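(* Let $n\ge 2$, let $1\le k\le n$ be integers, and let $\Omega\subset\mathbb{R}^n$ be open. Let $\mathcal{D}$ be a $k$-distribution of class $C^1$ on $\Omega$ and let $T$ be an integral $k$-current on $\Omega$. Write $T=[\![R,\eta,\theta]\!]$ and $\partial T=[\![R',\eta',\theta']\!]$ (the boundary of an integral current being integral), with $\theta|_R$ and $\theta'|_{R'}$ positive and integer-valued. Let $\mathcal{J}$ be the set of all $x\in\Omega$ such that $$\lim_{r\to 0+}\frac{\int_{B_r(x)\cap(R\setminus\Gamma(\eta,\mathcal{D}))}\theta\,d\mathcal{H}^k}{r^{k+1}}=\lim_{r\to 0+}\frac{\int_{B_r(x)\cap(R'\setminus\Gamma(\eta',\mathcal{D}))}\theta'\,d\mathcal{H}^{k-1}}{r^{k}}=0.$$ Then $\mathcal{D}$ is involutive at $(\mathcal{H}^k\llcorner R)$-a.e. $x\in\mathcal{J}$.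
   Context: $B_r(x)$ is the open ball of radius $r$ centered at $x$ and $\mathcal{H}^h$ is the $h$-dimensional Hausdorff measure on $\mathbb{R}^n$. $\wedge_h(\mathbb{R}^n)$ and $\wedge^h(\mathbb{R}^n)$ are the spaces of $h$-vectors and $h$-covectors, with the standard duality $\langle\cdot;\cdot\rangle$ (standard bases $e_{\mathbf i}$ and $dx_{\mathbf i}$ dual to each other). Interior multiplication and span: for $v\in\wedge_h(\mathbb{R}^n)$ and $\alpha\in\wedge^p(\mathbb{R}^n)$ with $p\le h$, $v\llcorner\alpha\in\wedge_{h-p}(\mathbb{R}^n)$ is defined by $\langle v\llcorner\alpha;\beta\rangle=\langle v;\alpha\wedge\beta\rangle$ for all $\beta\in\wedge^{h-p}(\mathbb{R}^n)$. For $h\ge1$, $\mathrm{span}(v):=\{v\llcorner\alpha\mid\alpha\in\wedge^{h-1}(\mathbb{R}^n)\}\subset\mathbb{R}^n$; it is the smallest linear subspace $W$ with $v\in\wedge_h(W)$ (if $v=v_1\wedge\dots\wedge v_h\ne0$, it is the $h$-plane generated by $v_1,\dots,v_h$). The span of a $0$-vector is $\{0\}$. Currents: an $h$-current on $\Omega$ is a continuous linear functional on the space $\mathcal{E}_h$ of smooth compactly supported differential $h$-forms on $\Omega$. Its boundary is given by $\langle\partial T;\omega\rangle=\langle T;d\omega\rangle$ for $\omega\in\mathcal{E}_{h-1}$, and its mass is $\mathbb{M}(T)=\sup\{\langle T;\omega\rangle\mid\omega\in\mathcal{E}_h,\ |\omega(x)|\le1\ \forall x\in\Omega\}$. A set is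 $h$-rectifiable if it can be covered, up to an $\mathcal{H}^h$-null set, by countably many $h$-dimensional $C^1$ surfaces. An $h$-current $T$ is rectifiable, written $T=[\![R,\eta,\theta]\!]$, if $\langle T;\omega\rangle=\int_R\langle\eta;\omega\rangle\,\theta\,d\mathcal{H}^h$ for all $\omega\in\mathcal{E}_h$, where $\theta\in L^1(\mathcal{H}^h)$, $R=\{x\in\Omega\mid\theta(x)\neq0\}$ is $h$-rectifiable, and $\eta$ is a (Borel) unit simple $h$-vectorfield such that $\mathrm{span}(\eta(x))$ is the approximate tangent $h$-plane to $R$ at $x$ for $\mathcal{H}^h$-a.e. $x\in R$. $T$ is integral if it is rectifiable, $\theta|_R$ is positive and integer-valued, and $\mathbb{M}(\partial T)<+\infty$; in that case $\partial T$ is also integral. Distributions: a $k$-distribution $\mathcal{D}$ on $\Omega$ assigns to each $x\in\Omega$ a $k$-dimensional linear subspace $\mathcal{D}(x)\subset\mathbb{R}^n$. It is of class $C^p$ if every $x\in\Omega$ has a neighborhood $U\subset\Omega$ with $C^p$ differential $1$-forms $\omega^{(1)},\dots,\omega^{(n-k)}$ on $U$ (called defining forms) such that $\mathcal{D}(y)=\bigcap_{j=1}^{n-k}\ker\omega^{(j)}_y$ for all $y\in U$. A $k$-distribution $\mathcal{D}$ of class $C^1$ is involutive at $x$ if there is a family of ($C^1$) defining forms in a neighborhood of $x$ with $(d\omega^{(j)})_x|_{\mathcal{D}(x)\times\mathcal{D}(x)}=0$ for all $j=1,\dots,n-k$ (this does not depend on the choice of defining forms). Tangency set: for an $h$-vectorfield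 $\tau$ on $\Omega$ with $h\le k$, $\Gamma(\tau,\mathcal{D}):=\{x\in\Omega\mid\mathrm{span}(\tau(x))\subset\mathcal{D}(x)\}$. *)

theory Defs
  imports "HOL-Analysis.Analysis"
begin

section \<open>Multivectors and multicovectors\<close>

text \<open>
  The whole exterior algebra is \<^typ>\<open>real ^ 'n set\<close>: the component at
  \<open>I = {i\<^sub>1 < \<dots> < i\<^sub>h}\<close> is the coefficient of \<open>e\<^sub>I\<close>
  (of \<open>dx\<^sub>I\<close> for covectors). The bases \<open>e\<^sub>I\<close> and \<open>dx\<^sub>I\<close> are dual to each other, so the
  duality pairing is the inner product of coordinates, and the norm is the Euclidean one.
  The linear order of the index type only serves to fix the signs.
\<close>

type_synonym 'n euclid = "real ^ 'n"
type_synonym 'n exterior = "real ^ 'n set"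

definition graded :: "nat \<Rightarrow> 'n::finite exterior set" where
  "graded h = {v. \<forall>I. v $ I \<noteq> 0 \<longrightarrow> card I = h}"

abbreviation pairing :: "'n::finite exterior \<Rightarrow> 'n exterior \<Rightarrow> real" where
  "pairing v \<alpha> \<equiv> v \<bullet> \<alpha>"

text \<open>For disjoint \<open>I\<close>, \<open>J\<close> one has \<open>e\<^sub>I \<and> e\<^sub>J = \<plusminus> e\<^bsub>I \<union> J\<^esub>\<close>, with the sign of the number of inversions.\<close>

definition wedge_sign :: "'n::linorder set \<Rightarrow> 'n set \<Rightarrow> real" where
  "wedge_sign I J = (-1) ^ card {(i, j). i \<in> I \<and> j \<in> J \<and> j < i}"

definition wedge :: "'n::{finite,linorder} exterior \<Rightarrow> 'n exterior \<Rightarrow> 'n exterior" where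
  "wedge v w = (\<chi> K. \<Sum>I\<in>Pow K. wedge_sign I (K - I) * v $ I * w $ (K - I))"

definition embed1 :: "'n euclid \<Rightarrow> 'n::finite exterior" where
  "embed1 x = (\<Sum>i\<in>UNIV. x $ i *\<^sub>R axis {i} 1)"

definition wedge_list :: "'n euclid list \<Rightarrow> 'n::{finite,linorder} exterior" where
  "wedge_list vs = foldr (\<lambda>x w. wedge (embed1 x) w) vs (axis {} 1)"

text \<open>The scalar factor only matters for \<open>h = 0\<close>, where every \<open>0\<close>-vector is simple.\<close>

definition simple_vector :: "nat \<Rightarrow> 'n::{finite,linorder} exterior \<Rightarrow> bool" where
  "simple_vector h v \<longleftrightarrow> (\<exists>c vs. length vs = h \<and> v = c *\<^sub>R wedge_list vs)"

text \<open>The interior product, given by its values on the basis covectors; see \<open>pairing_interior\<close>.\<close>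

definition interior_mult :: "'n::{finite,linorder} exterior \<Rightarrow> 'n exterior \<Rightarrow> 'n exterior" where
  "interior_mult v \<alpha> = (\<chi> J. pairing v (wedge \<alpha> (axis J 1)))"

definition mv_span :: "nat \<Rightarrow> 'n::{finite,linorder} exterior \<Rightarrow> 'n euclid set" where
  "mv_span h v = (if h = 0 then {0}
     else {x. \<exists>\<alpha>\<in>graded (h - 1). embed1 x = interior_mult v \<alpha>})"

lemma linear_wedge_right: "linear (wedge \<alpha>)"
  by (rule linearI)
     (simp_all add: wedge_def vec_eq_iff algebra_simps sum.distrib sum_distrib_left)

lemma pairing_interior: "pairing (interior_mult v \<alpha>) \<beta> = pairing v (wedge \<alpha> \<beta>)"
proof -
  interpret linear "wedge \<alpha>" by (rule linear_wedge_right)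
  have "\<beta> = (\<Sum>J\<in>UNIV. \<beta> $ J *\<^sub>R axis J 1)"
    by (simp add: vec_eq_iff axis_def if_distrib cong: if_cong)
  then have "wedge \<alpha> \<beta> = (\<Sum>J\<in>UNIV. \<beta> $ J *\<^sub>R wedge \<alpha> (axis J 1))"
    by (metis (no_types, lifting) sum scale sum.cong)
  then have "pairing v (wedge \<alpha> \<beta>) = (\<Sum>J\<in>UNIV. \<beta> $ J * pairing v (wedge \<alpha> (axis J 1)))"
    by (simp add: inner_sum_right)
  then show ?thesis
    unfolding inner_vec_def[of "interior_mult v \<alpha>"] by (simp add: interior_mult_def mult.commute)
qed


section \<open>Hausdorff measure\<close>

text \<open>
  The normalising constant makes \<open>h\<close>-dimensional Hausdorff measure agree with Lebesgue
  measure on \<open>h\<close>-planes. The empty set needs a separate clause because \<open>0 ^ 0 = 1\<close>;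
  the covering sets are required to be bounded because \<^const>\<open>diameter\<close> is
  meaningless otherwise.
\<close>

definition hausdorff_gauge :: "nat \<Rightarrow> 'a::metric_space set \<Rightarrow> ennreal" where
  "hausdorff_gauge h A =
     (if A = {} then 0 else ennreal (unit_ball_vol (real h) * (diameter A / 2) ^ h))"

definition hausdorff_covers :: "real \<Rightarrow> 'a::metric_space set \<Rightarrow> (nat \<Rightarrow> 'a set) set" where
  "hausdorff_covers \<delta> E =
     {A. E \<subseteq> (\<Union>i. A i) \<and> (\<forall>i. bounded (A i) \<and> diameter (A i) \<le> \<delta>)}"

definition hausdorff_pre :: "nat \<Rightarrow> real \<Rightarrow> 'a::metric_space set \<Rightarrow> ennreal" where
  "hausdorff_pre h \<delta> E = (INF A\<in>hausdorff_covers \<delta> E. \<Sum>i. hausdorff_gauge h (A i))"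

definition hausdorff_outer :: "nat \<Rightarrow> 'a::metric_space set \<Rightarrow> ennreal" where
  "hausdorff_outer h E = (SUP \<delta>\<in>{0<..}. hausdorff_pre h \<delta> E)"

text \<open>As a measure, it lives on the sets that are measurable in the sense of Caratheodory.\<close>

definition hausdorff_measure :: "nat \<Rightarrow> 'a::metric_space measure" where
  "hausdorff_measure h =
     measure_of UNIV (lambda_system UNIV UNIV (hausdorff_outer h)) (hausdorff_outer h)"

lemma hausdorff_pre_empty:
  assumes "\<delta> > 0"
  shows "hausdorff_pre h \<delta> ({} :: 'a::metric_space set) = 0"
proof -
  have "(\<lambda>_. {} :: 'a set) \<in> hausdorff_covers \<delta> {}"
    using assms by (simp add: hausdorff_covers_def)
  then have "hausdorff_pre h \<delta> ({} :: 'a set) \<le> (\<Sum>i::nat. hausdorff_gauge h ({} :: 'a set))"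
    unfolding hausdorff_pre_def by (intro INF_lower2[of "\<lambda>_. {}"]) auto
  then show ?thesis by (simp add: hausdorff_gauge_def)
qed

lemma hausdorff_pre_mono: "E \<subseteq> F \<Longrightarrow> hausdorff_pre h \<delta> E \<le> hausdorff_pre h \<delta> F"
  unfolding hausdorff_pre_def hausdorff_covers_def by (intro INF_superset_mono) auto

lemma hausdorff_pre_subadditive:
  "hausdorff_pre h \<delta> (\<Union>i. E i) \<le> (\<Sum>i. hausdorff_pre h \<delta> (E i))" (is "?l \<le> ?r")
proof (rule ennreal_le_epsilon)
  fix e :: real assume fin: "?r < top" and e: "0 < e"
  have e': "0 < ennreal (e * (1/2) ^ Suc i)" for i using e by simp
  have "\<exists>A. A \<in> hausdorff_covers \<delta> (E i) \<and>
          (\<Sum>j. hausdorff_gauge h (A j)) \<le> hausdorff_pre h \<delta> (E i) + ennreal (e * (1/2) ^ Suc i)" for i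
  proof -
    have "hausdorff_pre h \<delta> (E i) < top"
      using fin by (metis ennreal_suminf_lessD)
    then have "hausdorff_pre h \<delta> (E i) < hausdorff_pre h \<delta> (E i) + ennreal (e * (1/2) ^ Suc i)"
      using ennreal_add_left_cancel_less[of "hausdorff_pre h \<delta> (E i)" 0] e'
      by (simp only: add_0_right infinity_ennreal_def) auto
    then show ?thesis
      unfolding hausdorff_pre_def[of h \<delta> "E i"] INF_less_iff by (blast intro: less_imp_le)
  qed
  then obtain A where A: "\<And>i. A i \<in> hausdorff_covers \<delta> (E i)"
    and le: "\<And>i. (\<Sum>j. hausdorff_gauge h (A i j))
               \<le> hausdorff_pre h \<delta> (E i) + ennreal (e * (1/2) ^ Suc i)"
    by metis
  define B where "B = (\<lambda>m. case prod_decode m of (i, j) \<Rightarrow> A i j)"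
  have "B \<in> hausdorff_covers \<delta> (\<Union>i. E i)"
  proof -
    have "x \<in> (\<Union>m. B m)" if x: "x \<in> E i" for x i
    proof -
      from A[of i] x obtain j where "x \<in> A i j" by (auto simp: hausdorff_covers_def)
      then have "x \<in> B (prod_encode (i, j))" by (simp add: B_def)
      then show ?thesis by blast
    qed
    moreover have "bounded (B m) \<and> diameter (B m) \<le> \<delta>" for m
      using A by (auto simp: B_def hausdorff_covers_def split: prod.split)
    ultimately show ?thesis by (auto simp: hausdorff_covers_def)
  qed
  then have "?l \<le> (\<Sum>m. hausdorff_gauge h (B m))"
    unfolding hausdorff_pre_def by (rule INF_lower)
  also have "\<dots> = (\<Sum>i. \<Sum>j. hausdorff_gauge h (A i j))"
  proof -
    have "(\<lambda>m. hausdorff_gauge h (B m)) = (\<lambda>(i, j). hausdorff_gauge h (A i j)) \<circ> prod_decode"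
      by (auto simp: B_def fun_eq_iff split: prod.split)
    then show ?thesis
      using suminf_ennreal_2dimen[of "\<lambda>i. \<Sum>j. hausdorff_gauge h (A i j)"
          "\<lambda>(i, j). hausdorff_gauge h (A i j)"]
      by (simp add: o_def)
  qed
  also have "\<dots> \<le> (\<Sum>i. hausdorff_pre h \<delta> (E i) + ennreal (e * (1/2) ^ Suc i))"
    by (intro suminf_le le) auto
  also have "\<dots> = ?r + (\<Sum>i. ennreal (e * (1/2) ^ Suc i))"
    by (intro suminf_add[symmetric]) auto
  also have "(\<Sum>i. ennreal (e * (1/2) ^ Suc i)) = ennreal e"
    using e power_half_series[THEN sums_mult, of e]
    by (subst suminf_ennreal_eq[where x = e]) auto
  finally show "?l \<le> ?r + ennreal e" .
qed

lemma hausdorff_outer_measure_space: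
  "outer_measure_space UNIV (hausdorff_outer h :: 'a::metric_space set \<Rightarrow> ennreal)"
  unfolding outer_measure_space_def
proof (intro conjI)
  show "positive UNIV (hausdorff_outer h :: 'a set \<Rightarrow> ennreal)"
    by (simp add: positive_def hausdorff_outer_def hausdorff_pre_empty)
  show "increasing UNIV (hausdorff_outer h :: 'a set \<Rightarrow> ennreal)"
    unfolding increasing_def hausdorff_outer_def
    by (intro ballI impI SUP_subset_mono order_refl hausdorff_pre_mono)
  show "countably_subadditive UNIV (hausdorff_outer h :: 'a set \<Rightarrow> ennreal)"
    unfolding countably_subadditive_def
  proof (intro allI impI)
    fix E :: "nat \<Rightarrow> 'a set"
    show "hausdorff_outer h (\<Union>i. E i) \<le> (\<Sum>i. hausdorff_outer h (E i))"
      unfolding hausdorff_outer_def[of h "\<Union>i. E i"]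
    proof (rule SUP_least)
      fix \<delta> :: real assume "\<delta> \<in> {0<..}"
      then have "hausdorff_pre h \<delta> (E i) \<le> hausdorff_outer h (E i)" for i
        unfolding hausdorff_outer_def by (rule SUP_upper)
      then show "hausdorff_pre h \<delta> (\<Union>i. E i) \<le> (\<Sum>i. hausdorff_outer h (E i))"
        by (intro order_trans[OF hausdorff_pre_subadditive] suminf_le) auto
    qed
  qed
qed

lemma hausdorff_measure_space:
  "measure_space UNIV (lambda_system UNIV UNIV (hausdorff_outer h))
     (hausdorff_outer h :: 'a::metric_space set \<Rightarrow> ennreal)"
proof -
  interpret sigma_algebra UNIV "UNIV :: 'a set set"
    using sigma_algebra_Pow[of "UNIV :: 'a set"] by simp
  show ?thesis
    using caratheodory_lemma[OF hausdorff_outer_measure_space] .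
qed

lemma sets_hausdorff_measure:
  "sets (hausdorff_measure h :: 'a::metric_space measure) = lambda_system UNIV UNIV (hausdorff_outer h)"
proof -
  have "sigma_algebra UNIV (lambda_system UNIV UNIV (hausdorff_outer h :: 'a set \<Rightarrow> _))"
    using hausdorff_measure_space unfolding measure_space_def by blast
  then show ?thesis
    unfolding hausdorff_measure_def by (rule sigma_algebra.sets_measure_of_eq)
qed

lemma emeasure_hausdorff_measure:
  assumes "A \<in> sets (hausdorff_measure h :: 'a::metric_space measure)"
  shows "emeasure (hausdorff_measure h) A = hausdorff_outer h A"
  using assms[unfolded sets_hausdorff_measure] hausdorff_measure_space[of h, where 'a = 'a]
  unfolding hausdorff_measure_def measure_space_def
  by (intro emeasure_measure_of_sigma) blast+


section \<open>Differentiability and differential forms\<close>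

definition partial :: "'n \<Rightarrow> ('n::finite euclid \<Rightarrow> 'b::real_normed_vector) \<Rightarrow> 'n euclid \<Rightarrow> 'b" where
  "partial i f x = frechet_derivative f (at x) (axis i 1)"

text \<open>To be used on open sets only.\<close>

fun C_on :: "nat \<Rightarrow> ('n::finite euclid \<Rightarrow> 'b::real_normed_vector) \<Rightarrow> 'n euclid set \<Rightarrow> bool" where
  "C_on 0 f U \<longleftrightarrow> continuous_on U f"
| "C_on (Suc p) f U \<longleftrightarrow> f differentiable_on U \<and> (\<forall>i. C_on p (partial i f) U)"

definition ext_deriv ::
    "('n euclid \<Rightarrow> 'n exterior) \<Rightarrow> 'n euclid \<Rightarrow> 'n::{finite,linorder} exterior" where
  "ext_deriv \<omega> x = (\<Sum>i\<in>UNIV. wedge (axis {i} 1) (partial i \<omega> x))"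

text \<open>Compactly supported forms on \<open>\<Omega>\<close> are extended by zero to the whole space.\<close>

definition test_forms :: "'n euclid set \<Rightarrow> nat \<Rightarrow> ('n euclid \<Rightarrow> 'n::finite exterior) set" where
  "test_forms \<Omega> h = {\<omega>. (\<forall>p. C_on p \<omega> UNIV) \<and> (\<forall>x. \<omega> x \<in> graded h) \<and>
     (\<exists>K. compact K \<and> K \<subseteq> \<Omega> \<and> (\<forall>x. x \<notin> K \<longrightarrow> \<omega> x = 0))}"


section \<open>Currents\<close>

type_synonym 'n functional = "('n euclid \<Rightarrow> 'n exterior) \<Rightarrow> real"

text \<open>
  Convergence of test forms: supports in a common compact subset of \<open>\<Omega>\<close>, and uniform
  convergence of the derivatives \<open>\<partial>\<^bsub>i\<^sub>1\<^esub> \<dots> \<partial>\<^bsub>i\<^sub>m\<^esub>\<close> of every order.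
\<close>

definition test_converges ::
    "'n euclid set \<Rightarrow> (nat \<Rightarrow> 'n euclid \<Rightarrow> 'n::finite exterior) \<Rightarrow>
     ('n euclid \<Rightarrow> 'n exterior) \<Rightarrow> bool" where
  "test_converges \<Omega> \<omega>s \<omega> \<longleftrightarrow>
     (\<exists>K. compact K \<and> K \<subseteq> \<Omega> \<and> (\<forall>m x. x \<notin> K \<longrightarrow> \<omega>s m x = 0)) \<and>
     (\<forall>is. uniform_limit UNIV (\<lambda>m. foldr partial is (\<omega>s m)) (foldr partial is \<omega>) sequentially)"

text \<open>
  The space of test forms carries the usual inductive limit topology. A linear functional is
  continuous for it iff its restriction to the forms supported in each compact \<open>K \<subseteq> \<Omega>\<close>
  is, and these spaces are metrizable; hence sequences suffice.
\<close>

definition current :: "'n euclid set \<Rightarrow> nat \<Rightarrow> 'n::finite functional \<Rightarrow> bool" where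
  "current \<Omega> h T \<longleftrightarrow>
     (\<forall>\<omega>\<in>test_forms \<Omega> h. \<forall>\<omega>'\<in>test_forms \<Omega> h. T (\<lambda>x. \<omega> x + \<omega>' x) = T \<omega> + T \<omega>') \<and>
     (\<forall>\<omega>\<in>test_forms \<Omega> h. \<forall>c. T (\<lambda>x. c *\<^sub>R \<omega> x) = c * T \<omega>) \<and>
     (\<forall>\<omega>s \<omega>. (\<forall>m. \<omega>s m \<in> test_forms \<Omega> h) \<and> \<omega> \<in> test_forms \<Omega> h \<and> test_converges \<Omega> \<omega>s \<omega>
        \<longrightarrow> (\<lambda>m. T (\<omega>s m)) \<longlonglongrightarrow> T \<omega>)"

definition boundary :: "'n::{finite,linorder} functional \<Rightarrow> 'n functional" where
  "boundary T \<omega> = T (ext_deriv \<omega>)"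

definition mass :: "'n euclid set \<Rightarrow> nat \<Rightarrow> 'n::finite functional \<Rightarrow> ereal" where
  "mass \<Omega> h T = (SUP \<omega>\<in>{\<omega>\<in>test_forms \<Omega> h. \<forall>x\<in>\<Omega>. norm (\<omega> x) \<le> 1}. ereal (T \<omega>))"


section \<open>Rectifiable sets and integral currents\<close>

text \<open>Embedded \<open>h\<close>-dimensional submanifolds, as local zero sets of \<open>n - h\<close> functions of class
  \<open>C\<^sup>1\<close> with linearly independent differentials.\<close>

definition C1_surface :: "nat \<Rightarrow> 'n::finite euclid set \<Rightarrow> bool" where
  "C1_surface h S \<longleftrightarrow> h \<le> CARD('n) \<and>
     (\<forall>x\<in>S. \<exists>U (g :: nat \<Rightarrow> 'n euclid \<Rightarrow> real). open U \<and> x \<in> U \<and>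
        (\<forall>j < CARD('n) - h. C_on 1 (g j) U) \<and>
        (\<forall>y\<in>U. \<forall>c. (\<forall>v. (\<Sum>j < CARD('n) - h. c j * frechet_derivative (g j) (at y) v) = 0)
            \<longrightarrow> (\<forall>j < CARD('n) - h. c j = (0::real))) \<and>
        S \<inter> U = {y\<in>U. \<forall>j < CARD('n) - h. g j y = 0})"

definition rectifiable_set :: "nat \<Rightarrow> 'n::finite euclid set \<Rightarrow> bool" where
  "rectifiable_set h R \<longleftrightarrow> (\<exists>S :: nat \<Rightarrow> 'n euclid set.
     (\<forall>i. C1_surface h (S i)) \<and> R - (\<Union>i. S i) \<in> null_sets (hausdorff_measure h))"

text \<open>
  The blow-ups \<open>(R - x) / r\<close> converge to \<open>W\<close> as \<open>r\<close> tends to \<open>0\<close>, weakly as measures.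
\<close>

definition approx_tangent_plane ::
    "nat \<Rightarrow> 'n::finite euclid set \<Rightarrow> 'n euclid \<Rightarrow> 'n euclid set \<Rightarrow> bool" where
  "approx_tangent_plane h R x W \<longleftrightarrow> subspace W \<and> dim W = h \<and>
     (\<exists>r>0. emeasure (hausdorff_measure h) (R \<inter> ball x r) < \<infinity>) \<and>
     (\<forall>\<phi> :: 'n euclid \<Rightarrow> real. continuous_on UNIV \<phi> \<and> (\<exists>K. compact K \<and> (\<forall>y. y \<notin> K \<longrightarrow> \<phi> y = 0)) \<longrightarrow>
        ((\<lambda>r. (LINT y:R|hausdorff_measure h. \<phi> ((y - x) /\<^sub>R r)) / r ^ h)
          \<longlongrightarrow> (LINT y:W|hausdorff_measure h. \<phi> y)) (at_right 0))"

text \<open>\<open>T = [[R, \<eta>, \<theta>]]\<close>. The orientation \<open>\<eta>\<close> matters on \<open>R\<close> only.\<close>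

definition rectifiable_repr ::
    "'n euclid set \<Rightarrow> nat \<Rightarrow> 'n::{finite,linorder} functional \<Rightarrow> 'n euclid set \<Rightarrow>
     ('n euclid \<Rightarrow> 'n exterior) \<Rightarrow> ('n euclid \<Rightarrow> real) \<Rightarrow> bool" where
  "rectifiable_repr \<Omega> h T R \<eta> \<theta> \<longleftrightarrow>
     set_integrable (hausdorff_measure h) \<Omega> \<theta> \<and>
     R = {x\<in>\<Omega>. \<theta> x \<noteq> 0} \<and> rectifiable_set h R \<and>
     \<eta> \<in> borel_measurable (restrict_space borel R) \<and>
     (\<forall>x\<in>R. simple_vector h (\<eta> x) \<and> norm (\<eta> x) = 1) \<and>
     (AE x in hausdorff_measure h. x \<in> R \<longrightarrow> approx_tangent_plane h R x (mv_span h (\<eta> x))) \<and>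
     (\<forall>\<omega>\<in>test_forms \<Omega> h.
        T \<omega> = (LINT x:R|hausdorff_measure h. pairing (\<eta> x) (\<omega> x) * \<theta> x))"

definition integral_repr ::
    "'n euclid set \<Rightarrow> nat \<Rightarrow> 'n::{finite,linorder} functional \<Rightarrow> 'n euclid set \<Rightarrow>
     ('n euclid \<Rightarrow> 'n exterior) \<Rightarrow> ('n euclid \<Rightarrow> real) \<Rightarrow> bool" where
  "integral_repr \<Omega> h T R \<eta> \<theta> \<longleftrightarrow>
     rectifiable_repr \<Omega> h T R \<eta> \<theta> \<and> (\<forall>x\<in>R. \<theta> x > 0 \<and> \<theta> x \<in> \<int>)"

text \<open>There is no condition on the boundary of a \<open>0\<close>-current.\<close>

definition integral_current ::
    "'n euclid set \<Rightarrow> nat \<Rightarrow> 'n::{finite,linorder} functional \<Rightarrow> bool" where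
  "integral_current \<Omega> h T \<longleftrightarrow> current \<Omega> h T \<and> (\<exists>R \<eta> \<theta>. integral_repr \<Omega> h T R \<eta> \<theta>) \<and>
     (h \<ge> 1 \<longrightarrow> mass \<Omega> (h - 1) (boundary T) < \<infinity>)"


section \<open>Distributions of planes\<close>

definition distribution :: "'n::finite euclid set \<Rightarrow> nat \<Rightarrow> ('n euclid \<Rightarrow> 'n euclid set) \<Rightarrow> bool" where
  "distribution \<Omega> k D \<longleftrightarrow> (\<forall>x\<in>\<Omega>. subspace (D x) \<and> dim (D x) = k)"

definition defining_forms ::
    "nat \<Rightarrow> nat \<Rightarrow> ('n euclid \<Rightarrow> 'n euclid set) \<Rightarrow> 'n euclid set \<Rightarrow>
     (nat \<Rightarrow> 'n euclid \<Rightarrow> 'n::finite exterior) \<Rightarrow> bool" where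
  "defining_forms p k D U \<omega> \<longleftrightarrow>
     (\<forall>j < CARD('n) - k. C_on p (\<omega> j) U \<and> (\<forall>y\<in>U. \<omega> j y \<in> graded 1)) \<and>
     (\<forall>y\<in>U. D y = {v. \<forall>j < CARD('n) - k. pairing (embed1 v) (\<omega> j y) = 0})"

definition distribution_of_class ::
    "nat \<Rightarrow> 'n::finite euclid set \<Rightarrow> nat \<Rightarrow> ('n euclid \<Rightarrow> 'n euclid set) \<Rightarrow> bool" where
  "distribution_of_class p \<Omega> k D \<longleftrightarrow> distribution \<Omega> k D \<and>
     (\<forall>x\<in>\<Omega>. \<exists>U \<omega>. open U \<and> x \<in> U \<and> U \<subseteq> \<Omega> \<and> defining_forms p k D U \<omega>)"

definition involutive_at ::
    "'n::{finite,linorder} euclid set \<Rightarrow> nat \<Rightarrow> ('n euclid \<Rightarrow> 'n euclid set) \<Rightarrow> 'n euclid \<Rightarrow> bool" where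
  "involutive_at \<Omega> k D x \<longleftrightarrow>
     (\<exists>U \<omega>. open U \<and> x \<in> U \<and> U \<subseteq> \<Omega> \<and> defining_forms 1 k D U \<omega> \<and>
        (\<forall>j < CARD('n) - k. \<forall>v\<in>D x. \<forall>w\<in>D x.
           pairing (wedge (embed1 v) (embed1 w)) (ext_deriv (\<omega> j) x) = 0))"

definition tangency_set ::
    "'n euclid set \<Rightarrow> nat \<Rightarrow> ('n euclid \<Rightarrow> 'n::{finite,linorder} exterior) \<Rightarrow>
     ('n euclid \<Rightarrow> 'n euclid set) \<Rightarrow> 'n euclid set" where
  "tangency_set \<Omega> h \<tau> D = {x\<in>\<Omega>. mv_span h (\<tau> x) \<subseteq> D x}"

end

theory Submission
  imports Defs
begin

text \<open>
  At almost every point \<open>x\<close> of \<open>R \<inter> J\<close>, test the identity \<open>\<langle>\<partial>T; \<zeta>\<rangle> = \<langle>T; d\<zeta>\<rangle>\<close> with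
  \<open>\<zeta> = \<phi>\<^sub>r \<omega>' \<and> \<alpha>\<close>, where \<open>\<phi>\<^sub>r\<close> is a smooth bump on \<open>B\<^sub>r(x)\<close>, \<open>\<alpha>\<close> a constant
  \<open>(k - 2)\<close>-covector and \<open>\<omega>'\<close> the first order Taylor polynomial at \<open>x\<close> of a defining form \<open>\<omega>\<close>;
  being affine, \<open>\<omega>'\<close> is smooth although \<open>\<omega>\<close> is only \<open>C\<^sup>1\<close>. A form \<open>\<omega> \<and> \<beta>\<close> vanishes on the
  tangent part of a current, so by the density assumptions and \<open>\<omega>' - \<omega> = o(r)\<close> all terms are
  \<open>o(r\<^sup>k)\<close> except \<open>\<integral> \<phi>\<^sub>r \<langle>\<eta>; d\<omega>(x) \<and> \<alpha>\<rangle> \<theta>\<close>. The error on the boundary is controlled because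
  a finite Borel measure has finite upper \<open>k\<close>-density almost everywhere. At a Lebesgue point of
  \<open>\<theta> \<eta>\<close> where \<open>R\<close> has positive upper density this forces \<open>\<langle>\<eta>(x); d\<omega>(x) \<and> \<alpha>\<rangle> = 0\<close> for all
  \<open>\<alpha>\<close>. The same argument with \<open>\<phi>\<^sub>r \<omega>(x) \<and> \<beta>\<close> gives \<open>span(\<eta>(x)) = D(x)\<close>, whence \<open>d\<omega>(x)\<close>
  vanishes on \<open>D(x)\<close>.
\<close>

section \<open>Hausdorff measure and densities\<close>

text \<open>The exponents are dictated by the bump, whose gradient has size \<open>4 / r\<close>. In
  d\<zeta> this factor multiplies the Taylor error o(r) on a mass O(r^k), and a nontangential mass
  that the exponent k + 1 makes o(r^(k+1)); both products are o(r^k). An affine \<omega>' is the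
  lowest order that keeps d\<omega>(x): a constant one has zero differential. On the boundary the
  bump is not differentiated, so the exponent k is enough there although \<open>R'\<close> has
  dimension k - 1.

  The set \<open>R\<close> is known only to be Caratheodory measurable, and its densities are
  estimated by coverings: fivefold Vitali balls give upper bounds, nearly optimal covers a lower
  one. The lower bound holds merely along some sequence of radii and with a constant that is not
  sharp. This is enough, because every smallness statement holds for all small radii and thus meets
  that sequence.

  Products of covectors are bracketed to the right, with factors of degree one in front, so that
  contraction peels off one factor at a time.

  The covector \<alpha> has degree k - 2, hence k = 1 is treated apart.\<close>

lemma hausdorff_pre_antimono: "\<delta> \<le> \<epsilon> \<Longrightarrow> hausdorff_pre h \<epsilon> E \<le> hausdorff_pre h \<delta> E"
  unfolding hausdorff_pre_def hausdorff_covers_def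
  by (intro INF_superset_mono) (auto intro: order_trans)

lemma hausdorff_outer_mono: "E \<subseteq> F \<Longrightarrow> hausdorff_outer h E \<le> hausdorff_outer h F"
  unfolding hausdorff_outer_def by (intro SUP_subset_mono order_refl hausdorff_pre_mono)

lemma hausdorff_outer_empty [simp]: "hausdorff_outer h {} = 0"
  by (simp add: hausdorff_outer_def hausdorff_pre_empty)

lemma hausdorff_pre_le_outer: "\<delta> > 0 \<Longrightarrow> hausdorff_pre h \<delta> E \<le> hausdorff_outer h E"
  unfolding hausdorff_outer_def by (rule SUP_upper) simp

lemma hausdorff_outer_subadditive:
  "hausdorff_outer h (\<Union>i. E i) \<le> (\<Sum>i. hausdorff_outer h (E i :: 'a::metric_space set))"
  unfolding hausdorff_outer_def[of h "\<Union>i. E i"]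
proof (rule SUP_least)
  fix \<delta> :: real assume "\<delta> \<in> {0<..}"
  then show "hausdorff_pre h \<delta> (\<Union>i. E i) \<le> (\<Sum>i. hausdorff_outer h (E i))"
    by (intro order_trans[OF hausdorff_pre_subadditive] suminf_le hausdorff_pre_le_outer) auto
qed

lemma hausdorff_outer_Un:
  "hausdorff_outer h (A \<union> B) \<le> hausdorff_outer h A + hausdorff_outer h (B :: 'a::metric_space set)"
proof -
  have "hausdorff_outer h (A \<union> B) = hausdorff_outer h (\<Union>i. binaryset A B i)"
    by (simp add: UN_binaryset_eq)
  also have "\<dots> \<le> (\<Sum>i. hausdorff_outer h (binaryset A B i))"
    by (rule hausdorff_outer_subadditive)
  also have "\<dots> = hausdorff_outer h A + hausdorff_outer h B"
    by (rule suminf_binaryset_eq) simp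
  finally show ?thesis .
qed

lemma hausdorff_outer_SUP_nat:
  "hausdorff_outer h E = (SUP n. hausdorff_pre h (1 / real (Suc n)) E)"
proof (rule antisym)
  show "hausdorff_outer h E \<le> (SUP n. hausdorff_pre h (1 / real (Suc n)) E)"
    unfolding hausdorff_outer_def
  proof (rule SUP_least)
    fix \<delta> :: real assume "\<delta> \<in> {0<..}"
    then obtain n where "1 / real (Suc n) < \<delta>"
      using nat_approx_posE[of \<delta>] by auto
    then show "hausdorff_pre h \<delta> E \<le> (SUP n. hausdorff_pre h (1 / real (Suc n)) E)"
      by (intro SUP_upper2[of n] hausdorff_pre_antimono) auto
  qed
qed (auto intro!: SUP_least hausdorff_pre_le_outer)

section \<open>Hausdorff measure is a metric outer measure, so Borel sets are measurable\<close>

lemma hausdorff_outer_separated: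
  assumes d: "d > 0" and sep: "\<And>x y. x \<in> A \<Longrightarrow> y \<in> B \<Longrightarrow> d \<le> dist x y"
  shows "hausdorff_outer h A + hausdorff_outer h B \<le> hausdorff_outer h (A \<union> B)"
proof -
  have pre: "hausdorff_pre h \<delta> A + hausdorff_pre h \<delta> B \<le> hausdorff_pre h \<delta> (A \<union> B)"
    if \<delta>: "\<delta> > 0" "\<delta> < d" for \<delta>
    unfolding hausdorff_pre_def[of h \<delta> "A \<union> B"]
  proof (rule INF_greatest)
    fix C assume C: "C \<in> hausdorff_covers \<delta> (A \<union> B)"
    \<comment> \<open>For \<delta> < d no covering set meets both A and B, so the cover splits into
      one of A and one of B. Discarded sets become empty and have gauge 0, also for h = 0.\<close>
    define CA where "CA i = (if C i \<inter> A = {} then {} else C i)" for i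
    define CB where "CB i = (if C i \<inter> B = {} then {} else C i)" for i
    have "C i \<inter> A = {} \<or> C i \<inter> B = {}" for i
    proof (rule ccontr)
      assume "\<not> ?thesis"
      then obtain x y where "x \<in> C i" "x \<in> A" "y \<in> C i" "y \<in> B" by blast
      moreover have "bounded (C i)" "diameter (C i) \<le> \<delta>"
        using C by (auto simp: hausdorff_covers_def)
      ultimately have "dist x y \<le> \<delta>"
        using diameter_bounded_bound by fastforce
      with sep[OF \<open>x \<in> A\<close> \<open>y \<in> B\<close>] \<delta> show False by simp
    qed
    then have "hausdorff_gauge h (CA i) + hausdorff_gauge h (CB i) \<le> hausdorff_gauge h (C i)" for i
      by (auto simp: CA_def CB_def hausdorff_gauge_def)
    then have "(\<Sum>i. hausdorff_gauge h (CA i) + hausdorff_gauge h (CB i)) \<le> (\<Sum>i. hausdorff_gauge h (C i))"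
      by (intro suminf_le) auto
    moreover have "(\<Sum>i. hausdorff_gauge h (CA i) + hausdorff_gauge h (CB i)) =
       (\<Sum>i. hausdorff_gauge h (CA i)) + (\<Sum>i. hausdorff_gauge h (CB i))"
      by (intro suminf_add[symmetric]) auto
    moreover have "hausdorff_pre h \<delta> A \<le> (\<Sum>i. hausdorff_gauge h (CA i))"
      unfolding hausdorff_pre_def using C \<delta>
      by (intro INF_lower) (fastforce simp: hausdorff_covers_def CA_def)
    moreover have "hausdorff_pre h \<delta> B \<le> (\<Sum>i. hausdorff_gauge h (CB i))"
      unfolding hausdorff_pre_def using C \<delta>
      by (intro INF_lower) (fastforce simp: hausdorff_covers_def CB_def)
    ultimately show "hausdorff_pre h \<delta> A + hausdorff_pre h \<delta> B \<le> (\<Sum>i. hausdorff_gauge h (C i))"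
      by (metis (no_types, lifting) add_mono order_trans)
  qed
  have inc: "incseq (\<lambda>n. hausdorff_pre h (1 / real (Suc n)) E)" for E :: "'a set"
    by (intro monoI hausdorff_pre_antimono) (simp add: field_simps)
  obtain N where N: "1 / real (Suc N) < d"
    using nat_approx_posE[OF d] by auto
  have "hausdorff_outer h A + hausdorff_outer h B =
      (SUP n. hausdorff_pre h (1 / real (Suc n)) A + hausdorff_pre h (1 / real (Suc n)) B)"
    unfolding hausdorff_outer_SUP_nat by (rule ennreal_SUP_add[OF inc inc, symmetric])
  also have "\<dots> \<le> hausdorff_outer h (A \<union> B)"
  proof (rule SUP_least)
    fix n
    define m where "m = max n N"
    have "1 / real (Suc m) \<le> 1 / real (Suc N)"
      by (simp add: m_def field_simps)
    with N have "1 / real (Suc m) < d" by simp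
    then have "hausdorff_pre h (1 / real (Suc m)) A + hausdorff_pre h (1 / real (Suc m)) B
        \<le> hausdorff_pre h (1 / real (Suc m)) (A \<union> B)"
      by (intro pre) auto
    also have "\<dots> \<le> hausdorff_outer h (A \<union> B)"
      by (rule hausdorff_pre_le_outer) simp
    finally show "hausdorff_pre h (1 / real (Suc n)) A + hausdorff_pre h (1 / real (Suc n)) B
        \<le> hausdorff_outer h (A \<union> B)"
      using add_mono[OF incseqD[OF inc, of n m A] incseqD[OF inc, of n m B]]
      by (simp add: m_def)
  qed
  finally show ?thesis .
qed

text \<open>The pieces are added one at a time; the finitely many distances from the earlier pieces
  to the next one have a positive minimum.\<close>

lemma hausdorff_outer_separated_sum:
  fixes P :: "nat \<Rightarrow> 'a::metric_space set"
  assumes "\<And>m n. m < n \<Longrightarrow> \<exists>d>0. \<forall>x\<in>P m. \<forall>y\<in>P n. d \<le> dist x y"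
  shows "(\<Sum>n<N. hausdorff_outer h (P n)) \<le> hausdorff_outer h (\<Union>n<N. P n)"
proof (induction N)
  case (Suc N)
  have "\<exists>d>0. \<forall>x\<in>(\<Union>n<M. P n). \<forall>y\<in>P N. d \<le> dist x y" if "M \<le> N" for M
    using that
  proof (induction M)
    case 0
    show ?case by (auto intro: exI[of _ 1])
  next
    case (Suc M)
    then obtain d1 where d1: "d1 > 0" "\<forall>x\<in>(\<Union>n<M. P n). \<forall>y\<in>P N. d1 \<le> dist x y" by auto
    obtain d2 where d2: "d2 > 0" "\<forall>x\<in>P M. \<forall>y\<in>P N. d2 \<le> dist x y"
      using assms[of M N] Suc by auto
    show ?case
      using d1 d2 by (intro exI[of _ "min d1 d2"]) (auto simp: lessThan_Suc min_le_iff_disj)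
  qed
  then obtain d where d: "d > 0" "\<forall>x\<in>(\<Union>n<N. P n). \<forall>y\<in>P N. d \<le> dist x y" by blast
  have "(\<Sum>n<Suc N. hausdorff_outer h (P n)) \<le>
      hausdorff_outer h (\<Union>n<N. P n) + hausdorff_outer h (P N)"
    using Suc by (simp add: add_mono)
  also have "\<dots> \<le> hausdorff_outer h ((\<Union>n<N. P n) \<union> P N)"
    using d by (intro hausdorff_outer_separated[of d]) auto
  also have "(\<Union>n<N. P n) \<union> P N = (\<Union>n<Suc N. P n)"
    by (auto simp: lessThan_Suc min_le_iff_disj)
  finally show ?case .
qed simp

text \<open>Caratheodory's criterion: the points of E at distance at least 1/(n+1) from F are
  separated from F, so the outer measure adds up there. The points of E - F left out lie in thin
  annuli around F whose total measure is the tail of a convergent series.\<close>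

lemma closed_in_sets_hausdorff:
  fixes F :: "'a::metric_space set"
  assumes F: "closed F"
  shows "F \<in> sets (hausdorff_measure h)"
proof (cases "F = {}")
  case ne: False
  let ?H = "hausdorff_outer h :: 'a set \<Rightarrow> ennreal"
  have main: "?H (F \<inter> E) + ?H (E - F) \<le> ?H E" if fin: "?H E < top" for E
  proof -
    define Q where "Q n = {x\<in>E. 1 / real (Suc n) \<le> infdist x F}" for n
    \<comment> \<open>Annuli whose indices differ by at least 2 are a positive distance apart. The
      even and the odd ones are therefore summed separately, and each of the two sums stays below
      the measure of E.\<close>
    define P where "P n = {x\<in>E. 1 / real (Suc (Suc n)) \<le> infdist x F \<and> infdist x F < 1 / real (Suc n)}" for n
    have sep: "1 / real (Suc m) - t \<le> dist x y"
      if "1 / real (Suc m) \<le> infdist x F" "infdist y F < t" for m t x y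
      using infdist_triangle[of x F y] that by (simp add: dist_commute)
    have ring: "(\<Sum>n. ?H (P (2 * n + i))) \<le> ?H E" for i
    proof (rule suminf_le_const)
      fix N
      have "\<exists>d>0. \<forall>x\<in>P (2 * m + i). \<forall>y\<in>P (2 * n + i). d \<le> dist x y" if "m < n" for m n
      proof (intro exI conjI ballI)
        have "1 / real (Suc (2 * n + i)) < 1 / real (Suc (Suc (2 * m + i)))"
          using that by (intro divide_strict_left_mono) auto
        then show "0 < 1 / real (Suc (Suc (2 * m + i))) - 1 / real (Suc (2 * n + i))" by simp
      next
        fix x y assume "x \<in> P (2 * m + i)" "y \<in> P (2 * n + i)"
        then show "1 / real (Suc (Suc (2 * m + i))) - 1 / real (Suc (2 * n + i)) \<le> dist x y"
          by (intro sep) (auto simp: P_def)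
      qed
      then have "(\<Sum>n<N. ?H (P (2 * n + i))) \<le> ?H (\<Union>n<N. P (2 * n + i))"
        by (rule hausdorff_outer_separated_sum)
      also have "\<dots> \<le> ?H E"
        by (rule hausdorff_outer_mono) (auto simp: P_def)
      finally show "(\<Sum>n<N. ?H (P (2 * n + i))) \<le> ?H E" .
    qed auto
    define c where "c n = ?H (P (2 * n)) + ?H (P (2 * n + 1))" for n
    have "(\<Sum>n. c n) = (\<Sum>n. ?H (P (2 * n + 0))) + (\<Sum>n. ?H (P (2 * n + 1)))"
      unfolding c_def by (subst suminf_add[symmetric]) auto
    also have "\<dots> < top"
      using ring[of 0] ring[of 1] fin by (auto simp: less_top[symmetric] top_unique)
    finally have cfin: "(\<Sum>n. c n) < top" .
    have tail: "(\<lambda>N. \<Sum>n. c (n + N)) \<longlonglongrightarrow> 0"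
    proof -
      have eq: "(\<Sum>n. c (n + N)) = (\<Sum>n. c n) - (\<Sum>n<N. c n)" for N
      proof -
        have "(\<Sum>n. c n) = (\<Sum>n. c (n + N)) + (\<Sum>n<N. c n)"
          by (rule suminf_offset) auto
        moreover have "(\<Sum>n<N. c n) < top"
          using cfin by (intro order_le_less_trans[OF sum_le_suminf[of c "{..<N}"]]) auto
        ultimately show ?thesis
          by (metis ennreal_add_diff_cancel_right infinity_ennreal_def less_irrefl)
      qed
      have "(\<lambda>N. (\<Sum>n. c n) - (\<Sum>n<N. c n)) \<longlonglongrightarrow> (\<Sum>n. c n) - (\<Sum>n. c n)"
        using cfin by (intro tendsto_diff_ennreal summable_LIMSEQ tendsto_const) auto
      then show ?thesis using cfin unfolding eq by simp
    qed
    have bound: "?H (F \<inter> E) + ?H (E - F) \<le> ?H E + (\<Sum>n. c (n + N))" for N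
    proof -
      have "E - F \<subseteq> Q (2 * N) \<union> (\<Union>n. P (2 * (n + N)) \<union> P (2 * (n + N) + 1))"
      proof
        fix x assume x: "x \<in> E - F"
        then have pos: "infdist x F > 0"
          using in_closed_iff_infdist_zero[OF F ne] infdist_nonneg[of x F] by (metis DiffD2 order_le_less)
        show "x \<in> Q (2 * N) \<union> (\<Union>n. P (2 * (n + N)) \<union> P (2 * (n + N) + 1))"
        proof (cases "1 / real (Suc (2 * N)) \<le> infdist x F")
          case True
          with x show ?thesis by (auto simp: Q_def)
        next
          case False
          obtain m0 where m0: "1 / real (Suc m0) < infdist x F"
            using nat_approx_posE[OF pos] by auto
          \<comment> \<open>The first level that x reaches. With m = p + 1, failure at level p puts
            x into the annulus \<open>P p\<close>.\<close>
          define m where "m = (LEAST m. 1 / real (Suc m) \<le> infdist x F)"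
          have m: "1 / real (Suc m) \<le> infdist x F"
            unfolding m_def by (rule LeastI[of _ m0]) (use m0 in auto)
          have "\<not> m \<le> 2 * N"
          proof
            assume "m \<le> 2 * N"
            then have "1 / real (Suc (2 * N)) \<le> 1 / real (Suc m)" by (simp add: field_simps)
            with m False show False by simp
          qed
          then obtain p where p: "m = Suc p" "2 * N \<le> p" by (cases m) auto
          have "\<not> 1 / real (Suc p) \<le> infdist x F"
            using not_less_Least[of p "\<lambda>m. 1 / real (Suc m) \<le> infdist x F"] p(1)
            unfolding m_def[symmetric] by simp
          with m p x have xp: "x \<in> P p" by (auto simp: P_def)
          \<comment> \<open>The truncated subtraction is exact because 2 N \<le> p.\<close>
          have "p = 2 * ((p div 2 - N) + N) \<or> p = 2 * ((p div 2 - N) + N) + 1"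
            using p(2) by auto
          with xp have "x \<in> P (2 * ((p div 2 - N) + N)) \<union> P (2 * ((p div 2 - N) + N) + 1)"
            by (metis UnI1 UnI2)
          then show ?thesis by blast
        qed
      qed
      then have "?H (E - F) \<le> ?H (Q (2 * N) \<union> (\<Union>n. P (2 * (n + N)) \<union> P (2 * (n + N) + 1)))"
        by (rule hausdorff_outer_mono)
      also have "\<dots> \<le> ?H (Q (2 * N)) + ?H (\<Union>n. P (2 * (n + N)) \<union> P (2 * (n + N) + 1))"
        by (rule hausdorff_outer_Un)
      also have "?H (\<Union>n. P (2 * (n + N)) \<union> P (2 * (n + N) + 1)) \<le> (\<Sum>n. ?H (P (2 * (n + N)) \<union> P (2 * (n + N) + 1)))"
        by (rule hausdorff_outer_subadditive)
      also have "\<dots> \<le> (\<Sum>n. c (n + N))"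
        unfolding c_def by (intro suminf_le hausdorff_outer_Un) auto
      finally have 1: "?H (E - F) \<le> ?H (Q (2 * N)) + (\<Sum>n. c (n + N))" by (simp add: add_mono)
      have "?H (F \<inter> E) + ?H (Q (2 * N)) \<le> ?H ((F \<inter> E) \<union> Q (2 * N))"
      proof (rule hausdorff_outer_separated)
        fix x y assume "x \<in> F \<inter> E" "y \<in> Q (2 * N)"
        then show "1 / real (Suc (2 * N)) \<le> dist x y"
          using infdist_le[of x F y] by (auto simp: Q_def dist_commute)
      qed simp
      also have "\<dots> \<le> ?H E"
        by (rule hausdorff_outer_mono) (auto simp: Q_def)
      finally have 2: "?H (F \<inter> E) + ?H (Q (2 * N)) \<le> ?H E" .
      have "?H (F \<inter> E) + ?H (E - F) \<le> ?H (F \<inter> E) + (?H (Q (2 * N)) + (\<Sum>n. c (n + N)))"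
        using 1 by (rule add_left_mono)
      also have "\<dots> \<le> ?H E + (\<Sum>n. c (n + N))"
        using add_right_mono[OF 2, of "\<Sum>n. c (n + N)"] by (simp add: add.assoc)
      finally show ?thesis .
    qed
    have "(\<lambda>N. ?H E + (\<Sum>n. c (n + N))) \<longlonglongrightarrow> ?H E + 0"
      by (intro tendsto_add tendsto_const tail)
    then show ?thesis
      using bound by (intro LIMSEQ_le_const[of _ "?H E"]) auto
  qed
  have "?H (F \<inter> E) + ?H ((UNIV - F) \<inter> E) = ?H E" for E
  proof (rule antisym)
    have *: "(UNIV - F) \<inter> E = E - F" by auto
    show "?H (F \<inter> E) + ?H ((UNIV - F) \<inter> E) \<le> ?H E"
      unfolding * using main[of E] by (cases "?H E < top") (auto simp: less_top[symmetric])
    have "?H E \<le> ?H ((F \<inter> E) \<union> ((UNIV - F) \<inter> E))" by (rule hausdorff_outer_mono) auto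
    also have "\<dots> \<le> ?H (F \<inter> E) + ?H ((UNIV - F) \<inter> E)" by (rule hausdorff_outer_Un)
    finally show "?H E \<le> ?H (F \<inter> E) + ?H ((UNIV - F) \<inter> E)" .
  qed
  then show ?thesis
    unfolding sets_hausdorff_measure lambda_system_def by simp
qed simp

section \<open>Measurable sets, null sets and Borel hulls\<close>

lemma space_hausdorff [simp]: "space (hausdorff_measure h) = UNIV"
  by (simp add: hausdorff_measure_def space_measure_of_conv)

lemma borel_subset_hausdorff: "sets borel \<subseteq> sets (hausdorff_measure h :: 'a::metric_space measure)"
proof -
  have "sets borel = sigma_sets UNIV (Collect (closed :: 'a set \<Rightarrow> bool))"
    by (simp add: borel_eq_closed sets_measure_of)
  also have "\<dots> \<subseteq> sets (hausdorff_measure h)"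
    using sets.sigma_sets_subset[of "Collect closed" "hausdorff_measure h :: 'a measure"]
    by (auto intro: closed_in_sets_hausdorff)
  finally show ?thesis .
qed

lemma borel_in_hausdorff [measurable (raw), intro]:
  "A \<in> sets borel \<Longrightarrow> A \<in> sets (hausdorff_measure h :: 'a::metric_space measure)"
  using borel_subset_hausdorff by blast

lemma borel_measurable_hausdorff:
  "f \<in> measurable borel N \<Longrightarrow> f \<in> measurable (hausdorff_measure h :: 'a::metric_space measure) N"
  using measurable_mono[of N N borel "hausdorff_measure h :: 'a measure"] borel_subset_hausdorff
  by auto

text \<open>The Caratheodory sigma-algebra is complete: a set of outer measure zero splits every
  set. Exceptional sets of a.e. statements are thus measurable automatically.\<close>

lemma null_sets_hausdorffI:
  assumes "hausdorff_outer h (N :: 'a::metric_space set) = 0"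
  shows "N \<in> null_sets (hausdorff_measure h)"
proof -
  let ?H = "hausdorff_outer h :: 'a set \<Rightarrow> ennreal"
  have "?H (N \<inter> E) + ?H ((UNIV - N) \<inter> E) = ?H E" for E
  proof (rule antisym)
    have 0: "?H (N \<inter> E) = 0"
      using hausdorff_outer_mono[of "N \<inter> E" N h] assms by simp
    then show "?H (N \<inter> E) + ?H ((UNIV - N) \<inter> E) \<le> ?H E"
      by (simp add: hausdorff_outer_mono)
    have "?H E \<le> ?H ((N \<inter> E) \<union> ((UNIV - N) \<inter> E))" by (rule hausdorff_outer_mono) auto
    also have "\<dots> \<le> ?H (N \<inter> E) + ?H ((UNIV - N) \<inter> E)" by (rule hausdorff_outer_Un)
    finally show "?H E \<le> ?H (N \<inter> E) + ?H ((UNIV - N) \<inter> E)" .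
  qed
  then have "N \<in> sets (hausdorff_measure h)"
    unfolding sets_hausdorff_measure lambda_system_def by simp
  then show ?thesis using assms by (simp add: null_sets_def emeasure_hausdorff_measure)
qed

lemma AE_hausdorffI:
  assumes "hausdorff_outer h {x :: 'a::metric_space. \<not> P x} = 0"
  shows "AE x in hausdorff_measure h. P x"
  using null_sets_hausdorffI[OF assms] by (intro AE_I'[of "{x. \<not> P x}"]) auto

lemma ennreal_eq_0I: "(\<And>e. e > 0 \<Longrightarrow> x \<le> ennreal e) \<Longrightarrow> x = 0"
  using ennreal_le_epsilon[of 0 x] by simp

lemma hausdorff_gauge_closure:
  "bounded A \<Longrightarrow> hausdorff_gauge h (closure A) = hausdorff_gauge h A"
  by (simp add: hausdorff_gauge_def diameter_closure)

text \<open>Closing the sets of nearly optimal covers keeps their diameters; the intersection of the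
  closed covers over all scales is Borel. The hull gives access to outer regularity for sets that
  are only Caratheodory measurable.\<close>

lemma hausdorff_outer_borel_hull:
  fixes A :: "'a::metric_space set"
  obtains B where "B \<in> sets borel" "A \<subseteq> B" "hausdorff_outer h B = hausdorff_outer h A"
proof (cases "hausdorff_outer h A = top")
  case True
  then have "hausdorff_outer h (UNIV :: 'a set) = hausdorff_outer h A"
    using hausdorff_outer_mono[of A UNIV h] by (simp add: top_unique)
  then show ?thesis using that[of UNIV] by simp
next
  case False
  have "\<exists>C. C \<in> hausdorff_covers (1 / real (Suc n)) A \<and>
      (\<Sum>i. hausdorff_gauge h (C i)) \<le> hausdorff_outer h A + ennreal (1 / real (Suc n))" for n
  proof -
    have le: "hausdorff_pre h (1 / real (Suc n)) A \<le> hausdorff_outer h A"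
      by (rule hausdorff_pre_le_outer) simp
    also have "\<dots> < hausdorff_outer h A + ennreal (1 / real (Suc n))"
      using False ennreal_add_left_cancel_less[of "hausdorff_outer h A" 0 "ennreal (1 / real (Suc n))"]
      by (simp add: less_top[symmetric])
    finally show ?thesis
      unfolding hausdorff_pre_def INF_less_iff by (blast intro: less_imp_le)
  qed
  then obtain C where C: "\<And>n. C n \<in> hausdorff_covers (1 / real (Suc n)) A"
    and Cle: "\<And>n. (\<Sum>i. hausdorff_gauge h (C n i)) \<le> hausdorff_outer h A + ennreal (1 / real (Suc n))"
    by metis
  define B where "B = (\<Inter>n. \<Union>i. closure (C n i))"
  have bd: "bounded (C n i)" "diameter (C n i) \<le> 1 / real (Suc n)" for n i
    using C by (auto simp: hausdorff_covers_def)
  have "B \<in> sets borel" unfolding B_def by measurable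
  moreover have AB: "A \<subseteq> B"
  proof
    fix x assume "x \<in> A"
    then have "\<exists>i. x \<in> C n i" for n using C[of n] by (auto simp: hausdorff_covers_def)
    then show "x \<in> B" unfolding B_def by (meson INT_I UN_I UNIV_I closure_subset subsetD)
  qed
  moreover have "hausdorff_outer h B \<le> hausdorff_outer h A"
  proof (rule ennreal_le_epsilon)
    fix e :: real assume e: "0 < e"
    show "hausdorff_outer h B \<le> hausdorff_outer h A + ennreal e"
      unfolding hausdorff_outer_SUP_nat[of h B]
    proof (rule SUP_least)
      fix n
      obtain N where N: "1 / real (Suc N) < e" using nat_approx_posE[OF e] by auto
      define m where "m = max n N"
      have m: "1 / real (Suc m) \<le> 1 / real (Suc n)" "1 / real (Suc m) \<le> 1 / real (Suc N)"
        unfolding m_def by (auto intro!: divide_left_mono)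
      have "(\<lambda>i. closure (C m i)) \<in> hausdorff_covers (1 / real (Suc n)) B"
        using bd[of m] m(1) by (auto simp: hausdorff_covers_def B_def diameter_closure intro: order_trans)
      then have "hausdorff_pre h (1 / real (Suc n)) B \<le> (\<Sum>i. hausdorff_gauge h (closure (C m i)))"
        unfolding hausdorff_pre_def by (rule INF_lower)
      also have "\<dots> \<le> hausdorff_outer h A + ennreal (1 / real (Suc m))"
        using Cle[of m] bd(1) by (simp add: hausdorff_gauge_closure)
      also have "\<dots> \<le> hausdorff_outer h A + ennreal e"
        using m N by (intro add_left_mono ennreal_leI) simp
      finally show "hausdorff_pre h (1 / real (Suc n)) B \<le> hausdorff_outer h A + ennreal e" .
    qed
  qed
  ultimately show ?thesis
    using that hausdorff_outer_mono[OF AB] by (metis antisym)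
qed

section \<open>Comparison of Hausdorff measure with densities\<close>

lemma hausdorff_pre_le_countable_cover:
  fixes S :: "'i \<Rightarrow> 'a::metric_space set"
  assumes "countable C" and "E \<subseteq> (\<Union>i\<in>C. S i)" and "\<delta> \<ge> 0"
    and bd: "\<And>i. i \<in> C \<Longrightarrow> bounded (S i) \<and> diameter (S i) \<le> \<delta>"
  shows "hausdorff_pre h \<delta> E \<le> (\<integral>\<^sup>+i. hausdorff_gauge h (S i) \<partial>count_space C)"
proof -
  let ?N = "to_nat_on C ` C"
  \<comment> \<open>The index set may be finite, so the remaining positions are filled with the
    empty set. Its diameter 0 is admissible because \<delta> \<ge> 0.\<close>
  define B where "B n = (if n \<in> ?N then S (from_nat_into C n) else {})" for n
  have "hausdorff_pre h \<delta> E \<le> (\<Sum>n. hausdorff_gauge h (B n))"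
    unfolding hausdorff_pre_def
  proof (rule INF_lower)
    have "x \<in> (\<Union>n. B n)" if x: "x \<in> E" for x
    proof -
      obtain i where "i \<in> C" "x \<in> S i" using x assms(2) by auto
      then have "x \<in> B (to_nat_on C i)" using assms(1) by (simp add: B_def)
      then show ?thesis by blast
    qed
    moreover have "bounded (B n) \<and> diameter (B n) \<le> \<delta>" for n
      using bd assms(1,3) by (auto simp: B_def)
    ultimately show "B \<in> hausdorff_covers \<delta> E" by (auto simp: hausdorff_covers_def)
  qed
  also have "\<dots> = (\<integral>\<^sup>+n. hausdorff_gauge h (B n) \<partial>count_space UNIV)"
    by (simp add: nn_integral_count_space_nat)
  also have "\<dots> = (\<integral>\<^sup>+n. hausdorff_gauge h (S (from_nat_into C n)) \<partial>count_space ?N)"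
    by (subst nn_integral_count_space_indicator[of ?N])
       (auto intro!: nn_integral_cong simp: B_def hausdorff_gauge_def indicator_def)
  also have "\<dots> = (\<integral>\<^sup>+i. hausdorff_gauge h (S i) \<partial>count_space C)"
    using inj_on_to_nat_on[OF assms(1)] assms(1)
    by (subst nn_integral_bij_count_space[symmetric, of "to_nat_on C" C])
       (auto intro!: nn_integral_cong simp: bij_betw_def)
  finally show ?thesis .
qed

text \<open>Vitali's covering lemma yields disjoint balls in U, each of mass at least t r^h, whose
  fivefold enlargements cover A. The gauge of an enlarged ball is then a constant times the mass of
  the original one, and the masses add up to at most that of U.\<close>

lemma hausdorff_outer_le_density:
  fixes \<nu> :: "'a::euclidean_space measure" and A :: "'a set"
  assumes [measurable_cong]: "sets \<nu> = sets borel" and U: "open U" "A \<subseteq> U" and t: "t > 0"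
    and dens: "\<And>x. x \<in> A \<Longrightarrow> \<exists>\<^sub>F r in at_right 0. ennreal (t * r ^ h) \<le> emeasure \<nu> (ball x r)"
  shows "hausdorff_outer h A \<le> ennreal (unit_ball_vol (real h) * 5 ^ h / t) * emeasure \<nu> U"
  unfolding hausdorff_outer_def
proof (rule SUP_least)
  fix \<delta> :: real assume "\<delta> \<in> {0<..}"
  then have \<delta>: "\<delta> > 0" by simp
  \<comment> \<open>Radii up to \<delta>/10 keep the diameter of the enlarged balls below \<delta>.
    The covering lemma takes closed balls, which inherit the mass bound from the open ones.\<close>
  define K where "K = {(x, r). x \<in> A \<and> 0 < r \<and> r \<le> \<delta> / 10 \<and> cball x r \<subseteq> U \<and>
    ennreal (t * r ^ h) \<le> emeasure \<nu> (cball x r)}"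
  have cov: "A \<subseteq> (\<Union>i\<in>K. cball (fst i) (snd i))"
  proof
    fix x assume x: "x \<in> A"
    then obtain e where e: "e > 0" "cball x e \<subseteq> U"
      using U by (meson open_contains_cball subsetD)
    have "\<forall>\<^sub>F r in at_right (0::real). 0 < r \<and> r < min e (\<delta> / 10)"
      using e(1) \<delta> by (intro eventually_at_rightI[of 0 "min e (\<delta> / 10)"]) auto
    from frequently_eventually_frequently[OF dens[OF x] this]
    obtain r where r: "ennreal (t * r ^ h) \<le> emeasure \<nu> (ball x r)" "0 < r" "r < min e (\<delta> / 10)"
      using frequently_ex by blast
    have "emeasure \<nu> (ball x r) \<le> emeasure \<nu> (cball x r)"
      by (intro emeasure_mono) (auto simp: assms(1))
    moreover have "cball x r \<subseteq> cball x e" using r by (simp add: cball_subset_cball_iff)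
    ultimately have "(x, r) \<in> K" using r x e by (auto simp: K_def)
    then show "x \<in> (\<Union>i\<in>K. cball (fst i) (snd i))" using r by force
  qed
  have rad: "0 < snd i \<and> snd i \<le> \<delta> / 10" if "i \<in> K" for i
    using that by (auto simp: K_def)
  obtain C where C: "countable C" "C \<subseteq> K"
     "pairwise (\<lambda>i j. disjnt (cball (fst i) (snd i)) (cball (fst j) (snd j))) C"
     "A \<subseteq> (\<Union>i\<in>C. cball (fst i) (5 * snd i))"
    by (rule Vitali_covering_lemma_cballs[OF cov rad]; blast)
  let ?c = "unit_ball_vol (real h) * 5 ^ h / t"
  have "hausdorff_pre h \<delta> A \<le> (\<integral>\<^sup>+i. hausdorff_gauge h (cball (fst i) (5 * snd i)) \<partial>count_space C)"
    using C \<delta> by (intro hausdorff_pre_le_countable_cover) (auto simp: K_def)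
  also have "\<dots> \<le> (\<integral>\<^sup>+i. ennreal ?c * emeasure \<nu> (cball (fst i) (snd i)) \<partial>count_space C)"
  proof (rule nn_integral_mono)
    fix i assume "i \<in> space (count_space C)"
    then have i: "i \<in> K" using C by auto
    then have r: "snd i > 0" and le: "ennreal (t * snd i ^ h) \<le> emeasure \<nu> (cball (fst i) (snd i))"
      by (auto simp: K_def)
    have "hausdorff_gauge h (cball (fst i) (5 * snd i)) = ennreal (unit_ball_vol (real h) * (5 * snd i) ^ h)"
      using r by (simp add: hausdorff_gauge_def)
    also have "unit_ball_vol (real h) * (5 * snd i) ^ h = ?c * (t * snd i ^ h)"
      using t by (simp add: power_mult_distrib)
    also have "ennreal \<dots> = ennreal ?c * ennreal (t * snd i ^ h)"
      using t r by (intro ennreal_mult) auto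
    also have "\<dots> \<le> ennreal ?c * emeasure \<nu> (cball (fst i) (snd i))"
      by (intro mult_left_mono le) auto
    finally show "hausdorff_gauge h (cball (fst i) (5 * snd i)) \<le> \<dots>" .
  qed
  also have "\<dots> = ennreal ?c * (\<integral>\<^sup>+i. emeasure \<nu> (cball (fst i) (snd i)) \<partial>count_space C)"
    by (rule nn_integral_cmult) auto
  also have "(\<integral>\<^sup>+i. emeasure \<nu> (cball (fst i) (snd i)) \<partial>count_space C)
      = emeasure \<nu> (\<Union>i\<in>C. cball (fst i) (snd i))"
    using C by (intro emeasure_UN_countable[symmetric])
      (auto simp: assms(1) disjoint_family_on_def pairwise_def disjnt_def)
  also have "\<dots> \<le> emeasure \<nu> U"
  proof (rule emeasure_mono)
    show "(\<Union>i\<in>C. cball (fst i) (snd i)) \<subseteq> U"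
    proof (rule UN_least)
      fix i assume "i \<in> C"
      with C(2) have "i \<in> K" by blast
      then show "cball (fst i) (snd i) \<subseteq> U" by (simp add: K_def split_beta)
    qed
  qed (use U in \<open>simp add: assms(1)\<close>)
  finally show "hausdorff_pre h \<delta> A \<le> ennreal ?c * emeasure \<nu> U" 
    by (simp add: mult_left_mono)
qed

text \<open>At an exceptional point the upper density is at least t for every t, so by comparison
  the exceptional set has measure at most a constant divided by t.\<close>

lemma AE_upper_density_finite:
  fixes \<nu> :: "'a::euclidean_space measure"
  assumes "sets \<nu> = sets borel" and "emeasure \<nu> UNIV < \<infinity>"
  shows "AE x in hausdorff_measure h. \<exists>C>0. \<forall>\<^sub>F r in at_right 0. emeasure \<nu> (ball x r) \<le> ennreal (C * r ^ h)"
proof (rule AE_hausdorffI)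
  let ?N = "{x. \<not> (\<exists>C>0. \<forall>\<^sub>F r in at_right 0. emeasure \<nu> (ball x r) \<le> ennreal (C * r ^ h))}"
  obtain M where M: "emeasure \<nu> UNIV = ennreal M" "M \<ge> 0"
    using assms(2) by (cases "emeasure \<nu> UNIV") auto
  let ?v = "unit_ball_vol (real h) * 5 ^ h * M"
  have v: "?v \<ge> 0" using M by simp
  have "hausdorff_outer h ?N \<le> ennreal e" if e: "e > 0" for e
  proof -
    \<comment> \<open>The summand 1 keeps t positive when the total mass M is 0.\<close>
    define t where "t = (?v + 1) / e"
    have t: "t > 0" using e v by (simp add: t_def add_nonneg_pos)
    have "hausdorff_outer h ?N \<le> ennreal (unit_ball_vol (real h) * 5 ^ h / t) * emeasure \<nu> UNIV"
    proof (rule hausdorff_outer_le_density)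
      fix x assume "x \<in> ?N"
      then have "\<exists>\<^sub>F r in at_right 0. \<not> emeasure \<nu> (ball x r) \<le> ennreal (t * r ^ h)"
        using t by (auto simp: frequently_def)
      then show "\<exists>\<^sub>F r in at_right 0. ennreal (t * r ^ h) \<le> emeasure \<nu> (ball x r)"
        by (rule frequently_elim1) auto
    qed (use assms t in auto)
    also have "\<dots> = ennreal (?v / t)"
      unfolding M using M t by (simp add: ennreal_mult[symmetric])
    also have "\<dots> \<le> ennreal e"
    proof (rule ennreal_leI)
      have "?v / t = e * (?v / (?v + 1))" using e v by (simp add: t_def)
      also have "\<dots> \<le> e * 1" using e v by (intro mult_left_mono) (auto simp: divide_le_eq_1)
      finally show "?v / t \<le> e" by simp
    qed
    finally show ?thesis .
  qed
  then show "hausdorff_outer h ?N = 0" by (rule ennreal_eq_0I)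
qed

text \<open>Outer regularity encloses B in open sets of arbitrarily small mass, so for each t the
  points of B with upper density above t form a null set. The values t = 1/(n+1) are enough and
  countable.\<close>

lemma AE_density_zero:
  fixes \<nu> :: "'a::euclidean_space measure"
  assumes sets: "sets \<nu> = sets borel" and fin: "emeasure \<nu> UNIV < \<infinity>" and B: "B \<in> sets borel" "emeasure \<nu> B = 0"
  shows "AE x in hausdorff_measure h. x \<in> B \<longrightarrow>
    (\<forall>t>0. \<forall>\<^sub>F r in at_right 0. emeasure \<nu> (ball x r) \<le> ennreal (t * r ^ h))"
proof -
  have "AE x in hausdorff_measure h. x \<in> B \<longrightarrow>
    (\<forall>\<^sub>F r in at_right 0. emeasure \<nu> (ball x r) \<le> ennreal (1 / real (Suc n) * r ^ h))" for n
  proof (rule AE_hausdorffI)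
    let ?t = "1 / real (Suc n)"
    let ?N = "{x. \<not> (x \<in> B \<longrightarrow> (\<forall>\<^sub>F r in at_right 0. emeasure \<nu> (ball x r) \<le> ennreal (?t * r ^ h)))}"
    let ?v = "ennreal (unit_ball_vol (real h) * 5 ^ h / ?t)"
    have le: "hausdorff_outer h ?N \<le> ?v * emeasure \<nu> U" if "B \<subseteq> U" "open U" for U
    proof (rule hausdorff_outer_le_density)
      fix x assume "x \<in> ?N"
      then have "\<exists>\<^sub>F r in at_right 0. \<not> emeasure \<nu> (ball x r) \<le> ennreal (?t * r ^ h)"
        by (auto simp: frequently_def)
      then show "\<exists>\<^sub>F r in at_right 0. ennreal (?t * r ^ h) \<le> emeasure \<nu> (ball x r)"
        by (rule frequently_elim1) auto
    qed (use sets that in auto)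
    have sp: "space \<nu> = UNIV" using sets_eq_imp_space_eq[OF sets] by simp
    have inf: "(INF U \<in> {U. B \<subseteq> U \<and> open U}. emeasure \<nu> U) = 0"
      using outer_regular[OF sets _ B(1)] fin B(2) sp by auto
    have "hausdorff_outer h ?N \<le> ennreal e" if e: "e > 0" for e
    proof -
      define d where "d = e / (unit_ball_vol (real h) * 5 ^ h / ?t)"
      have vpos: "unit_ball_vol (real h) * 5 ^ h / ?t > 0" by simp
      have d: "d > 0" unfolding d_def using e vpos by (rule divide_pos_pos)
      have "(INF U \<in> {U. B \<subseteq> U \<and> open U}. emeasure \<nu> U) < ennreal d"
        unfolding inf using d by simp
      then obtain U where U: "B \<subseteq> U" "open U" "emeasure \<nu> U < ennreal d"
        unfolding INF_less_iff by auto
      have "hausdorff_outer h ?N \<le> ?v * emeasure \<nu> U" by (rule le[OF U(1,2)])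
      also have "\<dots> \<le> ?v * ennreal d" using U(3) by (intro mult_left_mono) auto
      also have "\<dots> = ennreal (unit_ball_vol (real h) * 5 ^ h / ?t * d)"
        using d vpos by (intro ennreal_mult[symmetric]) auto
      also have "unit_ball_vol (real h) * 5 ^ h / ?t * d = e"
        unfolding d_def using vpos by (metis less_numeral_extra(3) nonzero_mult_div_cancel_left times_divide_eq_right)
      finally show ?thesis .
    qed
    then show "hausdorff_outer h ?N = 0" by (rule ennreal_eq_0I)
  qed
  then have "AE x in hausdorff_measure h. \<forall>n. x \<in> B \<longrightarrow>
    (\<forall>\<^sub>F r in at_right 0. emeasure \<nu> (ball x r) \<le> ennreal (1 / real (Suc n) * r ^ h))"
    unfolding AE_all_countable by blast
  then show ?thesis
  proof eventually_elim
    case (elim x)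
    show ?case
    proof (intro impI allI)
      fix t :: real assume "x \<in> B" "t > 0"
      obtain n where n: "1 / real (Suc n) < t" using nat_approx_posE[OF \<open>t > 0\<close>] by auto
      have "\<forall>\<^sub>F r in at_right (0::real). r > 0" by (rule eventually_at_right_less)
      with elim[rule_format, OF \<open>x \<in> B\<close>, of n]
      show "\<forall>\<^sub>F r in at_right 0. emeasure \<nu> (ball x r) \<le> ennreal (t * r ^ h)"
      proof eventually_elim
        case (elim r)
        have "ennreal (1 / real (Suc n) * r ^ h) \<le> ennreal (t * r ^ h)"
          using n elim(2) by (intro ennreal_leI mult_right_mono) auto
        with elim(1) show ?case by (rule order_trans)
      qed
    qed
  qed
qed

text \<open>If small balls around the points of \<open>A\<close> carried little of \<open>A\<close>, an almost optimal cover of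
  \<open>A\<close> would show that \<open>A\<close> has at most half of its own measure.\<close>

lemma hausdorff_outer_thin_null:
  fixes A :: "'a::metric_space set"
  assumes fin: "hausdorff_outer h A < \<infinity>" and \<rho>: "\<rho> > 0"
    and thin: "\<And>x r. x \<in> A \<Longrightarrow> 0 < r \<Longrightarrow> r < \<rho> \<Longrightarrow>
      hausdorff_outer h (A \<inter> ball x r) \<le> ennreal (unit_ball_vol (real h) / 2 ^ Suc h * r ^ h)"
  shows "hausdorff_outer h A = 0"
proof -
  define H where "H = hausdorff_outer h A"
  have "H \<le> (H + ennreal e) / 2" if e: "e > 0" for e
  proof -
    have "hausdorff_pre h (\<rho> / 2) A \<le> H"
      unfolding H_def using \<rho> by (intro hausdorff_pre_le_outer) simp
    also have "\<dots> < H + ennreal e"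
      using fin e ennreal_add_left_cancel_less[of H 0 "ennreal e"] by (simp add: H_def)
    finally obtain S where S: "S \<in> hausdorff_covers (\<rho> / 2) A"
      and Sle: "(\<Sum>i. hausdorff_gauge h (S i)) < H + ennreal e"
      unfolding hausdorff_pre_def INF_less_iff by blast
    have piece: "hausdorff_outer h (A \<inter> S i) \<le> hausdorff_gauge h (S i) / 2" for i
    proof (cases "A \<inter> S i = {}")
      case False
      then obtain x where x: "x \<in> A" "x \<in> S i" by blast
      define d where "d = diameter (S i)"
      have bd: "bounded (S i)" "d \<le> \<rho> / 2" using S by (auto simp: hausdorff_covers_def d_def)
      have d0: "d \<ge> 0" unfolding d_def by (rule diameter_ge_0[OF bd(1)])
      let ?c = "unit_ball_vol (real h) / 2 ^ Suc h"
      \<comment> \<open>A set of diameter d through x lies in the closed ball of radius d, so the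
        hypothesis is used at radii r > d and then r tends to d. This also covers d = 0.\<close>
      have ev: "\<forall>\<^sub>F r in at_right d. hausdorff_outer h (A \<inter> S i) \<le> ennreal (?c * r ^ h)"
      proof (rule eventually_at_rightI[of d \<rho>])
        fix r assume r: "r \<in> {d<..<\<rho>}"
        have "S i \<subseteq> ball x r"
        proof
          fix y assume "y \<in> S i"
          then have "dist x y \<le> d" unfolding d_def by (rule diameter_bounded_bound[OF bd(1) x(2)])
          then show "y \<in> ball x r" using r by simp
        qed
        then have "hausdorff_outer h (A \<inter> S i) \<le> hausdorff_outer h (A \<inter> ball x r)"
          by (intro hausdorff_outer_mono) auto
        also have "\<dots> \<le> ennreal (?c * r ^ h)"
          using r d0 by (intro thin x) auto
        finally show "hausdorff_outer h (A \<inter> S i) \<le> ennreal (?c * r ^ h)" .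
      qed (use bd \<rho> in simp)
      have "((\<lambda>r. ennreal (?c * r ^ h)) \<longlongrightarrow> ennreal (?c * d ^ h)) (at_right d)"
        by (intro tendsto_intros)
      then have "hausdorff_outer h (A \<inter> S i) \<le> ennreal (?c * d ^ h)"
        by (rule tendsto_lowerbound[OF _ ev]) simp
      \<comment> \<open>The origin of 2^(h+1): the factor 2^h passes from diameter to radius as in
        the gauge, and the remaining 2 is the gain of one half.\<close>
      also have "?c * d ^ h = (unit_ball_vol (real h) * (d / 2) ^ h) / 2"
        by (simp add: power_divide)
      also have "ennreal \<dots> = hausdorff_gauge h (S i) / 2"
        using x d0 by (auto simp: hausdorff_gauge_def d_def divide_ennreal[symmetric])
      finally show ?thesis .
    qed simp
    have "H \<le> hausdorff_outer h (\<Union>i. A \<inter> S i)"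
      unfolding H_def using S by (intro hausdorff_outer_mono) (auto simp: hausdorff_covers_def)
    also have "\<dots> \<le> (\<Sum>i. hausdorff_outer h (A \<inter> S i))"
      by (rule hausdorff_outer_subadditive)
    also have "\<dots> \<le> (\<Sum>i. hausdorff_gauge h (S i) / 2)"
      by (intro suminf_le piece) auto
    also have "\<dots> = (\<Sum>i. hausdorff_gauge h (S i)) / 2"
      unfolding divide_ennreal_def by (rule ennreal_suminf_multc)
    also have "\<dots> \<le> (H + ennreal e) / 2"
      using Sle by (intro divide_right_mono_ennreal) auto
    finally show ?thesis .
  qed
  moreover obtain M where M: "H = ennreal M" "M \<ge> 0"
    using fin by (cases H) (auto simp: H_def)
  ultimately have "M \<le> (M + e) / 2" if "e > 0" for e
  proof -
    have "(H + ennreal e) / 2 = ennreal ((M + e) / 2)"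
      using M that by (simp add: divide_ennreal[symmetric])
    with \<open>\<And>e. e > 0 \<Longrightarrow> H \<le> (H + ennreal e) / 2\<close>[OF that] M that show ?thesis by simp
  qed
  then have "M \<le> 0" by (intro field_le_epsilon[of M 0]) (simp add: field_simps)
  with M show ?thesis by (simp add: H_def)
qed

text \<open>If the lower bound fails at x for all radii below 1/(n+1), then x lies in
  \<open>A n\<close>, which \<open>hausdorff_outer_thin_null\<close> shows to be null.\<close>

lemma AE_upper_density_pos:
  fixes R :: "'a::metric_space set"
  assumes fin: "hausdorff_outer h R < \<infinity>"
  shows "AE x in hausdorff_measure h. x \<in> R \<longrightarrow>
    (\<exists>\<^sub>F r in at_right 0. hausdorff_outer h (R \<inter> ball x r) \<ge> ennreal (unit_ball_vol (real h) / 2 ^ Suc h * r ^ h))"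
proof (rule AE_hausdorffI)
  let ?c = "unit_ball_vol (real h) / 2 ^ Suc h"
  define A where "A n = {x\<in>R. \<forall>r. 0 < r \<longrightarrow> r < 1 / real (Suc n) \<longrightarrow>
     hausdorff_outer h (R \<inter> ball x r) < ennreal (?c * r ^ h)}" for n
  have "hausdorff_outer h (A n) = 0" for n
  proof (rule hausdorff_outer_thin_null[where \<rho> = "1 / real (Suc n)"])
    show "hausdorff_outer h (A n) < \<infinity>"
      using fin hausdorff_outer_mono[of "A n" R h] by (auto simp: A_def intro: order_le_less_trans)
    fix x r assume "x \<in> A n" "0 < (r::real)" "r < 1 / real (Suc n)"
    then have "hausdorff_outer h (R \<inter> ball x r) < ennreal (?c * r ^ h)" by (auto simp: A_def)
    moreover have "hausdorff_outer h (A n \<inter> ball x r) \<le> hausdorff_outer h (R \<inter> ball x r)"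
      by (intro hausdorff_outer_mono) (auto simp: A_def)
    ultimately show "hausdorff_outer h (A n \<inter> ball x r) \<le> ennreal (?c * r ^ h)" by simp
  qed simp
  then have "hausdorff_outer h (\<Union>n. A n) = 0"
    using hausdorff_outer_subadditive[of h A] by simp
  moreover have "{x. \<not> (x \<in> R \<longrightarrow> (\<exists>\<^sub>F r in at_right 0. hausdorff_outer h (R \<inter> ball x r) \<ge> ennreal (?c * r ^ h)))} \<subseteq> (\<Union>n. A n)"
  proof
    fix x assume "x \<in> {x. \<not> (x \<in> R \<longrightarrow> (\<exists>\<^sub>F r in at_right 0. hausdorff_outer h (R \<inter> ball x r) \<ge> ennreal (?c * r ^ h)))}"
    then have x: "x \<in> R" and "\<forall>\<^sub>F r in at_right 0. hausdorff_outer h (R \<inter> ball x r) < ennreal (?c * r ^ h)"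
      by (auto simp: frequently_def not_le)
    then obtain b where b: "b > 0" "\<And>r. 0 < r \<Longrightarrow> r < b \<Longrightarrow> hausdorff_outer h (R \<inter> ball x r) < ennreal (?c * r ^ h)"
      unfolding eventually_at_right_field by auto
    obtain n where "1 / real (Suc n) < b" using nat_approx_posE[OF b(1)] by auto
    then have "x \<in> A n" using x b(2) by (auto simp: A_def)
    then show "x \<in> (\<Union>n. A n)" by blast
  qed
  ultimately show "hausdorff_outer h {x. \<not> (x \<in> R \<longrightarrow> (\<exists>\<^sub>F r in at_right 0. hausdorff_outer h (R \<inter> ball x r) \<ge> ennreal (?c * r ^ h)))} = 0"
    by (metis (no_types, lifting) hausdorff_outer_mono le_zero_eq)
qed

text \<open>The push-forward along the identity only cuts the sigma-algebra down to the Borel sets,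
  as the density results for Borel measures require.\<close>

definition hausdorff_weighted :: "nat \<Rightarrow> ('a::metric_space \<Rightarrow> real) \<Rightarrow> 'a measure" where
  "hausdorff_weighted h f = distr (density (hausdorff_measure h) (\<lambda>x. ennreal (f x))) borel (\<lambda>x. x)"

lemma sets_hausdorff_weighted: "sets (hausdorff_weighted h f) = sets borel"
  by (simp add: hausdorff_weighted_def)

lemma emeasure_hausdorff_weighted:
  assumes f: "integrable (hausdorff_measure h) f" "\<And>x. f x \<ge> 0" and B: "B \<in> sets borel"
  shows "emeasure (hausdorff_weighted h f) B = ennreal (LINT x:B|hausdorff_measure h. f x)"
proof -
  have [measurable]: "B \<in> sets (hausdorff_measure h)" using B by blast
  have [measurable]: "f \<in> borel_measurable (hausdorff_measure h)"
    by (rule borel_measurable_integrable[OF f(1)])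
  have id: "(\<lambda>x. x) \<in> measurable (density (hausdorff_measure h) (\<lambda>x. ennreal (f x))) borel"
    using borel_measurable_hausdorff[OF measurable_ident_sets[OF refl], of h] by simp
  have "emeasure (hausdorff_weighted h f) B = (\<integral>\<^sup>+x. ennreal (f x) * indicator B x \<partial>hausdorff_measure h)"
    unfolding hausdorff_weighted_def using B by (simp add: emeasure_distr[OF id] emeasure_density)
  also have "\<dots> = (\<integral>\<^sup>+x. ennreal (indicator B x *\<^sub>R f x) \<partial>hausdorff_measure h)"
    by (intro nn_integral_cong) (auto simp: indicator_def)
  also have "\<dots> = ennreal (LINT x:B|hausdorff_measure h. f x)"
    unfolding set_lebesgue_integral_def using f
    by (intro nn_integral_eq_integral integrable_mult_indicator) auto
  finally show ?thesis .
qed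

text \<open>The dimension p of the measure and the dimension h of the density may differ: the
  boundary is estimated with p = k - 1 and h = k.\<close>

lemma AE_upper_density_integral:
  fixes f :: "'a::euclidean_space \<Rightarrow> real"
  assumes f: "integrable (hausdorff_measure p) f" "\<And>x. f x \<ge> 0"
  shows "AE x in hausdorff_measure h. \<exists>C>0. \<forall>\<^sub>F r in at_right 0.
    (LINT y:ball x r|hausdorff_measure p. f y) \<le> C * r ^ h"
proof -
  have "emeasure (hausdorff_weighted p f) UNIV < \<infinity>"
    using emeasure_hausdorff_weighted[OF f, of UNIV] by simp
  from AE_upper_density_finite[OF sets_hausdorff_weighted this, of h]
  show ?thesis
  proof eventually_elim
    case (elim x)
    then obtain C where C: "C > 0"
      "\<forall>\<^sub>F r in at_right 0. emeasure (hausdorff_weighted p f) (ball x r) \<le> ennreal (C * r ^ h)" by blast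
    have "\<forall>\<^sub>F r in at_right (0::real). r > 0" by (rule eventually_at_right_less)
    with C(2) have "\<forall>\<^sub>F r in at_right 0. (LINT y:ball x r|hausdorff_measure p. f y) \<le> C * r ^ h"
      by eventually_elim (use C(1) in \<open>simp add: emeasure_hausdorff_weighted[OF f]\<close>)
    with C(1) show ?case by blast
  qed
qed

lemma set_lebesgue_integral_nonneg:
  fixes f :: "'a \<Rightarrow> real"
  shows "(\<And>x. x \<in> A \<Longrightarrow> 0 \<le> f x) \<Longrightarrow> 0 \<le> (LINT x:A|M. f x)"
  unfolding set_lebesgue_integral_def by (intro integral_nonneg_AE) (auto simp: indicator_def)

text \<open>A is replaced by a Borel hull B. Since A has finite measure, B - A is null, so f
  integrates to zero over B as well.\<close>

lemma AE_density_zero_integral: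
  fixes f :: "'a::euclidean_space \<Rightarrow> real"
  assumes f: "integrable (hausdorff_measure h) f" "\<And>x. f x \<ge> 0"
    and A: "A \<in> sets (hausdorff_measure h)" "hausdorff_outer h A < \<infinity>"
    and zero: "\<And>x. x \<in> A \<Longrightarrow> f x = 0"
  shows "AE x in hausdorff_measure h. x \<in> A \<longrightarrow>
    ((\<lambda>r. (LINT y:ball x r|hausdorff_measure h. f y) / r ^ h) \<longlongrightarrow> 0) (at_right 0)"
proof -
  let ?H = "hausdorff_measure h :: 'a measure"
  obtain B where B: "B \<in> sets borel" "A \<subseteq> B" "hausdorff_outer h B = hausdorff_outer h A"
    by (rule hausdorff_outer_borel_hull)
  have BH: "B \<in> sets ?H" using B(1) by blast
  have "emeasure ?H (B - A) = emeasure ?H B - emeasure ?H A"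
    using A B(2) BH by (intro emeasure_Diff) (auto simp: emeasure_hausdorff_measure)
  also have "\<dots> = 0"
    using A B(3) BH by (simp add: emeasure_hausdorff_measure)
  finally have "B - A \<in> null_sets ?H" using A BH by auto
  then have "AE y in ?H. y \<notin> B - A" by (rule AE_not_in)
  then have "AE y in ?H. indicator B y *\<^sub>R f y = 0"
    by eventually_elim (auto simp: indicator_def zero)
  then have "(LINT y:B|?H. f y) = 0"
    unfolding set_lebesgue_integral_def by (rule integral_eq_zero_AE)
  then have B0: "emeasure (hausdorff_weighted h f) B = 0"
    by (simp add: emeasure_hausdorff_weighted[OF f B(1)])
  have fin: "emeasure (hausdorff_weighted h f) UNIV < \<infinity>"
    using emeasure_hausdorff_weighted[OF f, of UNIV] by simp
  from AE_density_zero[OF sets_hausdorff_weighted fin B(1) B0, of h]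
  show ?thesis
  proof eventually_elim
    case (elim x)
    show ?case
    proof
      assume "x \<in> A"
      with B(2) elim have ev: "\<forall>\<^sub>F r in at_right 0. emeasure (hausdorff_weighted h f) (ball x r) \<le> ennreal (t * r ^ h)"
        if "t > 0" for t using that by blast
      show "((\<lambda>r. (LINT y:ball x r|?H. f y) / r ^ h) \<longlongrightarrow> 0) (at_right 0)"
      proof (rule tendstoI)
        fix e :: real assume e: "e > 0"
        have "\<forall>\<^sub>F r in at_right (0::real). r > 0" by (rule eventually_at_right_less)
        with ev[OF half_gt_zero[OF e]]
        show "\<forall>\<^sub>F r in at_right 0. dist ((LINT y:ball x r|?H. f y) / r ^ h) 0 < e"
        proof eventually_elim
          case (elim r)
          have "(LINT y:ball x r|?H. f y) \<le> e / 2 * r ^ h"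
            using elim e by (simp add: emeasure_hausdorff_weighted[OF f])
          then have "(LINT y:ball x r|?H. f y) / r ^ h \<le> e / 2"
            using elim(2) by (simp add: divide_le_eq)
          moreover have "(LINT y:ball x r|?H. f y) / r ^ h \<ge> 0"
            using elim(2) f(2) by (intro divide_nonneg_nonneg set_lebesgue_integral_nonneg) auto
          ultimately show ?case using e unfolding dist_real_def by linarith
        qed
      qed
    qed
  qed
qed

section \<open>Lebesgue points and blow-up\<close>

lemma set_integrable_hausdorff_const:
  assumes "R \<in> sets (hausdorff_measure h)" "hausdorff_outer h R < \<infinity>"
  shows "set_integrable (hausdorff_measure h) R (\<lambda>_. c :: 'b::euclidean_space)"
  unfolding set_integrable_def using assms
  by (intro integrable_scaleR_left impI integrable_real_indicator) (auto simp: emeasure_hausdorff_measure)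

text \<open>The value g x is approximated by points q of a countable dense set. On
  \<open>A q n\<close> the function is 1/(n+1)-close to q, and what lies off \<open>A q n\<close>
  has density zero at almost every point of \<open>A q n\<close>. The close part is controlled by
  the finite upper density of R.\<close>

lemma AE_lebesgue_point:
  fixes g :: "'a::euclidean_space \<Rightarrow> 'b::euclidean_space"
  assumes g: "set_integrable (hausdorff_measure h) R g"
    and R: "R \<in> sets (hausdorff_measure h)" "hausdorff_outer h R < \<infinity>"
  shows "AE x in hausdorff_measure h. x \<in> R \<longrightarrow>
    ((\<lambda>r. (LINT y:(R \<inter> ball x r)|hausdorff_measure h. norm (g y - g x)) / r ^ h) \<longlongrightarrow> 0) (at_right 0)"
proof -
  let ?H = "hausdorff_measure h :: 'a measure"
  obtain D :: "'b set" where D: "countable D" "\<And>X. open X \<Longrightarrow> X \<noteq> {} \<Longrightarrow> \<exists>d\<in>D. d \<in> X"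
    using countable_dense_exists by blast
  define G where "G y = indicator R y *\<^sub>R g y" for y
  have G: "integrable ?H G" using g by (simp add: G_def[abs_def] set_integrable_def)
  have [measurable]: "G \<in> borel_measurable ?H" by (rule borel_measurable_integrable[OF G])
  have [measurable]: "R \<in> sets ?H" by (rule R)
  have Gg: "G y = g y" if "y \<in> R" for y using that by (simp add: G_def)
  define A where "A q n = {y\<in>R. norm (g y - q) \<le> 1 / real (Suc n)}" for q n
  define f where "f q n y = indicator (R - A q n) y * norm (g y - q)" for q n y
  have A_sets [measurable]: "A q n \<in> sets ?H" for q n
  proof -
    have "A q n = {y\<in>space ?H. y \<in> R \<and> norm (G y - q) \<le> 1 / real (Suc n)}"
      by (auto simp: A_def Gg)
    then show ?thesis by simp
  qed
  have intdiff: "integrable ?H (\<lambda>y. indicator S y *\<^sub>R norm (g y - q))" if S: "S \<in> sets ?H" "S \<subseteq> R" for S q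
  proof -
    have "integrable ?H (\<lambda>y. G y - indicator R y *\<^sub>R q)"
      using set_integrable_hausdorff_const[OF R, of q] G by (auto simp: set_integrable_def)
    then have "integrable ?H (\<lambda>y. indicator S y *\<^sub>R norm (G y - indicator R y *\<^sub>R q))"
      using S by (intro integrable_mult_indicator integrable_norm) auto
    also have "(\<lambda>y. indicator S y *\<^sub>R norm (G y - indicator R y *\<^sub>R q)) = (\<lambda>y. indicator S y *\<^sub>R norm (g y - q))"
      using S by (auto simp: fun_eq_iff indicator_def G_def)
    finally show ?thesis .
  qed
  have f_int: "integrable ?H (f q n)" for q n
    using intdiff[of "R - A q n" q] by (simp add: f_def[abs_def])
  have "AE x in ?H. x \<in> A q n \<longrightarrow> ((\<lambda>r. (LINT y:ball x r|?H. f q n y) / r ^ h) \<longlongrightarrow> 0) (at_right 0)" for q n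
    using f_int
  proof (rule AE_density_zero_integral)
    show "hausdorff_outer h (A q n) < \<infinity>"
      using R(2) hausdorff_outer_mono[of "A q n" R h] by (auto simp: A_def intro: order_le_less_trans)
  qed (auto simp: f_def)
  then have "AE x in ?H. \<forall>q\<in>D. \<forall>n. x \<in> A q n \<longrightarrow>
      ((\<lambda>r. (LINT y:ball x r|?H. f q n y) / r ^ h) \<longlongrightarrow> 0) (at_right 0)"
    unfolding AE_ball_countable[OF D(1)] AE_all_countable by blast
  moreover have indR: "integrable ?H (\<lambda>y. indicator R y :: real)"
    using set_integrable_hausdorff_const[OF R, of "1::real"] by (simp add: set_integrable_def)
  then have "AE x in ?H. \<exists>C>0. \<forall>\<^sub>F r in at_right 0. (LINT y:ball x r|?H. indicator R y) \<le> C * r ^ h"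
    by (rule AE_upper_density_integral) simp
  ultimately show ?thesis
  proof eventually_elim
    case (elim x)
    from elim(2) obtain C where C: "C > 0" "\<forall>\<^sub>F r in at_right 0. (LINT y:ball x r|?H. indicator R y) \<le> C * r ^ h"
      by blast
    show ?case
    proof (intro impI tendstoI)
      fix e :: real assume xR: "x \<in> R" and e: "e > 0"
      \<comment> \<open>The close part contributes at most 2 C/(n+1) < e/2; the 2 counts the
        distances from g y to q and from q to g x.\<close>
      obtain n where n: "1 / real (Suc n) < e / (4 * C)"
        using nat_approx_posE[of "e / (4 * C)"] e C(1) by auto
      obtain q where q: "q \<in> D" "q \<in> ball (g x) (1 / real (Suc n))"
        using D(2)[of "ball (g x) (1 / real (Suc n))"] by auto
      have xA: "x \<in> A q n" using q(2) xR by (simp add: A_def dist_norm)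
      have "\<forall>\<^sub>F r in at_right 0. dist ((LINT y:ball x r|?H. f q n y) / r ^ h) 0 < e / 2"
        using elim(1)[rule_format, OF q(1) xA] e by (intro tendstoD) auto
      moreover have "\<forall>\<^sub>F r in at_right (0::real). r > 0" by (rule eventually_at_right_less)
      ultimately show "\<forall>\<^sub>F r in at_right 0. dist ((LINT y:(R \<inter> ball x r)|?H. norm (g y - g x)) / r ^ h) 0 < e"
        using C(2)
      proof eventually_elim
        case (elim r)
        let ?d = "1 / real (Suc n)"
        have [measurable]: "ball x r \<in> sets ?H" by auto
        have ia: "integrable ?H (\<lambda>y. indicator (ball x r) y *\<^sub>R f q n y)"
          by (intro integrable_mult_indicator f_int) auto
        have ib: "integrable ?H (\<lambda>y. 2 * ?d * (indicator (ball x r) y *\<^sub>R indicator R y))"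
          by (intro integrable_mult_right integrable_mult_indicator indR) auto
        have "(LINT y:(R \<inter> ball x r)|?H. norm (g y - g x)) \<le>
          (LINT y|?H. indicator (ball x r) y *\<^sub>R f q n y + 2 * ?d * (indicator (ball x r) y *\<^sub>R indicator R y))"
          unfolding set_lebesgue_integral_def
        proof (rule integral_mono)
          show "integrable ?H (\<lambda>y. indicator (R \<inter> ball x r) y *\<^sub>R norm (g y - g x))"
            by (rule intdiff) auto
          show "integrable ?H (\<lambda>y. indicator (ball x r) y *\<^sub>R f q n y + 2 * ?d * (indicator (ball x r) y *\<^sub>R indicator R y))"
            by (rule Bochner_Integration.integrable_add[OF ia ib])
          fix y
          have tri: "norm (g y - g x) \<le> norm (g y - q) + ?d"
            using norm_triangle_ineq[of "g y - q" "q - g x"] q(2) by (simp add: dist_norm norm_minus_commute)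
          have d0: "?d \<ge> 0" by simp
          show "indicator (R \<inter> ball x r) y *\<^sub>R norm (g y - g x) \<le>
            indicator (ball x r) y *\<^sub>R f q n y + 2 * ?d * (indicator (ball x r) y *\<^sub>R indicator R y)"
          proof (cases "y \<in> R \<inter> ball x r")
            case True
            show ?thesis
            proof (cases "y \<in> A q n")
              case True2: True
              then have "norm (g y - q) \<le> ?d" by (simp add: A_def)
              with tri True True2 show ?thesis by (simp add: f_def)
            next
              case False
              have "f q n y = norm (g y - q)" using True False by (simp add: f_def)
              with tri d0 have "norm (g y - g x) \<le> f q n y + 2 * ?d" by linarith
              with True show ?thesis by simp
            qed
          qed (auto simp: f_def)
        qed
        also have "\<dots> = (LINT y:ball x r|?H. f q n y) + 2 * ?d * (LINT y:ball x r|?H. indicator R y)"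
          unfolding set_lebesgue_integral_def Bochner_Integration.integral_add[OF ia ib] by simp
        also have "\<dots> \<le> e / 2 * r ^ h + 2 * ?d * (C * r ^ h)"
        proof (intro add_mono mult_left_mono)
          have "(LINT y:ball x r|?H. f q n y) / r ^ h < e / 2"
            using elim(1) unfolding dist_real_def by linarith
          then show "(LINT y:ball x r|?H. f q n y) \<le> e / 2 * r ^ h"
            using elim(2) by (simp add: divide_less_eq)
        qed (use elim in auto)
        also have "\<dots> = (e / 2 + 2 * C * ?d) * r ^ h" by (simp add: algebra_simps)
        also have "\<dots> < e * r ^ h"
        proof (rule mult_strict_right_mono)
          have "?d * (4 * C) < e" using n C(1) by (simp add: less_divide_eq)
          then have "2 * (2 * C * ?d) < e" by (simp only: mult_ac)
          then show "e / 2 + 2 * C * ?d < e" by linarith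
        qed (use elim(2) in simp)
        finally have "(LINT y:(R \<inter> ball x r)|?H. norm (g y - g x)) / r ^ h < e"
          using elim(2) by (simp add: divide_less_eq)
        moreover have "(LINT y:(R \<inter> ball x r)|?H. norm (g y - g x)) / r ^ h \<ge> 0"
          using elim(2) by (intro divide_nonneg_nonneg set_lebesgue_integral_nonneg) auto
        ultimately show ?case by simp
      qed
    qed
  qed
qed

text \<open>At a Lebesgue point g y may be replaced by g x up to o(r^h). A nonzero
  \<open>g x \<bullet> \<zeta>\<close> times the integral of \<phi> would then be o(r^h), although
  \<phi> is at least m on a half ball that infinitely often contains a fixed share of R.\<close>

lemma lebesgue_point_inner_eq_0:
  fixes g :: "'a::euclidean_space \<Rightarrow> 'b::euclidean_space" and \<phi> :: "real \<Rightarrow> 'a \<Rightarrow> real"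
  assumes g: "set_integrable (hausdorff_measure h) R g"
    and R: "R \<in> sets (hausdorff_measure h)" "hausdorff_outer h R < \<infinity>"
    and leb: "((\<lambda>r. (LINT y:(R \<inter> ball x r)|hausdorff_measure h. norm (g y - g x)) / r ^ h) \<longlongrightarrow> 0) (at_right 0)"
    and c: "c > 0" "\<exists>\<^sub>F r in at_right 0. ennreal (c * r ^ h) \<le> hausdorff_outer h (R \<inter> ball x r)"
    and \<phi>_meas: "\<And>r. \<phi> r \<in> borel_measurable borel"
    and \<phi>: "\<And>r y. 0 \<le> \<phi> r y" "\<And>r y. \<phi> r y \<le> 1" "\<And>r y. r > 0 \<Longrightarrow> y \<notin> ball x r \<Longrightarrow> \<phi> r y = 0"
    and m: "m > 0" "\<And>r y. r > 0 \<Longrightarrow> y \<in> ball x (r / 2) \<Longrightarrow> m \<le> \<phi> r y"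
    and small: "\<And>e. e > 0 \<Longrightarrow> \<forall>\<^sub>F r in at_right 0.
      \<bar>LINT y:R|hausdorff_measure h. \<phi> r y * (g y \<bullet> \<zeta>)\<bar> \<le> e * r ^ h"
  shows "g x \<bullet> \<zeta> = 0"
proof (rule ccontr)
  let ?H = "hausdorff_measure h :: 'a measure"
  assume ne: "g x \<bullet> \<zeta> \<noteq> 0"
  define L where "L = \<bar>g x \<bullet> \<zeta>\<bar>"
  have L: "L > 0" using ne by (simp add: L_def)
  define K where "K = norm \<zeta> + 1"
  have K: "K > 0" "norm \<zeta> \<le> K" using norm_ge_zero[of \<zeta>] by (auto simp: K_def add_nonneg_pos)
  \<comment> \<open>Makes \<open>2 * e * (2 * r) ^ h\<close> equal to half of
    \<open>L * m * (c * r ^ h)\<close>. The factor \<open>2 ^ h\<close> is due to \<phi> being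
    bounded below on the half ball only.\<close>
  define e where "e = L * m * c / (4 * 2 ^ h)"
  have e: "e > 0" using L m c by (simp add: e_def)
  have [measurable]: "R \<in> sets ?H" by (rule R)
  have [measurable]: "\<phi> r \<in> borel_measurable ?H" for r
    by (rule borel_measurable_hausdorff[OF \<phi>_meas])
  have gi: "integrable ?H (\<lambda>y. indicator R y *\<^sub>R g y)" using g by (simp add: set_integrable_def)
  have Ri: "integrable ?H (\<lambda>y. indicator R y *\<^sub>R v)" for v :: "'c::euclidean_space"
    using set_integrable_hausdorff_const[OF R, of v] by (simp add: set_integrable_def)
  have key: "\<forall>\<^sub>F r in at_right 0. L * m * measure ?H (R \<inter> ball x (r / 2)) \<le> 2 * e * r ^ h"
  proof -
    have "\<forall>\<^sub>F r in at_right 0. dist ((LINT y:(R \<inter> ball x r)|?H. norm (g y - g x)) / r ^ h) 0 < e / K"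
      using leb e K by (intro tendstoD) auto
    moreover have "\<forall>\<^sub>F r in at_right (0::real). r > 0" by (rule eventually_at_right_less)
    ultimately show ?thesis using small[OF e]
    proof eventually_elim
      case (elim r)
      have [measurable]: "ball x r \<in> sets ?H" "ball x (r / 2) \<in> sets ?H" by auto
      have i1: "integrable ?H (\<lambda>y. indicator R y *\<^sub>R (\<phi> r y * (g y \<bullet> \<zeta>)))"
      proof (rule Bochner_Integration.integrable_bound)
        show "integrable ?H (\<lambda>y. (indicator R y *\<^sub>R g y) \<bullet> \<zeta>)" using gi by (rule integrable_inner_left)
        have "(\<lambda>y. \<phi> r y * ((indicator R y *\<^sub>R g y) \<bullet> \<zeta>)) \<in> borel_measurable ?H"
          using borel_measurable_integrable[OF gi] by measurable
        then show "(\<lambda>y. indicator R y *\<^sub>R (\<phi> r y * (g y \<bullet> \<zeta>))) \<in> borel_measurable ?H"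
          by (simp add: mult_ac)
        show "AE y in ?H. norm (indicator R y *\<^sub>R (\<phi> r y * (g y \<bullet> \<zeta>))) \<le> norm ((indicator R y *\<^sub>R g y) \<bullet> \<zeta>)"
          using \<phi>(1,2) by (intro AE_I2) (auto simp: abs_mult indicator_def intro!: mult_left_le_one_le)
      qed
      have i2: "integrable ?H (\<lambda>y. indicator R y * \<phi> r y)"
      proof (rule Bochner_Integration.integrable_bound)
        show "integrable ?H (\<lambda>y. indicator R y *\<^sub>R (1::real))" by (rule Ri)
        show "AE y in ?H. norm (indicator R y * \<phi> r y) \<le> norm (indicator R y *\<^sub>R (1::real))"
          using \<phi>(1,2) by (intro AE_I2) (auto simp: indicator_def)
      qed measurable
      have i3: "integrable ?H (\<lambda>y. indicator (R \<inter> ball x r) y *\<^sub>R norm (g y - g x))"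
      proof -
        have "integrable ?H (\<lambda>y. norm (indicator R y *\<^sub>R g y - indicator R y *\<^sub>R g x))"
          using gi Ri by (intro integrable_norm Bochner_Integration.integrable_diff)
        then have "integrable ?H (\<lambda>y. indicator (R \<inter> ball x r) y *\<^sub>R norm (indicator R y *\<^sub>R g y - indicator R y *\<^sub>R g x))"
          by (intro integrable_mult_indicator) auto
        also have "(\<lambda>y. indicator (R \<inter> ball x r) y *\<^sub>R norm (indicator R y *\<^sub>R g y - indicator R y *\<^sub>R g x)) =
          (\<lambda>y. indicator (R \<inter> ball x r) y *\<^sub>R norm (g y - g x))"
          by (auto simp: fun_eq_iff indicator_def)
        finally show ?thesis .
      qed
      have fin: "emeasure ?H (R \<inter> ball x (r / 2)) < \<infinity>"
        using R(2) emeasure_mono[of "R \<inter> ball x (r / 2)" R ?H]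
        by (auto simp: emeasure_hausdorff_measure[OF R(1)] intro: order_le_less_trans)
      have "m * measure ?H (R \<inter> ball x (r / 2)) = (LINT y|?H. m * indicator (R \<inter> ball x (r / 2)) y)"
        by simp
      also have "\<dots> \<le> (LINT y|?H. indicator R y * \<phi> r y)"
      proof (rule integral_mono)
        show "integrable ?H (\<lambda>y. m * indicator (R \<inter> ball x (r / 2)) y)"
          using fin by (intro integrable_mult_right integrable_real_indicator) auto
        show "m * indicator (R \<inter> ball x (r / 2)) y \<le> indicator R y * \<phi> r y" for y
          using m(2)[OF elim(2), of y] \<phi>(1)[of r y] by (auto simp: indicator_def)
      qed (rule i2)
      finally have "L * m * measure ?H (R \<inter> ball x (r / 2)) \<le> L * (LINT y|?H. indicator R y * \<phi> r y)"
        using L by (simp add: mult.assoc)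
      also have "\<dots> = \<bar>LINT y|?H. indicator R y * \<phi> r y * (g x \<bullet> \<zeta>)\<bar>"
        using \<phi>(1) by (simp add: L_def abs_mult integral_nonneg_AE mult.commute)
      also have "(LINT y|?H. indicator R y * \<phi> r y * (g x \<bullet> \<zeta>)) =
        (LINT y|?H. indicator R y *\<^sub>R (\<phi> r y * (g y \<bullet> \<zeta>))) -
        (LINT y|?H. indicator R y *\<^sub>R (\<phi> r y * (g y \<bullet> \<zeta>)) - indicator R y * \<phi> r y * (g x \<bullet> \<zeta>))"
        using i1 i2 by (subst Bochner_Integration.integral_diff) auto
      also have "\<bar>\<dots>\<bar> \<le> \<bar>LINT y|?H. indicator R y *\<^sub>R (\<phi> r y * (g y \<bullet> \<zeta>))\<bar> +
        \<bar>LINT y|?H. indicator R y *\<^sub>R (\<phi> r y * (g y \<bullet> \<zeta>)) - indicator R y * \<phi> r y * (g x \<bullet> \<zeta>)\<bar>"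
        by (rule abs_triangle_ineq4)
      also have "\<dots> \<le> e * r ^ h + e * r ^ h"
      proof (rule add_mono)
        show "\<bar>LINT y|?H. indicator R y *\<^sub>R (\<phi> r y * (g y \<bullet> \<zeta>))\<bar> \<le> e * r ^ h"
          using elim(3) by (simp add: set_lebesgue_integral_def)
        have "norm (LINT y|?H. indicator R y *\<^sub>R (\<phi> r y * (g y \<bullet> \<zeta>)) - indicator R y * \<phi> r y * (g x \<bullet> \<zeta>)) \<le>
          (LINT y|?H. K * (indicator (R \<inter> ball x r) y *\<^sub>R norm (g y - g x)))"
        proof (rule Bochner_Integration.integral_norm_bound_integral)
          show "integrable ?H (\<lambda>y. indicator R y *\<^sub>R (\<phi> r y * (g y \<bullet> \<zeta>)) - indicator R y * \<phi> r y * (g x \<bullet> \<zeta>))"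
            using i1 i2 by auto
          show "integrable ?H (\<lambda>y. K * (indicator (R \<inter> ball x r) y *\<^sub>R norm (g y - g x)))"
            using i3 by (rule integrable_mult_right)
          fix y
          show "norm (indicator R y *\<^sub>R (\<phi> r y * (g y \<bullet> \<zeta>)) - indicator R y * \<phi> r y * (g x \<bullet> \<zeta>)) \<le>
            K * (indicator (R \<inter> ball x r) y *\<^sub>R norm (g y - g x))"
          proof (cases "y \<in> R \<inter> ball x r")
            case True
            have "\<bar>\<phi> r y * (g y \<bullet> \<zeta>) - \<phi> r y * (g x \<bullet> \<zeta>)\<bar> = \<phi> r y * \<bar>(g y - g x) \<bullet> \<zeta>\<bar>"
              using \<phi>(1) by (simp add: inner_diff_left abs_mult flip: right_diff_distrib)
            also have "\<dots> \<le> 1 * (norm (g y - g x) * norm \<zeta>)"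
              using \<phi> by (intro mult_mono Cauchy_Schwarz_ineq2) auto
            also have "\<dots> \<le> K * norm (g y - g x)"
              using K(2) by (simp add: mult.commute mult_right_mono)
            finally show ?thesis using True by simp
          next
            case False
            then have "indicator R y * \<phi> r y = 0" using \<phi>(3)[OF elim(2), of y] by (auto simp: indicator_def)
            with False show ?thesis by (auto simp: indicator_def)
          qed
        qed
        also have "\<dots> = K * (LINT y:(R \<inter> ball x r)|?H. norm (g y - g x))"
          by (simp add: set_lebesgue_integral_def)
        also have "\<dots> \<le> K * (e / K * r ^ h)"
        proof (rule mult_left_mono)
          have "(LINT y:(R \<inter> ball x r)|?H. norm (g y - g x)) / r ^ h < e / K"
            using elim(1) unfolding dist_real_def by linarith
          then show "(LINT y:(R \<inter> ball x r)|?H. norm (g y - g x)) \<le> e / K * r ^ h"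
            using elim(2) by (simp add: divide_less_eq)
        qed (use K in simp)
        also have "\<dots> = e * r ^ h" using K by simp
        finally show "\<bar>LINT y|?H. indicator R y *\<^sub>R (\<phi> r y * (g y \<bullet> \<zeta>)) - indicator R y * \<phi> r y * (g x \<bullet> \<zeta>)\<bar> \<le> e * r ^ h"
          by simp
      qed
      finally show ?case by simp
    qed
  qed
  have "\<forall>\<^sub>F r in at_right 0. L * m * measure ?H (R \<inter> ball x r) \<le> 2 * e * (2 * r) ^ h"
  proof -
    \<comment> \<open>Doubling the radius turns the half ball into the ball for which the lower
      density is available.\<close>
    obtain b where b: "b > 0" "\<And>r. 0 < r \<Longrightarrow> r < b \<Longrightarrow> L * m * measure ?H (R \<inter> ball x (r / 2)) \<le> 2 * e * r ^ h"
      using key unfolding eventually_at_right_field by auto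
    show ?thesis
    proof (rule eventually_at_rightI[of 0 "b / 2"])
      fix r assume "r \<in> {0<..<b / 2}"
      then show "L * m * measure ?H (R \<inter> ball x r) \<le> 2 * e * (2 * r) ^ h"
        using b(2)[of "2 * r"] by simp
    qed (use b in simp)
  qed
  moreover have "\<forall>\<^sub>F r in at_right (0::real). r > 0" by (rule eventually_at_right_less)
  ultimately have "\<forall>\<^sub>F r in at_right 0. L * m * measure ?H (R \<inter> ball x r) \<le> 2 * e * (2 * r) ^ h \<and> r > 0"
    by eventually_elim simp
  \<comment> \<open>The lower density holds for some arbitrarily small radii and the upper estimate
    for all small ones, so a common radius exists.\<close>
  from frequently_eventually_frequently[OF c(2) this]
  obtain r where r: "ennreal (c * r ^ h) \<le> hausdorff_outer h (R \<inter> ball x r)"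
    "L * m * measure ?H (R \<inter> ball x r) \<le> 2 * e * (2 * r) ^ h" "r > 0"
    using frequently_ex by blast
  have RB: "R \<inter> ball x r \<in> sets ?H" using R(1) by auto
  have "emeasure ?H (R \<inter> ball x r) < \<infinity>"
    using R(2) emeasure_mono[of "R \<inter> ball x r" R ?H] R(1)
    by (auto simp: emeasure_hausdorff_measure[OF R(1)] intro: order_le_less_trans)
  then have "hausdorff_outer h (R \<inter> ball x r) = ennreal (measure ?H (R \<inter> ball x r))"
    using RB by (simp add: emeasure_hausdorff_measure[symmetric] emeasure_eq_ennreal_measure)
  with r(1) c(1) r(3) have "c * r ^ h \<le> measure ?H (R \<inter> ball x r)" by simp
  then have "L * m * (c * r ^ h) \<le> L * m * measure ?H (R \<inter> ball x r)"
    using L m by (intro mult_left_mono) auto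
  also have "\<dots> \<le> 2 * e * (2 * r) ^ h" by (rule r(2))
  also have "\<dots> = L * m * (c * r ^ h) / 2" by (simp add: e_def power_mult_distrib)
  finally have "L * m * (c * r ^ h) \<le> L * m * (c * r ^ h) / 2" .
  moreover have "L * m * (c * r ^ h) > 0" using L m c r(3) by simp
  ultimately show False by linarith
qed

section \<open>Exterior algebra\<close>

lemma wedge_add_left: "wedge (v + v') w = wedge v w + wedge v' w"
  by (simp add: wedge_def vec_eq_iff algebra_simps sum.distrib)

lemma wedge_scaleR_left: "wedge (c *\<^sub>R v) w = c *\<^sub>R wedge v w"
  by (simp add: wedge_def vec_eq_iff algebra_simps sum_distrib_left)

lemma bounded_bilinear_wedge: "bounded_bilinear (wedge :: 'n::{finite,linorder} exterior \<Rightarrow> _)"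
  unfolding bilinear_conv_bounded_bilinear[symmetric] bilinear_def
  by (auto intro!: linearI linear_wedge_right simp: wedge_add_left wedge_scaleR_left)

interpretation wedge: bounded_bilinear "wedge :: 'n::{finite,linorder} exterior \<Rightarrow> _"
  by (rule bounded_bilinear_wedge)

lemma subspace_graded: "subspace (graded h)"
  unfolding subspace_def graded_def by auto (metis add_0)

lemma graded_wedge:
  assumes "v \<in> graded p" "w \<in> graded q"
  shows "wedge v w \<in> graded (p + q)"
  unfolding graded_def
proof (intro CollectI allI impI)
  fix K assume "wedge v w $ K \<noteq> 0"
  then obtain I where I: "I \<in> Pow K" "wedge_sign I (K - I) * v $ I * w $ (K - I) \<noteq> 0"
    unfolding wedge_def by (auto elim: sum.not_neutral_contains_not_neutral)
  then have "card I = p" "card (K - I) = q" using assms by (auto simp: graded_def)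
  then show "card K = p + q" using I(1) card_Diff_subset[of I K] card_mono[of K I] by (auto simp: finite_subset)
qed

lemma pairing_graded_neq: "v \<in> graded p \<Longrightarrow> w \<in> graded q \<Longrightarrow> p \<noteq> q \<Longrightarrow> pairing v w = 0"
  unfolding inner_vec_def graded_def by (intro sum.neutral) force

lemma axis_graded: "axis I 1 \<in> graded (card I)"
  by (auto simp: graded_def axis_def)

lemma embed1_nth: "embed1 x $ I = (if card I = 1 then x $ (THE i. I = {i}) else 0)"
proof (cases "card I = 1")
  case True
  then obtain i where i: "I = {i}" by (auto simp: card_1_singleton_iff)
  then have "embed1 x $ I = (\<Sum>j\<in>UNIV. if j = i then x $ j else 0)"
    unfolding embed1_def sum_component by (intro sum.cong) (auto simp: axis_def)
  then show ?thesis by (simp add: i)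
next
  case False
  then have "axis {i} (1::real) $ I = 0" for i by (auto simp: axis_def)
  with False show ?thesis by (simp add: embed1_def)
qed

lemma embed1_singleton [simp]: "embed1 x $ {i} = x $ i"
  by (simp add: embed1_nth)

lemma embed1_graded: "embed1 x \<in> graded 1"
  by (auto simp: graded_def embed1_nth)

lemma graded1_eq_embed1:
  assumes "\<omega> \<in> graded 1"
  shows "\<omega> = embed1 (\<chi> i. \<omega> $ {i})"
proof -
  have "\<omega> $ I = embed1 (\<chi> i. \<omega> $ {i}) $ I" for I
  proof (cases "card I = 1")
    case True
    then obtain i where "I = {i}" by (auto simp: card_1_singleton_iff)
    then show ?thesis by simp
  next
    case False
    then show ?thesis using assms by (auto simp: graded_def embed1_nth)
  qed
  then show ?thesis unfolding vec_eq_iff by blast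
qed

lemma linear_embed1: "linear embed1"
  by (rule linearI) (auto simp: embed1_def sum.distrib scaleR_add_left scaleR_sum_right)

lemma embed1_axis: "embed1 (axis i 1) = axis {i} 1"
proof -
  have "axis i 1 $ (THE j. I = {j}) = axis {i} (1::real) $ I" if "card I = 1" for I
    using that by (auto simp: card_1_singleton_iff axis_def)
  then show ?thesis
    by (auto simp: vec_eq_iff embed1_nth) (auto simp: axis_def)
qed

lemma pairing_embed1: "pairing (embed1 x) \<omega> = x \<bullet> (\<chi> i. \<omega> $ {i})"
  unfolding embed1_def inner_sum_left
  by (auto simp: inner_vec_def[of x] inner_axis' intro!: sum.cong)

lemma pairing_embed1_embed1 [simp]: "pairing (embed1 x) (embed1 y) = x \<bullet> y"
  by (simp add: pairing_embed1)

text \<open>The sign with which e_i is sorted into its place in e_K. Only elements strictly below i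
  are counted, so K with and without i give the same sign.\<close>

definition below_sign :: "'n::linorder \<Rightarrow> 'n set \<Rightarrow> real" where
  "below_sign i K = (-1) ^ card {j\<in>K. j < i}"

lemma below_sign_sq [simp]: "below_sign i K * below_sign i K = 1"
  by (simp add: below_sign_def flip: power_add)

lemma below_sign_remove:
  fixes i j :: "'n::{finite,linorder}"
  shows "i \<in> K \<Longrightarrow> below_sign j (K - {i}) = (if i < j then - below_sign j K else below_sign j K)"
proof (cases "i < j")
  case True
  assume "i \<in> K"
  then have "{k\<in>K. k < j} = insert i {k\<in>K - {i}. k < j}" using True by auto
  then have "card {k\<in>K. k < j} = Suc (card {k\<in>K - {i}. k < j})"
    by (metis (mono_tags, lifting) Diff_iff card_insert_disjoint finite insertI1 mem_Collect_eq)
  with True show ?thesis by (simp add: below_sign_def)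
next
  case False
  then have "{k\<in>K - {i}. k < j} = {k\<in>K. k < j}" by auto
  with False show ?thesis by (simp add: below_sign_def)
qed

lemma below_sign_insert:
  fixes i j :: "'n::{finite,linorder}"
  shows "i \<notin> K \<Longrightarrow> below_sign j (insert i K) = (if i < j then - below_sign j K else below_sign j K)"
  using below_sign_remove[of i "insert i K" j] by (auto split: if_splits)

lemma wedge_axis_left:
  "wedge (axis {i} 1) \<xi> $ K = (if i \<in> K then below_sign i K * \<xi> $ (K - {i}) else 0)"
proof -
  have "wedge (axis {i} 1) \<xi> $ K = (\<Sum>I\<in>Pow K. if I = {i} then wedge_sign {i} (K - {i}) * \<xi> $ (K - {i}) else 0)"
    unfolding wedge_def vec_lambda_beta by (intro sum.cong refl) (auto simp: axis_def)
  also have "\<dots> = (if i \<in> K then wedge_sign {i} (K - {i}) * \<xi> $ (K - {i}) else 0)"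
    by simp
  also have "wedge_sign {i} (K - {i}) = below_sign i K"
  proof -
    have "{(a, b). a \<in> {i} \<and> b \<in> K - {i} \<and> b < a} = Pair i ` {j\<in>K. j < i}" by auto
    then show ?thesis unfolding wedge_sign_def below_sign_def by (simp add: card_image inj_on_def)
  qed
  finally show ?thesis .
qed

lemma wedge_axis_right:
  "wedge \<xi> (axis {i} 1) $ K = (if i \<in> K then (-1) ^ card {j\<in>K. i < j} * \<xi> $ (K - {i}) else 0)"
proof -
  have "wedge \<xi> (axis {i} 1) $ K =
      (\<Sum>I\<in>Pow K. if I = K - {i} \<and> i \<in> K then wedge_sign (K - {i}) {i} * \<xi> $ (K - {i}) else 0)"
    unfolding wedge_def vec_lambda_beta
  proof (rule sum.cong[OF refl])
    fix I assume I: "I \<in> Pow K"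
    show "wedge_sign I (K - I) * \<xi> $ I * axis {i} 1 $ (K - I) =
      (if I = K - {i} \<and> i \<in> K then wedge_sign (K - {i}) {i} * \<xi> $ (K - {i}) else 0)"
    proof (cases "I = K - {i} \<and> i \<in> K")
      case True
      then have "K - I = {i}" by blast
      with True show ?thesis by (simp add: axis_def)
    next
      case False
      have "K - I \<noteq> {i}"
      proof
        assume *: "K - I = {i}"
        have "K - (K - I) = I" using double_diff[of I K K] I by blast
        with * False show False by auto
      qed
      then have "axis {i} (1::real) $ (K - I) = 0" by (simp add: axis_def)
      then show ?thesis unfolding if_not_P[OF False] by simp
    qed
  qed
  also have "\<dots> = (if i \<in> K then wedge_sign (K - {i}) {i} * \<xi> $ (K - {i}) else 0)"
    by (cases "i \<in> K") (simp_all add: sum.delta[of "Pow K"] Diff_subset)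
  also have "wedge_sign (K - {i}) {i} = (-1) ^ card {j\<in>K. i < j}"
  proof -
    have "{(a, b). a \<in> K - {i} \<and> b \<in> {i} \<and> b < a} = (\<lambda>j. (j, i)) ` {j\<in>K. i < j}" by auto
    then show ?thesis unfolding wedge_sign_def by (simp add: card_image inj_on_def)
  qed
  finally show ?thesis .
qed

text \<open>To get from the right end to the left end, e_i passes all p factors: those above i and
  those below i.\<close>

lemma wedge_axis_commute:
  fixes \<beta> :: "'n::{finite,linorder} exterior"
  assumes "\<beta> \<in> graded p"
  shows "wedge \<beta> (axis {i} 1) = (-1) ^ p *\<^sub>R wedge (axis {i} 1) \<beta>"
proof -
  have "(-1) ^ card {j\<in>K. i < j} * \<beta> $ (K - {i}) = (-1) ^ p * (below_sign i K * \<beta> $ (K - {i}))"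
    if "i \<in> K" for K
  proof (cases "\<beta> $ (K - {i}) = 0")
    case False
    then have "p = card (K - {i})" using assms by (auto simp: graded_def)
    also have "K - {i} = {j\<in>K. j < i} \<union> {j\<in>K. i < j}" by auto
    also have "card \<dots> = card {j\<in>K. j < i} + card {j\<in>K. i < j}"
      by (rule card_Un_disjoint) auto
    finally have "(-1) ^ p * below_sign i K = (-1) ^ card {j\<in>K. i < j} * (below_sign i K * below_sign i K)"
      by (simp only: power_add below_sign_def) (simp add: mult_ac)
    then show ?thesis by (simp only: below_sign_sq) simp
  qed simp
  then show ?thesis
    by (simp add: vec_eq_iff wedge_axis_left wedge_axis_right)
qed

lemma wedge_embed1_left: "wedge (embed1 a) \<xi> = (\<Sum>i\<in>UNIV. a $ i *\<^sub>R wedge (axis {i} 1) \<xi>)"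
  unfolding embed1_def by (simp add: wedge.sum_left wedge.scaleR_left)

lemma wedge_embed1_commute:
  assumes "\<beta> \<in> graded p"
  shows "wedge \<beta> (embed1 a) = (-1) ^ p *\<^sub>R wedge (embed1 a) \<beta>"
  unfolding wedge_embed1_left unfolding embed1_def
  by (simp add: wedge.sum_right wedge.scaleR_right wedge_axis_commute[OF assms] scaleR_sum_right mult.commute)

text \<open>Removing i from K flips \<open>below_sign j\<close> exactly if i < j, and removing j
  flips \<open>below_sign i\<close> exactly if j < i. For distinct indices just one of the two
  happens.\<close>

lemma wedge_axis_anticommute:
  fixes \<xi> :: "'n::{finite,linorder} exterior"
  shows "wedge (axis {i} 1) (wedge (axis {j} 1) \<xi>) = - wedge (axis {j} 1) (wedge (axis {i} 1) \<xi>)"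
proof (cases "i = j")
  case False
  have "K - {i} - {j} = K - {j} - {i}" for K by auto
  moreover have "\<not> i < j \<longleftrightarrow> j < i" using False by auto
  ultimately show ?thesis using False
    by (auto simp: vec_eq_iff wedge_axis_left below_sign_remove)
qed (auto simp: vec_eq_iff wedge_axis_left)

lemma wedge_embed1_anticommute:
  "wedge (embed1 a) (wedge (embed1 b) \<xi>) = - wedge (embed1 b) (wedge (embed1 a) \<xi>)"
proof -
  let ?W = "\<lambda>i j. wedge (axis {i} 1) (wedge (axis {j} 1) \<xi>)"
  have expand: "wedge (embed1 a) (wedge (embed1 b) \<xi>) = (\<Sum>i\<in>UNIV. \<Sum>j\<in>UNIV. (a $ i * b $ j) *\<^sub>R ?W i j)" for a b
    unfolding wedge_embed1_left
    by (simp add: wedge.sum_right wedge.scaleR_right scaleR_sum_right)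
  have "wedge (embed1 a) (wedge (embed1 b) \<xi>) = (\<Sum>j\<in>UNIV. \<Sum>i\<in>UNIV. (a $ i * b $ j) *\<^sub>R ?W i j)"
    unfolding expand by (rule sum.swap)
  also have "\<dots> = (\<Sum>j\<in>UNIV. \<Sum>i\<in>UNIV. - ((b $ j * a $ i) *\<^sub>R ?W j i))"
  proof (intro sum.cong refl)
    fix i j
    show "(a $ i * b $ j) *\<^sub>R ?W i j = - ((b $ j * a $ i) *\<^sub>R ?W j i)"
      by (subst wedge_axis_anticommute) (simp add: mult.commute)
  qed
  finally show ?thesis unfolding expand by (simp only: sum_negf)
qed

lemma wedge_embed1_self [simp]: "wedge (embed1 a) (wedge (embed1 a) \<xi>) = 0"
  using wedge_embed1_anticommute[of a a \<xi>]
  by (metis add.right_inverse scaleR_2 scaleR_eq_0_iff zero_neq_numeral)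

section \<open>Contraction by a covector of degree one\<close>

definition contract_axis :: "'n \<Rightarrow> 'n::{finite,linorder} exterior \<Rightarrow> 'n exterior" where
  "contract_axis i \<xi> = (\<chi> K. if i \<in> K then 0 else below_sign i K * \<xi> $ (insert i K))"

definition contract :: "'n euclid \<Rightarrow> 'n::{finite,linorder} exterior \<Rightarrow> 'n exterior" where
  "contract a \<xi> = (\<Sum>i\<in>UNIV. a $ i *\<^sub>R contract_axis i \<xi>)"

lemma linear_contract_axis: "linear (contract_axis i)"
  by (rule linearI) (auto simp: contract_axis_def vec_eq_iff algebra_simps)

lemma linear_contract: "linear (contract a)"
  unfolding contract_def
  by (intro linear_compose_sum ballI linear_compose_scale_right linear_contract_axis)

lemma pairing_contract_axis:
  "pairing (contract_axis i \<xi>) \<beta> = pairing \<xi> (wedge (axis {i} 1) \<beta>)"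
proof -
  have "pairing (contract_axis i \<xi>) \<beta> = (\<Sum>K | i \<notin> K. below_sign i K * \<xi> $ (insert i K) * \<beta> $ K)"
    unfolding inner_vec_def contract_axis_def
    by (rule sum.mono_neutral_cong_right) auto
  also have "\<dots> = (\<Sum>K | i \<in> K. \<xi> $ K * (below_sign i K * \<beta> $ (K - {i})))"
    by (rule sum.reindex_bij_witness[of _ "\<lambda>K. K - {i}" "insert i"])
       (auto simp: insert_absorb below_sign_insert)
  also have "\<dots> = pairing \<xi> (wedge (axis {i} 1) \<beta>)"
    unfolding inner_vec_def wedge_axis_left
    by (rule sum.mono_neutral_cong_left) auto
  finally show ?thesis .
qed

text \<open>Together with \<open>pairing_interior\<close> this identifies
  \<open>contract a \<xi>\<close> with \<open>interior_mult \<xi> (embed1 a)\<close>. The coordinate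
  formula is what makes the antiderivation rule below checkable.\<close>

lemma pairing_contract: "pairing (contract a \<xi>) \<beta> = pairing \<xi> (wedge (embed1 a) \<beta>)"
  unfolding contract_def wedge_embed1_left
  by (simp add: inner_sum_left inner_sum_right pairing_contract_axis)

text \<open>The canonical anticommutation relation. For i = j exactly one summand survives at each
  K, depending on whether i belongs to K; for distinct indices the two differ by one
  transposition.\<close>

lemma contract_axis_wedge:
  fixes \<xi> :: "'n::{finite,linorder} exterior"
  shows "contract_axis i (wedge (axis {j} 1) \<xi>) + wedge (axis {j} 1) (contract_axis i \<xi>) =
    (if i = j then \<xi> else 0)"
proof (cases "i = j")
  case True
  then show ?thesis
    by (auto simp: vec_eq_iff wedge_axis_left contract_axis_def below_sign_insert below_sign_remove insert_absorb
        simp flip: mult.assoc)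
next
  case False
  have "insert i (K - {j}) = insert i K - {j}" for K using False by auto
  moreover have "\<not> i < j \<longleftrightarrow> j < i" using False by auto
  ultimately show ?thesis using False
    by (auto simp: vec_eq_iff wedge_axis_left contract_axis_def below_sign_insert below_sign_remove)
qed

lemma contract_wedge:
  "contract a (wedge (embed1 b) \<xi>) = (a \<bullet> b) *\<^sub>R \<xi> - wedge (embed1 b) (contract a \<xi>)"
proof -
  interpret ca: linear "contract_axis i :: 'a exterior \<Rightarrow> _" for i by (rule linear_contract_axis)
  have "contract a (wedge (embed1 b) \<xi>) + wedge (embed1 b) (contract a \<xi>) =
    (\<Sum>i\<in>UNIV. \<Sum>j\<in>UNIV. (a $ i * b $ j) *\<^sub>R contract_axis i (wedge (axis {j} 1) \<xi>)) +
    (\<Sum>j\<in>UNIV. \<Sum>i\<in>UNIV. (a $ i * b $ j) *\<^sub>R wedge (axis {j} 1) (contract_axis i \<xi>))"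
    unfolding wedge_embed1_left contract_def
    by (simp add: wedge.sum_right wedge.scaleR_right scaleR_sum_right ca.sum ca.scale mult.commute)
  also have "(\<Sum>j\<in>UNIV. \<Sum>i\<in>UNIV. (a $ i * b $ j) *\<^sub>R wedge (axis {j} 1) (contract_axis i \<xi>)) =
    (\<Sum>i\<in>UNIV. \<Sum>j\<in>UNIV. (a $ i * b $ j) *\<^sub>R wedge (axis {j} 1) (contract_axis i \<xi>))"
    by (rule sum.swap)
  also have "(\<Sum>i\<in>UNIV. \<Sum>j\<in>UNIV. (a $ i * b $ j) *\<^sub>R contract_axis i (wedge (axis {j} 1) \<xi>)) +
    (\<Sum>i\<in>UNIV. \<Sum>j\<in>UNIV. (a $ i * b $ j) *\<^sub>R wedge (axis {j} 1) (contract_axis i \<xi>)) =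
    (\<Sum>i\<in>UNIV. \<Sum>j\<in>UNIV. (a $ i * b $ j) *\<^sub>R (if i = j then \<xi> else 0))"
    by (simp only: sum.distrib[symmetric] scaleR_add_right[symmetric] contract_axis_wedge)
  also have "\<dots> = (a \<bullet> b) *\<^sub>R \<xi>"
    by (simp add: if_distrib[of "\<lambda>x. _ *\<^sub>R x"] inner_vec_def scaleR_sum_left cong: if_cong)
  finally show ?thesis by (simp add: algebra_simps)
qed

lemma contract_unit [simp]: "contract a (axis {} 1) = 0"
proof -
  have "contract_axis i (axis {} 1) = 0" for i :: 'a
    by (simp add: contract_axis_def vec_eq_iff axis_def)
  then show ?thesis by (simp add: contract_def)
qed

lemma wedge_unit_right: "wedge (embed1 a) (axis {} 1) = embed1 a"
proof -
  have "wedge (axis {i} 1) (axis {} 1) = axis {i} (1::real)" for i :: 'a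
  proof -
    have "wedge (axis {i} 1) (axis {} 1) $ K = axis {i} (1::real) $ K" for K
    proof (cases "K = {i}")
      case True
      have "{j\<in>{i}. j < i} = {}" by auto
      then have "below_sign i {i} = 1" unfolding below_sign_def by (simp only: card.empty power_0)
      with True show ?thesis unfolding wedge_axis_left by (simp add: axis_def)
    next
      case False
      then have "i \<in> K \<Longrightarrow> K - {i} \<noteq> {}" by blast
      with False show ?thesis unfolding wedge_axis_left by (simp add: axis_def)
    qed
    then show ?thesis unfolding vec_eq_iff by blast
  qed
  then show ?thesis unfolding wedge_embed1_left unfolding embed1_def by simp
qed

text \<open>A 2 by 2 Gram determinant, obtained by contracting with a and then pairing with
  b.\<close>

lemma pairing_wedge_embed1:
  "pairing (wedge (embed1 v) (embed1 w)) (wedge (embed1 a) (embed1 b)) =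
    (a \<bullet> v) * (b \<bullet> w) - (a \<bullet> w) * (b \<bullet> v)"
proof -
  have "contract a (embed1 w) = (a \<bullet> w) *\<^sub>R axis {} 1"
    using contract_wedge[of a w "axis {} 1"] by (simp add: wedge_unit_right wedge.zero_right)
  then have "contract a (wedge (embed1 v) (embed1 w)) = (a \<bullet> v) *\<^sub>R embed1 w - (a \<bullet> w) *\<^sub>R embed1 v"
    by (simp add: contract_wedge wedge.scaleR_right wedge_unit_right)
  then show ?thesis
    using pairing_contract[of a "wedge (embed1 v) (embed1 w)" "embed1 b"]
    by (simp add: inner_diff_left inner_diff_right inner_commute)
qed

text \<open>If u \<and> \<eta> = 0, the antiderivation rule leaves u \<and> (c contracted into
  \<eta>) = (c \<bullet> u) \<eta>. Two applications return \<eta> with the 2 by 2 determinant as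
  coefficient, so a vanishing contraction can be read off as a vanishing value on (v, w).\<close>

lemma wedge_wedge_contract_contract:
  assumes "wedge (embed1 v) \<eta> = 0" "wedge (embed1 w) \<eta> = 0"
  shows "wedge (embed1 w) (wedge (embed1 v) (contract b (contract a \<eta>))) =
    - pairing (wedge (embed1 v) (embed1 w)) (wedge (embed1 a) (embed1 b)) *\<^sub>R \<eta>"
proof -
  interpret c: linear "contract b" by (rule linear_contract)
  have 1: "wedge (embed1 u) (contract c \<eta>) = (c \<bullet> u) *\<^sub>R \<eta>" if "wedge (embed1 u) \<eta> = 0" for u c
    using contract_wedge[of c u \<eta>] that linear_0[OF linear_contract, of c] by simp
  have "wedge (embed1 v) (contract b (contract a \<eta>)) = (b \<bullet> v) *\<^sub>R contract a \<eta> - (a \<bullet> v) *\<^sub>R contract b \<eta>"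
    using contract_wedge[of b v "contract a \<eta>"] 1[OF assms(1), of a] by (simp add: c.scale algebra_simps)
  then have "wedge (embed1 w) (wedge (embed1 v) (contract b (contract a \<eta>))) =
      (b \<bullet> v) *\<^sub>R (a \<bullet> w) *\<^sub>R \<eta> - (a \<bullet> v) *\<^sub>R (b \<bullet> w) *\<^sub>R \<eta>"
    using 1[OF assms(2)] by (simp add: wedge.diff_right wedge.scaleR_right)
  then show ?thesis
    by (simp add: pairing_wedge_embed1 algebra_simps)
qed

section \<open>Simple vectors and their spans\<close>

lemma wedge_list_Cons: "wedge_list (v # vs) = wedge (embed1 v) (wedge_list vs)"
  by (simp add: wedge_list_def)

lemma wedge_list_Nil: "wedge_list [] = axis {} 1"
  by (simp add: wedge_list_def)

lemma wedge_list_graded: "wedge_list vs \<in> graded (length vs)"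
proof (induction vs)
  case Nil
  show ?case using axis_graded[of "{}"] by (simp add: wedge_list_Nil)
next
  case (Cons v vs)
  then show ?case using graded_wedge[OF embed1_graded Cons, of v] by (simp add: wedge_list_Cons)
qed

lemma simple_vector_graded: "simple_vector h \<eta> \<Longrightarrow> \<eta> \<in> graded h"
  using wedge_list_graded subspace_scale[OF subspace_graded] unfolding simple_vector_def by blast

lemma wedge_list_member: "x \<in> set vs \<Longrightarrow> wedge (embed1 x) (wedge_list vs) = 0"
proof (induction vs)
  case (Cons v vs)
  then show ?case
    using wedge_embed1_anticommute[of x v "wedge_list vs"]
    by (cases "x = v") (auto simp: wedge_list_Cons wedge.zero_right)
qed simp

lemma wedge_list_span:
  assumes "x \<in> span (set vs)"
  shows "wedge (embed1 x) (wedge_list vs) = 0"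
proof -
  interpret e: linear embed1 by (rule linear_embed1)
  have "subspace {x. wedge (embed1 x) (wedge_list vs) = 0}"
    by (auto simp: subspace_def e.add e.scale wedge.add_left wedge.scaleR_left wedge.zero_left e.zero)
  then have "span (set vs) \<subseteq> {x. wedge (embed1 x) (wedge_list vs) = 0}"
    by (intro span_minimal) (auto simp: wedge_list_member)
  with assms show ?thesis by blast
qed

lemma contract_wedge_list:
  assumes "\<And>v. v \<in> set vs \<Longrightarrow> a \<bullet> v = 0"
  shows "contract a (wedge_list vs) = 0"
  using assms
proof (induction vs)
  case (Cons v vs)
  then show ?case by (simp add: wedge_list_Cons contract_wedge wedge.zero_right)
qed (simp add: wedge_list_Nil)

text \<open>If a is orthogonal to all factors, moving it to the front of the product contracts the
  simple vector to zero, hence a is orthogonal to x. Applied to the component of x orthogonal to the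
  factors, this shows that the component vanishes.\<close>

lemma mv_span_simple_subset:
  assumes h: "h \<ge> 1" "length vs = h" and x: "x \<in> mv_span h (c *\<^sub>R wedge_list vs)"
  shows "x \<in> span (set vs)"
proof -
  obtain \<beta> where \<beta>: "\<beta> \<in> graded (h - 1)" "embed1 x = interior_mult (c *\<^sub>R wedge_list vs) \<beta>"
    using x h by (auto simp: mv_span_def)
  have perp: "a \<bullet> x = 0" if a: "\<And>v. v \<in> set vs \<Longrightarrow> a \<bullet> v = 0" for a
  proof -
    have "x \<bullet> a = pairing (c *\<^sub>R wedge_list vs) (wedge \<beta> (embed1 a))"
      using pairing_interior[of "c *\<^sub>R wedge_list vs" \<beta> "embed1 a"] by (simp add: \<beta>(2)[symmetric])
    also have "\<dots> = c * (-1) ^ (h - 1) * pairing (wedge_list vs) (wedge (embed1 a) \<beta>)"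
      by (simp add: wedge_embed1_commute[OF \<beta>(1)])
    also have "\<dots> = 0"
      using contract_wedge_list[of vs a] a by (simp add: pairing_contract[symmetric])
    finally show ?thesis by (simp add: inner_commute)
  qed
  obtain y z where yz: "y \<in> span (set vs)" "\<And>w. w \<in> span (set vs) \<Longrightarrow> orthogonal z w" "x = y + z"
    using orthogonal_subspace_decomp_exists[of "set vs" x] by metis
  have "z \<bullet> x = 0"
    by (rule perp) (use yz(2) span_base in \<open>auto simp: orthogonal_def\<close>)
  moreover have "z \<bullet> y = 0" using yz by (simp add: orthogonal_def)
  ultimately have "z = 0" using yz(3) by (simp add: inner_add_right)
  with yz show ?thesis by simp
qed

lemma wedge_mv_span:
  assumes "h \<ge> 1" "simple_vector h \<eta>" "x \<in> mv_span h \<eta>"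
  shows "wedge (embed1 x) \<eta> = 0"
proof -
  obtain c vs where "length vs = h" "\<eta> = c *\<^sub>R wedge_list vs"
    using assms(2) by (auto simp: simple_vector_def)
  then show ?thesis
    using mv_span_simple_subset[of h vs x c] assms wedge_list_span[of x vs]
    by (simp add: wedge.scaleR_right)
qed

lemma interior_mult_graded:
  assumes "\<eta> \<in> graded h" "h \<ge> 1" "\<beta> \<in> graded (h - 1)"
  shows "interior_mult \<eta> \<beta> \<in> graded 1"
  unfolding graded_def interior_mult_def
proof (clarsimp)
  fix J assume "pairing \<eta> (wedge \<beta> (axis J 1)) \<noteq> 0"
  then have "h = h - 1 + card J"
    using pairing_graded_neq[OF assms(1) graded_wedge[OF assms(3) axis_graded]] by blast
  then show "card J = Suc 0" using assms(2) by simp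
qed

text \<open>The bridge from tangency, an inclusion of planes, to the integrand of a current. The
  span consists of the interior products of \<eta> with \<beta>, and exchanging \<omega> and \<beta>
  costs the sign (-1)^(h-1).\<close>

lemma mv_span_annihilates_iff:
  fixes \<eta> \<omega> :: "'n::{finite,linorder} exterior"
  assumes \<eta>: "\<eta> \<in> graded h" and h: "h \<ge> 1" and \<omega>: "\<omega> \<in> graded 1"
  shows "(\<forall>x\<in>mv_span h \<eta>. pairing (embed1 x) \<omega> = 0) \<longleftrightarrow>
    (\<forall>\<beta>\<in>graded (h - 1). pairing \<eta> (wedge \<omega> \<beta>) = 0)"
proof -
  have eq: "pairing \<eta> (wedge \<beta> \<omega>) = (-1) ^ (h - 1) * pairing \<eta> (wedge \<omega> \<beta>)" if "\<beta> \<in> graded (h - 1)" for \<beta>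
    by (subst (1 2) graded1_eq_embed1[OF \<omega>]) (simp add: wedge_embed1_commute[OF that])
  show ?thesis
  proof (intro iffI ballI)
    fix \<beta> :: "'n exterior" assume L: "\<forall>x\<in>mv_span h \<eta>. pairing (embed1 x) \<omega> = 0" and \<beta>: "\<beta> \<in> graded (h - 1)"
    have "interior_mult \<eta> \<beta> = embed1 (\<chi> i. interior_mult \<eta> \<beta> $ {i})"
      by (rule graded1_eq_embed1[OF interior_mult_graded[OF \<eta> h \<beta>]])
    moreover from this have "(\<chi> i. interior_mult \<eta> \<beta> $ {i}) \<in> mv_span h \<eta>"
      using h \<beta> by (auto simp: mv_span_def intro!: bexI[of _ \<beta>])
    ultimately have "pairing (interior_mult \<eta> \<beta>) \<omega> = 0" using L by metis
    then show "pairing \<eta> (wedge \<omega> \<beta>) = 0"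
      using eq[OF \<beta>] by (simp add: pairing_interior)
  next
    fix x assume R: "\<forall>\<beta>\<in>graded (h - 1). pairing \<eta> (wedge \<omega> \<beta>) = 0" and "x \<in> mv_span h \<eta>"
    then obtain \<beta> where "\<beta> \<in> graded (h - 1)" "embed1 x = interior_mult \<eta> \<beta>"
      using h by (auto simp: mv_span_def)
    then show "pairing (embed1 x) \<omega> = 0" using R eq by (simp add: pairing_interior)
  qed
qed

lemma graded_eq_sum_axis:
  assumes "\<beta> \<in> graded p"
  shows "\<beta> = (\<Sum>I | card I = p. \<beta> $ I *\<^sub>R axis I 1)"
proof -
  have "\<beta> $ J = (\<Sum>I | card I = p. \<beta> $ I *\<^sub>R axis I 1) $ J" for J
  proof -
    have "(\<Sum>I | card I = p. \<beta> $ I *\<^sub>R axis I 1) $ J = (\<Sum>I | card I = p. if I = J then \<beta> $ J else 0)"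
      unfolding sum_component by (intro sum.cong) (auto simp: axis_def)
    also have "\<dots> = \<beta> $ J" using assms by (auto simp: graded_def)
    finally show ?thesis by (rule sym)
  qed
  then show ?thesis unfolding vec_eq_iff by blast
qed

text \<open>Reduction to finitely many basis covectors, which turns tangency into a measurable
  condition.\<close>

lemma pairing_wedge_graded_iff:
  fixes \<eta> \<omega> :: "'n::{finite,linorder} exterior"
  shows "(\<forall>\<beta>\<in>graded p. pairing \<eta> (wedge \<omega> \<beta>) = 0) \<longleftrightarrow> (\<forall>I. card I = p \<longrightarrow> pairing \<eta> (wedge \<omega> (axis I 1)) = 0)"
proof (intro iffI ballI allI impI)
  fix \<beta> :: "'n exterior" assume *: "\<forall>I. card I = p \<longrightarrow> pairing \<eta> (wedge \<omega> (axis I 1)) = 0" and "\<beta> \<in> graded p"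
  then show "pairing \<eta> (wedge \<omega> \<beta>) = 0"
    by (subst graded_eq_sum_axis[of \<beta> p]) (simp_all add: wedge.sum_right wedge.scaleR_right inner_sum_right)
qed (use axis_graded in auto)

text \<open>The hypothesis says that \<open>\<eta>\<close> contracted with \<open>\<Sum>\<^sub>i a\<^sub>i \<and> b\<^sub>i\<close> vanishes.\<close>

lemma two_covector_vanishes:
  fixes \<eta> :: "'n::{finite,linorder} exterior"
  assumes k: "k \<ge> 2" and \<eta>: "simple_vector k \<eta>" "\<eta> \<noteq> 0"
    and zero: "\<And>\<alpha>. \<alpha> \<in> graded (k - 2) \<Longrightarrow>
      pairing \<eta> (\<Sum>i\<in>I. wedge (embed1 (a i)) (wedge (embed1 (b i)) \<alpha>)) = 0"
    and vw: "v \<in> mv_span k \<eta>" "w \<in> mv_span k \<eta>"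
  shows "pairing (wedge (embed1 v) (embed1 w)) (\<Sum>i\<in>I. wedge (embed1 (a i)) (embed1 (b i))) = 0"
proof -
  let ?c = "\<Sum>i\<in>I. contract (b i) (contract (a i) \<eta>)"
  have pair: "pairing ?c \<alpha> = pairing \<eta> (\<Sum>i\<in>I. wedge (embed1 (a i)) (wedge (embed1 (b i)) \<alpha>))" for \<alpha>
    by (simp add: inner_sum_left inner_sum_right pairing_contract)
  \<comment> \<open>Degrees other than k - 2 vanish by grading alone, so \<open>?c\<close> is zero
    as an element of the whole exterior algebra.\<close>
  have "pairing ?c (axis J 1) = 0" for J
  proof (cases "card J = k - 2")
    case True
    then show ?thesis using zero[of "axis J 1"] axis_graded[of J] pair by simp
  next
    case False
    have "wedge (embed1 (a i)) (wedge (embed1 (b i)) (axis J 1)) \<in> graded (1 + (1 + card J))" for i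
      by (intro graded_wedge embed1_graded axis_graded)
    then have "pairing \<eta> (wedge (embed1 (a i)) (wedge (embed1 (b i)) (axis J 1))) = 0" for i
      using False k by (intro pairing_graded_neq[OF simple_vector_graded[OF \<eta>(1)]]) auto
    then show ?thesis unfolding pair by (simp add: inner_sum_right)
  qed
  then have "?c = 0" by (simp add: vec_eq_iff inner_axis)
  \<comment> \<open>Wedging back with v and w recovers a multiple of the nonzero \<eta>, whose
    coefficient is up to sign the value in question.\<close>
  then have "0 = wedge (embed1 w) (wedge (embed1 v) ?c)"
    by (simp add: wedge.zero_right)
  also have "\<dots> = (\<Sum>i\<in>I. wedge (embed1 w) (wedge (embed1 v) (contract (b i) (contract (a i) \<eta>))))"
    by (simp add: wedge.sum_right)
  also have "\<dots> = (\<Sum>i\<in>I. - pairing (wedge (embed1 v) (embed1 w)) (wedge (embed1 (a i)) (embed1 (b i))) *\<^sub>R \<eta>)"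
    using k \<eta> vw by (intro sum.cong wedge_wedge_contract_contract wedge_mv_span refl) auto
  also have "\<dots> = - pairing (wedge (embed1 v) (embed1 w)) (\<Sum>i\<in>I. wedge (embed1 (a i)) (embed1 (b i))) *\<^sub>R \<eta>"
    by (simp add: inner_sum_right scaleR_sum_left sum_negf)
  finally show ?thesis using \<eta>(2) by simp
qed

section \<open>A smooth bump\<close>

text \<open>The classical exp(-1/t) is the case m = 0. The powers of 1/t make the family, up to
  linear combinations, closed under differentiation.\<close>

definition exp_recip :: "nat \<Rightarrow> real \<Rightarrow> real" where
  "exp_recip m t = (if t \<le> 0 then 0 else exp (- inverse t) * inverse t ^ m)"

lemma exp_recip_div_tendsto: "((\<lambda>t. exp_recip m t / t) \<longlongrightarrow> 0) (at_right 0)"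
proof -
  have "((\<lambda>u::real. u ^ Suc m / exp u) \<longlongrightarrow> 0) at_top"
    by (rule tendsto_power_div_exp_0)
  then have "((\<lambda>t. inverse t ^ Suc m / exp (inverse t)) \<longlongrightarrow> 0) (at_right (0::real))"
    by (rule filterlim_compose[OF _ filterlim_inverse_at_top_right])
  then show ?thesis
  proof (rule Lim_transform_eventually)
    have "\<forall>\<^sub>F r in at_right (0::real). r > 0" by (rule eventually_at_right_less)
    then show "\<forall>\<^sub>F t in at_right 0. inverse t ^ Suc m / exp (inverse t) = exp_recip m t / t"
      by eventually_elim (simp add: exp_recip_def exp_minus divide_inverse)
  qed
qed

text \<open>At t = 0 the difference quotient is \<open>exp_recip m t / t\<close>, which tends to 0
  because the exponential beats every power.\<close>

lemma has_real_derivative_exp_recip: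
  "(exp_recip m has_real_derivative (exp_recip (m + 2) t - real m * exp_recip (m + 1) t)) (at t)"
proof -
  consider "t > 0" | "t < 0" | "t = 0" by linarith
  then show ?thesis
  proof cases
    case 1
    have "((\<lambda>t. exp (- inverse t) * inverse t ^ m) has_real_derivative
      (exp (- inverse t) * (inverse t)\<^sup>2 * inverse t ^ m -
       real m * inverse t ^ (m - Suc 0) * (inverse t)\<^sup>2 * exp (- inverse t))) (at t)"
      using 1 by (auto intro!: derivative_eq_intros simp: power2_eq_square)
    also have "exp (- inverse t) * (inverse t)\<^sup>2 * inverse t ^ m -
       real m * inverse t ^ (m - Suc 0) * (inverse t)\<^sup>2 * exp (- inverse t) =
       exp_recip (m + 2) t - real m * exp_recip (m + 1) t"
      using 1 by (cases m) (simp_all add: exp_recip_def power2_eq_square)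
    finally have "((\<lambda>t. exp (- inverse t) * inverse t ^ m) has_real_derivative
      (exp_recip (m + 2) t - real m * exp_recip (m + 1) t)) (at t)" .
    moreover have "open {0::real<..}" by simp
    ultimately show ?thesis
      by (rule has_field_derivative_transform_within_open) (use 1 in \<open>auto simp: exp_recip_def\<close>)
  next
    case 2
    have "((\<lambda>t. 0) has_real_derivative 0) (at t)" by simp
    then have "(exp_recip m has_real_derivative 0) (at t)"
      by (rule has_field_derivative_transform_within_open[of _ _ _ "{..<0}"]) (use 2 in \<open>auto simp: exp_recip_def\<close>)
    then show ?thesis using 2 by (simp add: exp_recip_def)
  next
    case 3
    have "((\<lambda>t. exp_recip m t / t) \<longlongrightarrow> 0) (at_left 0)"
    proof (rule tendsto_eventually)
      show "\<forall>\<^sub>F t in at_left 0. exp_recip m t / t = 0"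
        by (rule eventually_at_leftI[of "-1"]) (auto simp: exp_recip_def)
    qed
    then have "((\<lambda>t. exp_recip m t / t) \<longlongrightarrow> 0) (at 0)"
      using exp_recip_div_tendsto by (rule filterlim_split_at)
    then show ?thesis unfolding 3 DERIV_def by (simp add: exp_recip_def)
  qed
qed

text \<open>An algebra of functions that contains the bump \<open>exp (- 1 / s)\<close> and is closed under partial
  derivatives, so that its members are smooth.\<close>

inductive bump_algebra :: "'n::finite euclid \<Rightarrow> real \<Rightarrow> ('n euclid \<Rightarrow> real) \<Rightarrow> bool"
  for c :: "'n::finite euclid" and r :: real where
  const: "bump_algebra c r (\<lambda>x. a)"
| coord: "bump_algebra c r (\<lambda>x. x $ i)"
| bump: "bump_algebra c r (\<lambda>x. exp_recip m (1 - (x - c) \<bullet> (x - c) / r\<^sup>2))"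
| add: "bump_algebra c r f \<Longrightarrow> bump_algebra c r g \<Longrightarrow> bump_algebra c r (\<lambda>x. f x + g x)"
| mult: "bump_algebra c r f \<Longrightarrow> bump_algebra c r g \<Longrightarrow> bump_algebra c r (\<lambda>x. f x * g x)"

lemma bump_algebra_sum:
  "(\<And>i. i \<in> I \<Longrightarrow> bump_algebra c r (f i)) \<Longrightarrow> bump_algebra c r (\<lambda>x. \<Sum>i\<in>I. f i x)"
  by (induction I rule: infinite_finite_induct) (auto intro: bump_algebra.intros)

lemma bump_algebra_inner: "bump_algebra c r (\<lambda>x. (x - c) \<bullet> axis i 1)"
proof -
  have "bump_algebra c r (\<lambda>x. x $ i + (- (c $ i)))"
    by (intro bump_algebra.intros)
  then show ?thesis by (simp add: inner_axis)
qed

lemma bump_algebra_deriv: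
  assumes "bump_algebra c r f"
  shows "\<exists>f'. (\<forall>x. (f has_derivative f' x) (at x)) \<and> (\<forall>i. bump_algebra c r (\<lambda>x. f' x (axis i 1)))"
  using assms
proof induction
  case (const a)
  show ?case by (intro exI[of _ "\<lambda>x v. 0"]) (auto intro: bump_algebra.const)
next
  case (coord i)
  have "((\<lambda>x. x $ i) has_derivative (\<lambda>v. v $ i)) (at x)" for x :: "'a euclid"
    by (rule bounded_linear_imp_has_derivative[OF bounded_linear_vec_nth])
  then show ?case by (intro exI[of _ "\<lambda>x v. v $ i"]) (auto intro: bump_algebra.const)
next
  case (bump m)
  let ?s = "\<lambda>x. 1 - (x - c) \<bullet> (x - c) / r\<^sup>2"
  let ?d = "\<lambda>x. exp_recip (m + 2) (?s x) + (- real m) * exp_recip (m + 1) (?s x)"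
  have "((\<lambda>x. exp_recip m (?s x)) has_derivative (\<lambda>v. ?d x * ((- 1 / r\<^sup>2) * (2 * ((x - c) \<bullet> v))))) (at x)" for x
  proof -
    have "(?s has_derivative (\<lambda>v. (- 1 / r\<^sup>2) * (2 * ((x - c) \<bullet> v)))) (at x)"
      unfolding divide_inverse
      by (auto intro!: derivative_eq_intros simp: inner_commute)
    from has_derivative_compose[OF this has_real_derivative_exp_recip[of m "?s x", unfolded has_field_derivative_def]]
    show ?thesis by simp
  qed
  moreover have "bump_algebra c r (\<lambda>x. ?d x * ((- 1 / r\<^sup>2) * (2 * ((x - c) \<bullet> axis i 1))))" for i
    by (intro bump_algebra.intros bump_algebra_inner)
  ultimately show ?case
    by (intro exI[of _ "\<lambda>x v. ?d x * ((- 1 / r\<^sup>2) * (2 * ((x - c) \<bullet> v)))"] conjI allI)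
next
  case (add f g)
  then obtain f' g' where "\<forall>x. (f has_derivative f' x) (at x)" "\<forall>i. bump_algebra c r (\<lambda>x. f' x (axis i 1))"
    "\<forall>x. (g has_derivative g' x) (at x)" "\<forall>i. bump_algebra c r (\<lambda>x. g' x (axis i 1))" by blast
  then show ?case
    by (intro exI[of _ "\<lambda>x v. f' x v + g' x v"]) (auto intro: bump_algebra.add has_derivative_add)
next
  case (mult f g)
  then obtain f' g' where fg: "\<forall>x. (f has_derivative f' x) (at x)" "\<forall>i. bump_algebra c r (\<lambda>x. f' x (axis i 1))"
    "\<forall>x. (g has_derivative g' x) (at x)" "\<forall>i. bump_algebra c r (\<lambda>x. g' x (axis i 1))" by blast
  show ?case
    using fg mult by (intro exI[of _ "\<lambda>x v. f x * g' x v + f' x v * g x"])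
      (auto intro!: bump_algebra.add bump_algebra.mult has_derivative_mult)
qed

lemma partial_eq: "(f has_derivative f') (at x) \<Longrightarrow> partial i f x = f' (axis i 1)"
  unfolding partial_def by (simp add: frechet_derivative_at[symmetric])

lemma has_derivative_vec_lambda:
  fixes f :: "'a::real_normed_vector \<Rightarrow> real ^ 'm::finite"
  assumes "\<And>I. ((\<lambda>x. f x $ I) has_derivative (\<lambda>v. f' v $ I)) (at x within S)"
  shows "(f has_derivative f') (at x within S)"
proof (rule has_derivative_componentwise_within[THEN iffD2], rule ballI)
  fix b :: "real ^ 'm" assume "b \<in> Basis"
  then obtain I where "b = axis I 1" by (auto simp: Basis_vec_def)
  then show "((\<lambda>x. f x \<bullet> b) has_derivative (\<lambda>v. f' v \<bullet> b)) (at x within S)"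
    using assms[of I] by (simp add: inner_axis)
qed

lemma bump_algebra_vec_deriv:
  fixes f :: "'n::finite euclid \<Rightarrow> real ^ 'm::finite"
  assumes "\<And>I. bump_algebra c r (\<lambda>x. f x $ I)"
  shows "f differentiable (at x)" "bump_algebra c r (\<lambda>x. partial i f x $ I)"
proof -
  have "\<exists>f'. (\<forall>x. ((\<lambda>x. f x $ I) has_derivative f' x) (at x)) \<and> (\<forall>i. bump_algebra c r (\<lambda>x. f' x (axis i 1)))" for I
    by (rule bump_algebra_deriv[OF assms])
  then obtain F where F: "\<And>I x. ((\<lambda>x. f x $ I) has_derivative F I x) (at x)"
    "\<And>I i. bump_algebra c r (\<lambda>x. F I x (axis i 1))" by metis
  have D: "(f has_derivative (\<lambda>v. \<chi> I. F I x v)) (at x)" for x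
    by (rule has_derivative_vec_lambda) (simp add: F)
  then show "f differentiable (at x)" unfolding differentiable_def by blast
  show "bump_algebra c r (\<lambda>x. partial i f x $ I)"
    by (simp add: partial_eq[OF D] F)
qed

lemma bump_algebra_C_on:
  fixes f :: "'n::finite euclid \<Rightarrow> real ^ 'm::finite"
  assumes "\<And>I. bump_algebra c r (\<lambda>x. f x $ I)"
  shows "C_on p f UNIV"
  using assms
proof (induction p arbitrary: f)
  case 0
  have "f differentiable_on UNIV"
    unfolding differentiable_on_def using bump_algebra_vec_deriv(1)[OF 0] by simp
  then show ?case by (simp add: differentiable_imp_continuous_on)
next
  case (Suc p)
  have "f differentiable_on UNIV"
    unfolding differentiable_on_def using bump_algebra_vec_deriv(1)[OF Suc.prems] by simp
  moreover have "C_on p (partial i f) UNIV" for i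
    by (rule Suc.IH) (rule bump_algebra_vec_deriv(2)[OF Suc.prems])
  ultimately show ?case by simp
qed

section \<open>The bump function and its gradient\<close>

definition bump :: "'n::finite euclid \<Rightarrow> real \<Rightarrow> 'n euclid \<Rightarrow> real" where
  "bump c r x = exp_recip 0 (1 - (x - c) \<bullet> (x - c) / r\<^sup>2)"

lemma bump_algebra_bump: "bump_algebra c r (bump c r)"
  unfolding bump_def[abs_def] by (rule bump_algebra.bump)

lemma bump_bounds: "0 \<le> bump c r x" "bump c r x \<le> 1"
  by (auto simp: bump_def exp_recip_def)

lemma exp_recip_outside: "r > 0 \<Longrightarrow> x \<notin> ball c r \<Longrightarrow> exp_recip m (1 - (x - c) \<bullet> (x - c) / r\<^sup>2) = 0"
  by (auto simp: exp_recip_def dist_norm norm_minus_commute power_mono field_simps simp flip: power2_norm_eq_inner)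

lemma bump_outside: "r > 0 \<Longrightarrow> x \<notin> ball c r \<Longrightarrow> bump c r x = 0"
  unfolding bump_def by (rule exp_recip_outside)

text \<open>On the half ball the argument of \<open>exp_recip 0\<close> is at least 3/4; the rounder
  bound 1/2 gives exp(-2).\<close>

lemma bump_lower:
  assumes "r > 0" "x \<in> ball c (r / 2)"
  shows "exp (- 2) \<le> bump c r x"
proof -
  have "(norm (x - c))\<^sup>2 \<le> (r / 2)\<^sup>2"
    using assms by (intro power_mono) (auto simp: dist_norm norm_minus_commute)
  then have "(x - c) \<bullet> (x - c) / r\<^sup>2 \<le> 1 / 4"
    using assms by (simp add: power2_norm_eq_inner power_divide divide_le_eq)
  then have *: "1 / 2 \<le> 1 - (x - c) \<bullet> (x - c) / r\<^sup>2" by linarith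
  then have "inverse (1 - (x - c) \<bullet> (x - c) / r\<^sup>2) \<le> inverse (1 / 2)"
    by (intro le_imp_inverse_le) auto
  moreover have "0 < 1 - (x - c) \<bullet> (x - c) / r\<^sup>2" using * by linarith
  ultimately show ?thesis by (simp add: bump_def exp_recip_def del: diff_gt_0_iff_gt)
qed

text \<open>The index 2 arises because the derivative of \<open>exp_recip 0\<close> is
  \<open>exp_recip 2\<close>: the other term carries the factor m = 0.\<close>

definition bump_grad :: "'n::finite euclid \<Rightarrow> real \<Rightarrow> 'n euclid \<Rightarrow> 'n euclid" where
  "bump_grad c r x = (- 2 / r\<^sup>2 * exp_recip 2 (1 - (x - c) \<bullet> (x - c) / r\<^sup>2)) *\<^sub>R (x - c)"

lemma has_derivative_bump: "(bump c r has_derivative (\<lambda>v. bump_grad c r x \<bullet> v)) (at x)"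
proof -
  let ?s = "\<lambda>x. 1 - (x - c) \<bullet> (x - c) / r\<^sup>2"
  have "(?s has_derivative (\<lambda>v. (- 1 / r\<^sup>2) * (2 * ((x - c) \<bullet> v)))) (at x)"
    unfolding divide_inverse
    by (auto intro!: derivative_eq_intros simp: inner_commute)
  from has_derivative_compose[OF this has_real_derivative_exp_recip[of 0 "?s x", unfolded has_field_derivative_def]]
  show ?thesis by (simp add: bump_grad_def bump_def[abs_def] numeral_2_eq_2 mult_ac)
qed

text \<open>With u = 1/t this is the Taylor estimate u^2/2 \<le> exp u.\<close>

lemma exp_recip_2_le: "exp_recip 2 t \<le> 2"
proof (cases "t > 0")
  case True
  define u where "u = inverse t"
  have u: "u > 0" using True by (simp add: u_def)
  have "u\<^sup>2 / 2 \<le> exp u" using exp_lower_Taylor_quadratic[of u] u by simp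
  then have "exp (- u) * u\<^sup>2 \<le> 2" by (simp add: exp_minus field_simps)
  with True show ?thesis by (simp add: exp_recip_def u_def)
qed (simp add: exp_recip_def)

lemma exp_recip_nonneg: "0 \<le> exp_recip m t"
  by (simp add: exp_recip_def)

lemma bump_grad_outside: "r > 0 \<Longrightarrow> x \<notin> ball c r \<Longrightarrow> bump_grad c r x = 0"
  by (simp add: bump_grad_def exp_recip_outside del: mem_ball)

lemma norm_bump_grad_le:
  assumes r: "r > 0"
  shows "norm (bump_grad c r x) \<le> 4 / r"
proof (cases "x \<in> ball c r")
  case True
  have "norm (bump_grad c r x) = 2 / r\<^sup>2 * exp_recip 2 (1 - (x - c) \<bullet> (x - c) / r\<^sup>2) * norm (x - c)"
    by (simp add: bump_grad_def abs_mult exp_recip_nonneg)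
  also have "\<dots> \<le> 2 / r\<^sup>2 * 2 * r"
    using True r by (intro mult_mono exp_recip_2_le) (auto simp: exp_recip_nonneg dist_norm norm_minus_commute)
  also have "\<dots> = 4 / r" using r by (simp add: power2_eq_square)
  finally show ?thesis .
qed (use r in \<open>simp add: bump_grad_outside del: mem_ball\<close>)

section \<open>Tangency and involutivity\<close>

lemma integral_repr_weight:
  assumes "integral_repr \<Omega> h T R \<eta> \<theta>"
  shows "integrable (hausdorff_measure h) (\<lambda>y. indicator R y * \<theta> y)"
proof -
  have "integrable (hausdorff_measure h) (\<lambda>y. indicator \<Omega> y *\<^sub>R \<theta> y)" and R: "R = {x\<in>\<Omega>. \<theta> x \<noteq> 0}"
    using assms by (auto simp: integral_repr_def rectifiable_repr_def set_integrable_def)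
  moreover have "(\<lambda>y. indicator \<Omega> y *\<^sub>R \<theta> y) = (\<lambda>y. indicator R y * \<theta> y)"
    by (auto simp: R indicator_def fun_eq_iff)
  ultimately show ?thesis by simp
qed

lemma integral_repr_ge_1:
  assumes "integral_repr \<Omega> h T R \<eta> \<theta>" "y \<in> R"
  shows "\<theta> y \<ge> 1"
proof -
  have "\<theta> y \<in> \<int>" and pos: "\<theta> y > 0" using assms by (auto simp: integral_repr_def)
  then obtain z where "\<theta> y = of_int z" by (elim Ints_cases)
  with pos show ?thesis by simp
qed

text \<open>Integer multiplicity enters here: \<theta> \<ge> 1 on R bounds the measure of R by the
  integral of \<theta>. The density and Lebesgue point results rely on this finiteness.\<close>

lemma integral_repr_sets:
  fixes R :: "'n::{finite,linorder} euclid set"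
  assumes repr: "integral_repr \<Omega> h T R \<eta> \<theta>"
  shows "R \<in> sets (hausdorff_measure h)" and "hausdorff_outer h R < \<infinity>"
proof -
  let ?H = "hausdorff_measure h :: 'n euclid measure"
  have [measurable]: "(\<lambda>y. indicator R y * \<theta> y) \<in> borel_measurable ?H"
    by (rule borel_measurable_integrable[OF integral_repr_weight[OF repr]])
  have "R = {y\<in>space ?H. indicator R y * \<theta> y \<noteq> 0}"
    using integral_repr_ge_1[OF repr] by (force simp: indicator_def)
  also have "\<dots> \<in> sets ?H" by measurable
  finally show R: "R \<in> sets ?H" .
  have "emeasure ?H R = (\<integral>\<^sup>+y. indicator R y \<partial>?H)" using R by simp
  also have "\<dots> \<le> (\<integral>\<^sup>+y. ennreal (norm (indicator R y * \<theta> y)) \<partial>?H)"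
    using integral_repr_ge_1[OF repr] by (intro nn_integral_mono) (force simp: indicator_def)
  also have "\<dots> < \<infinity>"
    using integral_repr_weight[OF repr] unfolding integrable_iff_bounded by blast
  finally show "hausdorff_outer h R < \<infinity>" by (simp add: emeasure_hausdorff_measure[OF R])
qed

lemma integral_repr_orientation:
  assumes "integral_repr \<Omega> h T R \<eta> \<theta>" "y \<in> R"
  shows "\<eta> y \<in> graded h" "norm (\<eta> y) = 1" "simple_vector h (\<eta> y)" "y \<in> \<Omega>"
  using assms simple_vector_graded[of h "\<eta> y"]
  by (auto simp: integral_repr_def rectifiable_repr_def)

text \<open>The orientation is Borel relative to R, and R is only Caratheodory measurable. The trace
  sigma-algebra on R is therefore enlarged first, and the extension by zero comes
  afterwards.\<close>

lemma integral_repr_measurable: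
  fixes R :: "'n::{finite,linorder} euclid set"
  assumes repr: "integral_repr \<Omega> h T R \<eta> \<theta>"
  shows "(\<lambda>y. indicator R y *\<^sub>R \<eta> y) \<in> borel_measurable (hausdorff_measure h)"
proof -
  let ?H = "hausdorff_measure h :: 'n euclid measure"
  have R: "R \<in> sets ?H" by (rule integral_repr_sets[OF repr])
  have "\<eta> \<in> borel_measurable (restrict_space borel R)"
    using repr by (auto simp: integral_repr_def rectifiable_repr_def)
  moreover have "sets (restrict_space borel R) \<subseteq> sets (restrict_space ?H R)"
    using borel_subset_hausdorff[of h] by (auto simp: sets_restrict_space)
  ultimately have "\<eta> \<in> borel_measurable (restrict_space ?H R)"
    using measurable_mono[of borel borel "restrict_space borel R" "restrict_space ?H R"]
    by (auto simp: space_restrict_space)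
  then show ?thesis
    using R by (subst (asm) borel_measurable_restrict_space_iff) auto
qed

lemma integral_repr_vector_integrable:
  fixes R :: "'n::{finite,linorder} euclid set"
  assumes repr: "integral_repr \<Omega> h T R \<eta> \<theta>"
  shows "set_integrable (hausdorff_measure h) R (\<lambda>y. \<theta> y *\<^sub>R \<eta> y)"
    unfolding set_integrable_def
  proof (rule Bochner_Integration.integrable_bound[OF integral_repr_weight[OF repr]])
    have "(\<lambda>y. (indicator R y * \<theta> y) *\<^sub>R (indicator R y *\<^sub>R \<eta> y)) \<in> borel_measurable (hausdorff_measure h)"
      by (intro borel_measurable_scaleR integral_repr_measurable[OF repr]
          borel_measurable_integrable[OF integral_repr_weight[OF repr]])
    also have "(\<lambda>y. (indicator R y * \<theta> y) *\<^sub>R (indicator R y *\<^sub>R \<eta> y)) = (\<lambda>y. indicator R y *\<^sub>R \<theta> y *\<^sub>R \<eta> y)"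
      by (auto simp: fun_eq_iff indicator_def)
    finally show "(\<lambda>y. indicator R y *\<^sub>R \<theta> y *\<^sub>R \<eta> y) \<in> borel_measurable (hausdorff_measure h)" .
    show "AE y in (hausdorff_measure h). norm (indicator R y *\<^sub>R \<theta> y *\<^sub>R \<eta> y) \<le> norm (indicator R y * \<theta> y)"
      using integral_repr_orientation(2)[OF repr] by (auto simp: indicator_def)
  qed

lemma integral_repr_pairing_integrable:
  fixes R :: "'n::{finite,linorder} euclid set"
  assumes repr: "integral_repr \<Omega> h T R \<eta> \<theta>"
    and F: "F \<in> borel_measurable borel"
    and bound: "integrable (hausdorff_measure h) b"
      "\<And>y. y \<in> R \<Longrightarrow> \<bar>pairing (\<eta> y) (F y) * \<theta> y\<bar> \<le> b y" "\<And>y. 0 \<le> b y"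
  shows "set_integrable (hausdorff_measure h) R (\<lambda>y. pairing (\<eta> y) (F y) * \<theta> y)"
    and "\<bar>LINT y:R|hausdorff_measure h. pairing (\<eta> y) (F y) * \<theta> y\<bar> \<le> (LINT y|hausdorff_measure h. b y)"
proof -
  let ?H = "hausdorff_measure h :: 'n euclid measure"
  have [measurable]: "(\<lambda>y. indicator R y * \<theta> y) \<in> borel_measurable ?H"
    by (rule borel_measurable_integrable[OF integral_repr_weight[OF repr]])
  have [measurable]: "(\<lambda>y. indicator R y *\<^sub>R \<eta> y) \<in> borel_measurable ?H"
    by (rule integral_repr_measurable[OF repr])
  have [measurable]: "F \<in> borel_measurable ?H" by (rule borel_measurable_hausdorff[OF F])
  have "(\<lambda>y. pairing (indicator R y *\<^sub>R \<eta> y) (F y) * (indicator R y * \<theta> y)) \<in> borel_measurable ?H"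
    by measurable
  also have "(\<lambda>y. pairing (indicator R y *\<^sub>R \<eta> y) (F y) * (indicator R y * \<theta> y)) =
      (\<lambda>y. indicator R y *\<^sub>R (pairing (\<eta> y) (F y) * \<theta> y))"
    by (auto simp: fun_eq_iff indicator_def)
  finally have meas: "(\<lambda>y. indicator R y *\<^sub>R (pairing (\<eta> y) (F y) * \<theta> y)) \<in> borel_measurable ?H" .
  have le: "norm (indicator R y *\<^sub>R (pairing (\<eta> y) (F y) * \<theta> y)) \<le> b y" for y
    using bound(2,3)[of y] by (auto simp: indicator_def)
  have int: "integrable ?H (\<lambda>y. indicator R y *\<^sub>R (pairing (\<eta> y) (F y) * \<theta> y))"
    by (rule Bochner_Integration.integrable_bound[OF bound(1) meas])
       (use le bound(3) in \<open>auto intro!: AE_I2 simp: order_trans[OF _ abs_ge_self]\<close>)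
  then show "set_integrable ?H R (\<lambda>y. pairing (\<eta> y) (F y) * \<theta> y)" by (simp add: set_integrable_def)
  show "\<bar>LINT y:R|?H. pairing (\<eta> y) (F y) * \<theta> y\<bar> \<le> (LINT y|?H. b y)"
    using Bochner_Integration.integral_norm_bound_integral[OF int bound(1)] le
    by (simp add: set_lebesgue_integral_def)
qed

section \<open>The nontangential part of a current\<close>

lemma borel_measurable_wedge:
  "f \<in> borel_measurable M \<Longrightarrow> g \<in> borel_measurable M \<Longrightarrow> (\<lambda>y. wedge (f y) (g y)) \<in> borel_measurable M"
  by (rule borel_measurable_continuous_Pair) (auto intro!: continuous_intros wedge.continuous_on)

lemma defining_formsD:
  fixes D :: "'n::finite euclid \<Rightarrow> 'n euclid set"
  assumes "defining_forms p k D U \<omega>" "y \<in> U"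
  shows "D y = {v. \<forall>j < CARD('n) - k. pairing (embed1 v) (\<omega> j y) = 0}"
    and "j < CARD('n) - k \<Longrightarrow> \<omega> j y \<in> graded 1"
  using assms unfolding defining_forms_def by blast+

text \<open>Tested on basis covectors, nontangency is a finite disjunction of measurable
  inequalities. The restriction to B is needed for the defining forms, which live on U.\<close>

lemma tangency_set_measurable:
  fixes R :: "'n::{finite,linorder} euclid set"
  assumes repr: "integral_repr \<Omega> h T R \<eta> \<theta>" and h: "h \<ge> 1"
    and df: "defining_forms 1 k D U \<omega>" and U: "open U" and B: "B \<in> sets borel" "B \<subseteq> U"
  shows "B \<inter> (R - tangency_set \<Omega> h \<eta> D) \<in> sets (hausdorff_measure h)"
proof -
  let ?H = "hausdorff_measure h :: 'n euclid measure"
  let ?q = "CARD('n) - k"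
  have [measurable]: "(\<lambda>y. indicator R y *\<^sub>R \<eta> y) \<in> borel_measurable ?H"
    by (rule integral_repr_measurable[OF repr])
  have [measurable]: "R \<in> sets ?H" by (rule integral_repr_sets[OF repr])
  have [measurable]: "B \<in> sets ?H" using B by blast
  have \<omega>m [measurable]: "(\<lambda>y. indicator U y *\<^sub>R \<omega> j y) \<in> borel_measurable ?H" if "j < ?q" for j
  proof -
    have "continuous_on U (\<omega> j)"
      using df that by (auto simp: defining_forms_def differentiable_imp_continuous_on)
    then show ?thesis
      using U by (intro borel_measurable_hausdorff borel_measurable_continuous_on_indicator) auto
  qed
  have "B \<inter> (R - tangency_set \<Omega> h \<eta> D) =
    {y\<in>space ?H. y \<in> B \<and> y \<in> R \<and> (\<exists>j\<in>{..<?q}. \<exists>I\<in>{I. card I = h - 1}.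
       pairing (indicator R y *\<^sub>R \<eta> y) (wedge (indicator U y *\<^sub>R \<omega> j y) (axis I 1)) \<noteq> 0)}"
  proof -
    have "mv_span h (\<eta> y) \<subseteq> D y \<longleftrightarrow>
      (\<forall>j<?q. \<forall>I. card I = h - 1 \<longrightarrow> pairing (\<eta> y) (wedge (\<omega> j y) (axis I 1)) = 0)"
      if y: "y \<in> B" "y \<in> R" for y
    proof -
      have "mv_span h (\<eta> y) \<subseteq> D y \<longleftrightarrow> (\<forall>j<?q. \<forall>x\<in>mv_span h (\<eta> y). pairing (embed1 x) (\<omega> j y) = 0)"
        using defining_formsD(1)[OF df, of y] y B by blast
      also have "\<dots> \<longleftrightarrow> (\<forall>j<?q. \<forall>\<beta>\<in>graded (h - 1). pairing (\<eta> y) (wedge (\<omega> j y) \<beta>) = 0)"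
      proof -
        have "(\<forall>x\<in>mv_span h (\<eta> y). pairing (embed1 x) (\<omega> j y) = 0) \<longleftrightarrow>
          (\<forall>\<beta>\<in>graded (h - 1). pairing (\<eta> y) (wedge (\<omega> j y) \<beta>) = 0)" if "j < ?q" for j
        proof (rule mv_span_annihilates_iff[OF _ h])
          show "\<eta> y \<in> graded h" using integral_repr_orientation[OF repr] y by blast
          show "\<omega> j y \<in> graded 1" using df that y B by (auto simp: defining_forms_def)
        qed
        then show ?thesis by blast
      qed
      finally show ?thesis unfolding pairing_wedge_graded_iff .
    qed
    then have "y \<notin> tangency_set \<Omega> h \<eta> D \<longleftrightarrow> (\<exists>j\<in>{..<?q}. \<exists>I\<in>{I. card I = h - 1}.
        pairing (indicator R y *\<^sub>R \<eta> y) (wedge (indicator U y *\<^sub>R \<omega> j y) (axis I 1)) \<noteq> 0)"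
      if "y \<in> B" "y \<in> R" for y
      using that B(2) integral_repr_orientation(4)[OF repr that(2)]
      unfolding tangency_set_def by (simp add: subset_iff) blast
    then show ?thesis by (auto simp del: Bex_def)
  qed
  also have "\<dots> \<in> sets ?H"
  proof -
    have [measurable]: "(\<lambda>y. pairing (indicator R y *\<^sub>R \<eta> y) (wedge (indicator U y *\<^sub>R \<omega> j y) (axis I 1))) \<in> borel_measurable ?H"
      if "j \<in> {..<?q}" for j I
      using \<omega>m that by (intro borel_measurable_inner borel_measurable_wedge) auto
    show ?thesis by measurable
  qed
  finally show ?thesis .
qed

text \<open>The forms \<open>\<omega>' \<and> \<beta>\<close>, with \<open>\<omega>'\<close> close to the defining form \<open>\<omega>\<^sub>j\<close>, only see the part of
  the current that is not tangent to the distribution.\<close>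

lemma tangential_negligible:
  fixes R :: "'n::{finite,linorder} euclid set"
  assumes repr: "integral_repr \<Omega> h T R \<eta> \<theta>" and h: "h \<ge> 1"
    and df: "defining_forms 1 k D U \<omega>" and U: "open U" "x \<in> U" and j: "j < CARD('n) - k"
    and w: "\<And>r. w r \<in> borel_measurable borel" "\<And>r y. r > 0 \<Longrightarrow> \<bar>w r y\<bar> \<le> W r"
      "\<And>r y. r > 0 \<Longrightarrow> y \<notin> ball x r \<Longrightarrow> w r y = 0"
    and \<omega>': "continuous_on UNIV \<omega>'"
    and close: "\<And>e. e > 0 \<Longrightarrow> \<forall>\<^sub>F r in at_right 0. \<forall>y\<in>ball x r. W r * norm (\<omega>' y - \<omega> j y) \<le> e"
    and nontangent: "((\<lambda>r. W r * (LINT y:(ball x r \<inter> (R - tangency_set \<Omega> h \<eta> D))|hausdorff_measure h. \<theta> y) / r ^ p)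
      \<longlongrightarrow> 0) (at_right 0)"
    and dens: "\<forall>\<^sub>F r in at_right 0. (LINT y:ball x r|hausdorff_measure h. indicator R y * \<theta> y) \<le> C * r ^ p"
    and \<beta>: "\<beta> \<in> graded (h - 1)" and e: "e > 0"
  shows "\<forall>\<^sub>F r in at_right 0.
    set_integrable (hausdorff_measure h) R (\<lambda>y. pairing (\<eta> y) (w r y *\<^sub>R wedge (\<omega>' y) \<beta>) * \<theta> y) \<and>
    \<bar>LINT y:R|hausdorff_measure h. pairing (\<eta> y) (w r y *\<^sub>R wedge (\<omega>' y) \<beta>) * \<theta> y\<bar> \<le> e * r ^ p"
proof -
  let ?H = "hausdorff_measure h :: 'n euclid measure"
  let ?\<Gamma> = "tangency_set \<Omega> h \<eta> D"
  obtain K where K: "K > 0" "\<And>a b :: 'n exterior. norm (wedge a b) \<le> norm a * norm b * K"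
    using wedge.pos_bounded by blast
  define M where "M = norm (\<omega> j x) + 1"
  have M: "M > 0" by (simp add: M_def add_nonneg_pos)
  define A where "A = (norm \<beta> + 1) * K"
  have A: "A > 0" "norm \<beta> * K \<le> A" using K by (auto simp: A_def add_nonneg_pos)
  define C' where "C' = \<bar>C\<bar> + 1"
  have C': "C' > 0" "C \<le> C'" by (auto simp: C'_def)
  \<comment> \<open>The final bound is \<open>A * (M * e2 + e1 * C')\<close> times
    \<open>r ^ p\<close>; these values make each of its two terms e/2.\<close>
  define e1 where "e1 = e / (2 * A * C')"
  define e2 where "e2 = e / (2 * A * M)"
  have e12: "e1 > 0" "e2 > 0" using e A C' M by (auto simp: e1_def e2_def)
  have cont: "continuous_on U (\<omega> j)"
    using df j by (auto simp: defining_forms_def differentiable_imp_continuous_on)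
  have "\<forall>\<^sub>F r in at_right 0. ball x r \<subseteq> U \<and> (\<forall>y\<in>ball x r. norm (\<omega> j y) \<le> M)"
  proof -
    obtain d1 where d1: "d1 > 0" "ball x d1 \<subseteq> U" using U by (meson openE)
    obtain d2 where d2: "d2 > 0" "\<And>y. y \<in> U \<Longrightarrow> dist y x < d2 \<Longrightarrow> dist (\<omega> j y) (\<omega> j x) < 1"
      using cont U(2) unfolding continuous_on_iff by (metis zero_less_one)
    show ?thesis
    proof (rule eventually_at_rightI[of 0 "min d1 d2"])
      fix r assume r: "r \<in> {0<..<min d1 d2}"
      then have sub: "ball x r \<subseteq> U" using d1(2) subset_ball[of r d1 x] by auto
      moreover have "norm (\<omega> j y) \<le> M" if "y \<in> ball x r" for y
        using d2(2)[of y] that r sub norm_triangle_ineq2[of "\<omega> j y" "\<omega> j x"]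
        by (auto simp: M_def dist_norm norm_minus_commute)
      ultimately show "ball x r \<subseteq> U \<and> (\<forall>y\<in>ball x r. norm (\<omega> j y) \<le> M)" by blast
    qed (use d1 d2 in auto)
  qed
  moreover have "\<forall>\<^sub>F r in at_right (0::real). r > 0" by (rule eventually_at_right_less)
  moreover have "\<forall>\<^sub>F r in at_right 0.
      dist (W r * (LINT y:(ball x r \<inter> (R - ?\<Gamma>))|?H. \<theta> y) / r ^ p) 0 < e2"
    using nontangent e12(2) by (rule tendstoD)
  ultimately show ?thesis
    using close[OF e12(1)] dens
  proof eventually_elim
    case (elim r)
    have BU: "ball x r \<subseteq> U" and bM: "\<And>y. y \<in> ball x r \<Longrightarrow> norm (\<omega> j y) \<le> M" and r: "r > 0"
      and cl: "\<And>y. y \<in> ball x r \<Longrightarrow> W r * norm (\<omega>' y - \<omega> j y) \<le> e1"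
      using elim by auto
    have W0: "W r \<ge> 0" using w(2)[OF r, of x] by (meson abs_ge_zero order_trans)
    let ?N = "ball x r \<inter> (R - ?\<Gamma>)"
    have N: "?N \<in> sets ?H"
      by (rule tangency_set_measurable[OF repr h df U(1) _ BU]) auto
    \<comment> \<open>The first term bounds the contribution of the defining form, of size at most M
      and present off the tangency set only. The second one bounds the error of \<omega>' on the
      whole ball.\<close>
    define b where "b y = A * (M * W r * (indicator ?N y *\<^sub>R (indicator R y * \<theta> y)) +
      e1 * (indicator (ball x r) y *\<^sub>R (indicator R y * \<theta> y)))" for y
    have \<theta>0: "indicator R y * \<theta> y \<ge> 0" for y
      using integral_repr_ge_1[OF repr, of y] by (auto simp: indicator_def)
    have i1: "integrable ?H (\<lambda>y. indicator ?N y *\<^sub>R (indicator R y * \<theta> y))"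
      by (rule integrable_mult_indicator[OF N integral_repr_weight[OF repr]])
    have i2: "integrable ?H (\<lambda>y. indicator (ball x r) y *\<^sub>R (indicator R y * \<theta> y))"
      by (rule integrable_mult_indicator[OF _ integral_repr_weight[OF repr]]) auto
    have b_int: "integrable ?H b"
      unfolding b_def[abs_def]
      by (intro integrable_mult_right Bochner_Integration.integrable_add i1 i2)
    have b0: "0 \<le> b y" for y
      unfolding b_def using A M W0 e12 \<theta>0 by (intro mult_nonneg_nonneg add_nonneg_nonneg) auto
    have bb: "\<bar>pairing (\<eta> y) (w r y *\<^sub>R wedge (\<omega>' y) \<beta>) * \<theta> y\<bar> \<le> b y" if y: "y \<in> R" for y
    proof (cases "y \<in> ball x r")
      case False
      with w(3)[OF r] b0 show ?thesis by simp
    next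
      case True
      have \<theta>y: "\<theta> y > 0" using integral_repr_ge_1[OF repr y] by simp
      have \<eta>1: "norm (\<eta> y) = 1" using integral_repr_orientation[OF repr y] by simp
      have pw: "\<bar>pairing (\<eta> y) (wedge a \<beta>)\<bar> \<le> norm a * A" for a
      proof -
        have "\<bar>pairing (\<eta> y) (wedge a \<beta>)\<bar> \<le> norm (\<eta> y) * norm (wedge a \<beta>)" by (rule Cauchy_Schwarz_ineq2)
        also have "\<dots> \<le> norm a * (norm \<beta> * K)" using K(2)[of a \<beta>] \<eta>1 by (simp add: mult.assoc)
        also have "\<dots> \<le> norm a * A" using A by (intro mult_left_mono) auto
        finally show ?thesis .
      qed
      \<comment> \<open>Where \<eta> is tangent, the defining form annihilates its span, so the
        pairing is zero by \<open>mv_span_annihilates_iff\<close>.\<close>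
      have tan: "\<bar>pairing (\<eta> y) (wedge (\<omega> j y) \<beta>)\<bar> \<le> A * M * indicator ?N y"
      proof (cases "y \<in> ?\<Gamma>")
        case in\<Gamma>: True
        then have "\<forall>z\<in>mv_span h (\<eta> y). pairing (embed1 z) (\<omega> j y) = 0"
          using defining_formsD(1)[OF df subsetD[OF BU True]] j by (auto simp: tangency_set_def)
        moreover have "\<omega> j y \<in> graded 1" using df j True BU by (auto simp: defining_forms_def)
        ultimately have "pairing (\<eta> y) (wedge (\<omega> j y) \<beta>) = 0"
          using mv_span_annihilates_iff[OF integral_repr_orientation(1)[OF repr y] h] \<beta> by blast
        then show ?thesis using A M by simp
      next
        case False
        then have "y \<in> ?N" using y True by simp
        moreover have "norm (\<omega> j y) * A \<le> M * A" using bM[OF True] A by (intro mult_right_mono) auto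
        ultimately show ?thesis using pw[of "\<omega> j y"] by (simp add: mult.commute)
      qed
      have "\<bar>pairing (\<eta> y) (w r y *\<^sub>R wedge (\<omega>' y) \<beta>)\<bar> = \<bar>w r y\<bar> *
         \<bar>pairing (\<eta> y) (wedge (\<omega> j y) \<beta>) + pairing (\<eta> y) (wedge (\<omega>' y - \<omega> j y) \<beta>)\<bar>"
        by (simp add: abs_mult inner_add_right[symmetric] wedge.add_left[symmetric])
      also have "\<dots> \<le> W r * (A * M * indicator ?N y + norm (\<omega>' y - \<omega> j y) * A)"
        using w(2)[OF r, of y] tan pw[of "\<omega>' y - \<omega> j y"] W0
        by (intro mult_mono order_trans[OF abs_triangle_ineq] add_mono) auto
      also have "\<dots> = A * (M * W r * indicator ?N y + W r * norm (\<omega>' y - \<omega> j y))"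
        by (simp add: algebra_simps)
      also have "\<dots> \<le> A * (M * W r * indicator ?N y + e1)"
        using cl[OF True] A by (intro mult_left_mono add_left_mono) auto
      finally have "\<bar>pairing (\<eta> y) (w r y *\<^sub>R wedge (\<omega>' y) \<beta>)\<bar> * \<theta> y \<le>
          A * (M * W r * indicator ?N y + e1) * \<theta> y"
        using \<theta>y by (intro mult_right_mono) auto
      also have "\<dots> = b y" using y True by (simp add: b_def algebra_simps)
      finally show ?thesis using \<theta>y by (simp add: abs_mult)
    qed
    have F: "(\<lambda>y. w r y *\<^sub>R wedge (\<omega>' y) \<beta>) \<in> borel_measurable borel"
      using w(1)[of r] borel_measurable_continuous_onI[OF \<omega>']
      by (intro borel_measurable_scaleR borel_measurable_wedge) auto
    have "(LINT y|?H. b y) = A * (M * W r * (LINT y:?N|?H. indicator R y * \<theta> y) +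
       e1 * (LINT y:ball x r|?H. indicator R y * \<theta> y))"
      unfolding b_def set_lebesgue_integral_def
      by (subst integral_mult_right_zero, subst Bochner_Integration.integral_add)
         (auto intro!: integrable_mult_right i1[simplified] i2[simplified])
    also have "(LINT y:?N|?H. indicator R y * \<theta> y) = (LINT y:?N|?H. \<theta> y)"
      unfolding set_lebesgue_integral_def by (intro Bochner_Integration.integral_cong) (auto simp: indicator_def)
    also have "A * (M * W r * (LINT y:?N|?H. \<theta> y) + e1 * (LINT y:ball x r|?H. indicator R y * \<theta> y)) \<le>
       A * (M * (e2 * r ^ p) + e1 * (C' * r ^ p))"
    proof -
      have "W r * (LINT y:?N|?H. \<theta> y) / r ^ p < e2"
        using elim(3) unfolding dist_real_def by linarith
      then have "W r * (LINT y:?N|?H. \<theta> y) \<le> e2 * r ^ p" using r by (simp add: divide_less_eq)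
      moreover have "C * r ^ p \<le> C' * r ^ p" using C' r by (intro mult_right_mono) auto
      then have "(LINT y:ball x r|?H. indicator R y * \<theta> y) \<le> C' * r ^ p" using elim(5) by linarith
      ultimately show ?thesis
        using A M e12 unfolding mult.assoc by (intro mult_left_mono add_mono) auto
    qed
    also have "\<dots> = e * r ^ p"
      using A M C' by (simp add: e1_def e2_def field_simps)
    finally have "(LINT y|?H. b y) \<le> e * r ^ p" .
    with integral_repr_pairing_integrable[OF repr F b_int bb b0] show ?case by auto
  qed
qed


section \<open>Test forms built from the bump\<close>

lemma bump_algebra_affine:
  fixes f :: "'n::finite euclid \<Rightarrow> real"
  assumes "linear f"
  shows "bump_algebra c r (\<lambda>y. a + f (y - z))"
proof -
  interpret linear f by fact
  have expand: "f y = (\<Sum>i\<in>UNIV. f (axis i 1) * y $ i)" for y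
  proof -
    have "y = (\<Sum>i\<in>UNIV. y $ i *\<^sub>R axis i 1)"
      using basis_expansion[of y] by (simp only: scalar_mult_eq_scaleR)
    then have "f y = f (\<Sum>i\<in>UNIV. y $ i *\<^sub>R axis i 1)" by (rule arg_cong)
    also have "\<dots> = (\<Sum>i\<in>UNIV. f (axis i 1) * y $ i)"
      by (simp only: sum scale real_scaleR_def mult.commute)
    finally show ?thesis .
  qed
  have "(\<lambda>y. a + f (y - z)) = (\<lambda>y. (a - f z) + (\<Sum>i\<in>UNIV. f (axis i 1) * y $ i))"
    unfolding expand[symmetric] diff by (simp add: algebra_simps)
  then show ?thesis by (auto intro!: bump_algebra.intros bump_algebra_sum)
qed

lemma test_formsI:
  fixes \<zeta> :: "'n::finite euclid \<Rightarrow> 'n exterior"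
  assumes "\<And>I. bump_algebra c r (\<lambda>y. \<zeta> y $ I)" "\<And>y. \<zeta> y \<in> graded h"
    "cball c r \<subseteq> \<Omega>" "\<And>y. y \<notin> ball c r \<Longrightarrow> \<zeta> y = 0"
  shows "\<zeta> \<in> test_forms \<Omega> h"
proof -
  have "\<forall>p. C_on p \<zeta> UNIV" using bump_algebra_C_on[OF assms(1)] by blast
  moreover have "y \<notin> cball c r \<Longrightarrow> \<zeta> y = 0" for y by (rule assms(4)) auto
  ultimately show ?thesis
    using assms(2,3) by (auto simp: test_forms_def intro!: exI[of _ "cball c r"])
qed

text \<open>Leibniz: d\<zeta> = \<phi> d\<omega>' \<and> \<alpha> + d\<phi> \<and> \<omega>' \<and>
  \<alpha>. The second product is written with \<omega>' in front, which costs the minus sign,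
  because \<open>tangential_negligible\<close> handles forms \<omega>' \<and> \<beta>; here \<beta>
  = e_i \<and> \<alpha>.\<close>

lemma
  fixes L :: "'n::{finite,linorder} euclid \<Rightarrow> 'n exterior"
  assumes L: "linear L" "\<And>v. L v \<in> graded 1" and \<omega>0: "\<omega>0 \<in> graded 1" and \<alpha>: "\<alpha> \<in> graded p"
    and r: "r > 0" "cball c r \<subseteq> \<Omega>"
  defines "\<zeta> \<equiv> \<lambda>y. bump c r y *\<^sub>R wedge (\<omega>0 + L (y - c)) \<alpha>"
  shows bump_form_test: "\<zeta> \<in> test_forms \<Omega> (1 + p)"
    and ext_deriv_bump_form: "ext_deriv \<zeta> = (\<lambda>y. bump c r y *\<^sub>R (\<Sum>i\<in>UNIV. wedge (axis {i} 1) (wedge (L (axis i 1)) \<alpha>)) -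
      (\<Sum>i\<in>UNIV. (bump_grad c r y $ i) *\<^sub>R wedge (\<omega>0 + L (y - c)) (wedge (axis {i} 1) \<alpha>)))"
    and ext_deriv_bump_form_test: "ext_deriv \<zeta> \<in> test_forms \<Omega> (1 + (1 + p))"
proof -
  interpret L: linear L by (rule L)
  let ?w = "\<lambda>y. \<omega>0 + L (y - c)"
  have w1: "?w y \<in> graded 1" for y
    by (rule subspace_add[OF subspace_graded \<omega>0 L(2)])
  have "linear (\<lambda>v. wedge (L v) \<alpha> $ I)" for I
    by (rule linearI) (auto simp: L.add L.scale wedge.add_left wedge.scaleR_left)
  then have "bump_algebra c r (\<lambda>y. wedge \<omega>0 \<alpha> $ I + wedge (L (y - c)) \<alpha> $ I)" for I
    by (rule bump_algebra_affine)
  then have alg: "bump_algebra c r (\<lambda>y. \<zeta> y $ I)" for I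
    unfolding \<zeta>_def by (auto simp: wedge.add_left intro!: bump_algebra.mult bump_algebra_bump)
  have gr: "\<zeta> y \<in> graded (1 + p)" for y
    unfolding \<zeta>_def by (intro subspace_scale[OF subspace_graded] graded_wedge w1 \<alpha>)
  show "\<zeta> \<in> test_forms \<Omega> (1 + p)"
    by (rule test_formsI[OF alg gr r(2)]) (simp add: \<zeta>_def bump_outside[OF r(1)] del: mem_ball)
  have bl: "bounded_linear (\<lambda>v. wedge (L v) \<alpha>)"
    by (rule linear_conv_bounded_linear[THEN iffD1], rule linearI)
       (auto simp: L.add L.scale wedge.add_left wedge.scaleR_left)
  have "((\<lambda>y. wedge (?w y) \<alpha>) has_derivative (\<lambda>v. wedge (L v) \<alpha>)) (at y)" for y
  proof -
    have "((\<lambda>y. wedge (\<omega>0 - L c) \<alpha> + wedge (L y) \<alpha>) has_derivative (\<lambda>v. 0 + wedge (L v) \<alpha>)) (at y)"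
      by (intro has_derivative_add has_derivative_const bounded_linear_imp_has_derivative bl)
    then show ?thesis by (simp add: L.diff wedge.add_left wedge.diff_left algebra_simps)
  qed
  from has_derivative_scaleR[OF has_derivative_bump this]
  have D: "(\<zeta> has_derivative (\<lambda>v. bump c r y *\<^sub>R wedge (L v) \<alpha> + (bump_grad c r y \<bullet> v) *\<^sub>R wedge (?w y) \<alpha>)) (at y)" for y
    unfolding \<zeta>_def .
  have part: "partial i \<zeta> y = bump c r y *\<^sub>R wedge (L (axis i 1)) \<alpha> + (bump_grad c r y $ i) *\<^sub>R wedge (?w y) \<alpha>" for i y
    by (subst partial_eq[OF D]) (simp add: inner_axis)
  have swap: "wedge (axis {i} 1) (wedge (?w y) \<alpha>) = - wedge (?w y) (wedge (axis {i} 1) \<alpha>)" for i y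
    unfolding embed1_axis[symmetric]
    by (subst (1 2) graded1_eq_embed1[OF w1]) (rule wedge_embed1_anticommute)
  show ext: "ext_deriv \<zeta> = (\<lambda>y. bump c r y *\<^sub>R (\<Sum>i\<in>UNIV. wedge (axis {i} 1) (wedge (L (axis i 1)) \<alpha>)) -
      (\<Sum>i\<in>UNIV. (bump_grad c r y $ i) *\<^sub>R wedge (?w y) (wedge (axis {i} 1) \<alpha>)))"
    unfolding ext_deriv_def part
    by (simp add: wedge.add_right wedge.scaleR_right sum.distrib scaleR_sum_right swap sum_negf sum_subtractf)
  \<comment> \<open>The integral representation of T applies to test forms only, so d\<zeta> has to
    be recognised as one.\<close>
  show "ext_deriv \<zeta> \<in> test_forms \<Omega> (1 + (1 + p))"
  proof (rule test_formsI[OF _ _ r(2)])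
    show "bump_algebra c r (\<lambda>y. ext_deriv \<zeta> y $ I)" for I
    proof -
      have "bump_algebra c r (\<lambda>y. wedge (axis {i} 1) (partial i \<zeta> y) $ I)" for i
        unfolding wedge_axis_left using bump_algebra_vec_deriv(2)[OF alg]
        by (cases "i \<in> I") (auto intro!: bump_algebra.const bump_algebra.mult)
      then show ?thesis by (auto simp: ext_deriv_def intro: bump_algebra_sum)
    qed
    have "partial i \<zeta> y \<in> graded (1 + p)" for i y
      unfolding part
      by (intro subspace_add[OF subspace_graded] subspace_scale[OF subspace_graded] graded_wedge w1 \<alpha> L(2))
    moreover have "axis {i} 1 \<in> graded 1" for i :: 'n using axis_graded[of "{i}"] by simp
    ultimately show "ext_deriv \<zeta> y \<in> graded (1 + (1 + p))" for y
      unfolding ext_deriv_def by (intro subspace_sum[OF subspace_graded] graded_wedge)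
    show "ext_deriv \<zeta> y = 0" if "y \<notin> ball c r" for y
      using that by (simp add: ext bump_outside[OF r(1)] bump_grad_outside[OF r(1)] del: mem_ball)
  qed
qed

section \<open>Involutivity at a single good point\<close>

lemma derivative_graded:
  assumes "(f has_derivative L) (at x)" "open U" "x \<in> U" "\<And>y. y \<in> U \<Longrightarrow> f y \<in> graded h"
  shows "L v \<in> graded h"
  unfolding graded_def
proof (intro CollectI allI impI)
  fix I assume nz: "L v $ I \<noteq> 0"
  show "card I = h"
  proof (rule ccontr)
    assume I: "card I \<noteq> h"
    have "((\<lambda>y. f y $ I) has_derivative (\<lambda>v. L v $ I)) (at x)"
      by (rule bounded_linear.has_derivative[OF bounded_linear_vec_nth assms(1)])
    moreover have "((\<lambda>y. f y $ I) has_derivative (\<lambda>v. 0)) (at x)"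
    proof (rule has_derivative_transform_within_open[OF _ assms(2,3)])
      show "((\<lambda>y. 0) has_derivative (\<lambda>v. 0)) (at x)" by simp
      show "0 = f y $ I" if "y \<in> U" for y using assms(4)[OF that] I by (auto simp: graded_def)
    qed
    ultimately have "(\<lambda>v. L v $ I) = (\<lambda>v. 0)" by (rule has_derivative_unique)
    with nz show False by metis
  qed
qed

text \<open>The properties valid at almost every point of R, and those defining J, are gathered as
  hypotheses, so the argument is purely pointwise. In \<open>dens'\<close> a (k - 1)-dimensional
  measure is compared with r^k.\<close>

lemma involutive_at_good_point:
  fixes R R' :: "'n::{finite,linorder} euclid set"
  assumes k: "k \<ge> 2" and \<Omega>: "open \<Omega>"
    and dist: "distribution_of_class 1 \<Omega> k D"
    and repr: "integral_repr \<Omega> k T R \<eta> \<theta>"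
    and repr': "integral_repr \<Omega> (k - 1) (boundary T) R' \<eta>' \<theta>'"
    and x: "x \<in> R"
    and leb: "((\<lambda>r. (LINT y:(R \<inter> ball x r)|hausdorff_measure k. norm (\<theta> y *\<^sub>R \<eta> y - \<theta> x *\<^sub>R \<eta> x)) / r ^ k)
      \<longlongrightarrow> 0) (at_right 0)"
    and pos: "c > 0" "\<exists>\<^sub>F r in at_right 0. ennreal (c * r ^ k) \<le> hausdorff_outer k (R \<inter> ball x r)"
    and dens: "\<forall>\<^sub>F r in at_right 0. (LINT y:ball x r|hausdorff_measure k. indicator R y * \<theta> y) \<le> C * r ^ k"
    and dens': "\<forall>\<^sub>F r in at_right 0. (LINT y:ball x r|hausdorff_measure (k - 1). indicator R' y * \<theta>' y) \<le> C' * r ^ k"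
    and W: "subspace (mv_span k (\<eta> x))" "dim (mv_span k (\<eta> x)) = k"
    and nt: "((\<lambda>r. (LINT y:(ball x r \<inter> (R - tangency_set \<Omega> k \<eta> D))|hausdorff_measure k. \<theta> y)
          / r ^ (k + 1)) \<longlongrightarrow> 0) (at_right 0)"
    and nt': "((\<lambda>r. (LINT y:(ball x r \<inter> (R' - tangency_set \<Omega> (k - 1) \<eta>' D))|hausdorff_measure (k - 1). \<theta>' y)
          / r ^ k) \<longlongrightarrow> 0) (at_right 0)"
  shows "involutive_at \<Omega> k D x"
proof -
  let ?H = "hausdorff_measure k :: 'n euclid measure"
  let ?H' = "hausdorff_measure (k - 1) :: 'n euclid measure"
  let ?q = "CARD('n) - k"
  have x\<Omega>: "x \<in> \<Omega>" and \<eta>x: "\<eta> x \<in> graded k" "simple_vector k (\<eta> x)" "\<eta> x \<noteq> 0"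
    using integral_repr_orientation[OF repr x] by auto
  have \<theta>x: "\<theta> x \<noteq> 0" using integral_repr_ge_1[OF repr x] by simp
  have k1: "k \<ge> 1" "k - 1 \<ge> 1" using k by auto
  have R: "R \<in> sets ?H" "hausdorff_outer k R < \<infinity>" by (rule integral_repr_sets[OF repr])+
  obtain U \<omega> where U: "open U" "x \<in> U" "U \<subseteq> \<Omega>" and df: "defining_forms 1 k D U \<omega>"
    using dist x\<Omega> unfolding distribution_of_class_def by blast
  have bump_meas: "bump x r \<in> borel_measurable borel" for r
  proof -
    have "continuous_on UNIV (bump x r)"
      by (rule has_derivative_continuous_on) (rule has_derivative_bump)
    then show ?thesis by (rule borel_measurable_continuous_onI)
  qed
  have bump_grad_meas: "(\<lambda>y. bump_grad x r y $ i) \<in> borel_measurable borel" for r i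
  proof -
    have "continuous_on UNIV (\<lambda>y. exp_recip 2 (1 - (y - x) \<bullet> (y - x) / r\<^sup>2))"
      by (rule continuous_on_compose2[of UNIV "exp_recip 2"])
         (auto intro!: continuous_intros DERIV_continuous_on has_real_derivative_exp_recip simp: divide_inverse)
    then have "continuous_on UNIV (bump_grad x r)"
      unfolding bump_grad_def[abs_def] by (intro continuous_intros)
    then show ?thesis by (intro borel_measurable_continuous_onI continuous_intros) auto
  qed
  have cont: "continuous_on U (\<omega> j)" and diff: "\<omega> j differentiable (at x)" if "j < ?q" for j
    using df that U by (auto simp: defining_forms_def differentiable_imp_continuous_on
        differentiable_on_eq_differentiable_at)
  have gint: "set_integrable ?H R (\<lambda>y. \<theta> y *\<^sub>R \<eta> y)"
    by (rule integral_repr_vector_integrable[OF repr])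
  \<comment> \<open>Reduces each pointwise identity to an integral against the bump being o(r^k).
    The blow-up is done for the product of \<theta> and \<eta>; \<theta> x is nonzero and
    cancels.\<close>
  have blowup: "pairing (\<eta> x) \<zeta> = 0"
    if small: "\<And>e. e > 0 \<Longrightarrow> \<forall>\<^sub>F r in at_right 0.
      \<bar>LINT y:R|?H. pairing (\<eta> y) (bump x r y *\<^sub>R \<zeta>) * \<theta> y\<bar> \<le> e * r ^ k" for \<zeta>
  proof -
    have "(\<theta> x *\<^sub>R \<eta> x) \<bullet> \<zeta> = 0"
    proof (rule lebesgue_point_inner_eq_0[OF gint R leb pos bump_meas bump_bounds bump_outside _ bump_lower])
      show "\<forall>\<^sub>F r in at_right 0. \<bar>LINT y:R|?H. bump x r y * ((\<theta> y *\<^sub>R \<eta> y) \<bullet> \<zeta>)\<bar> \<le> e * r ^ k"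
        if "e > 0" for e using small[OF that] by (simp add: mult_ac)
    qed simp_all
    with \<theta>x show ?thesis by simp
  qed
  have rpos: "\<forall>\<^sub>F r in at_right (0::real). r > 0" by (rule eventually_at_right_less)
  have "mv_span k (\<eta> x) \<subseteq> D x"
  proof -
    have "pairing (\<eta> x) (wedge (\<omega> j x) \<beta>) = 0" if j: "j < ?q" and \<beta>: "\<beta> \<in> graded (k - 1)" for j \<beta>
    proof (rule blowup)
      fix e :: real assume e: "e > 0"
      have close: "\<forall>\<^sub>F r in at_right 0. \<forall>y\<in>ball x r. 1 * norm (\<omega> j x - \<omega> j y) \<le> e" if "e > 0" for e
      proof -
        obtain d where d: "d > 0" "\<And>y. y \<in> U \<Longrightarrow> dist y x < d \<Longrightarrow> dist (\<omega> j y) (\<omega> j x) < e"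
          using cont[OF j] U(2) \<open>e > 0\<close> unfolding continuous_on_iff by metis
        obtain d' where d': "d' > 0" "ball x d' \<subseteq> U" using U by (meson openE)
        show ?thesis
          by (rule eventually_at_rightI[of 0 "min d d'"])
             (use d d' in \<open>fastforce simp: dist_commute dist_norm[symmetric] subset_iff intro: less_imp_le\<close>)+
      qed
      \<comment> \<open>The bump is not differentiated here, so the weight is 1 and the density
        condition of order k + 1 is weakened to order k by a factor r.\<close>
      have "((\<lambda>r. r * ((LINT y:(ball x r \<inter> (R - tangency_set \<Omega> k \<eta> D))|?H. \<theta> y) / r ^ (k + 1)))
          \<longlongrightarrow> 0 * 0) (at_right 0)"
        by (intro tendsto_mult nt tendsto_ident_at)
      then have "((\<lambda>r. r * ((LINT y:(ball x r \<inter> (R - tangency_set \<Omega> k \<eta> D))|?H. \<theta> y) / r ^ (k + 1)))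
          \<longlongrightarrow> 0) (at_right 0)" by simp
      then have nt1: "((\<lambda>r. 1 * (LINT y:(ball x r \<inter> (R - tangency_set \<Omega> k \<eta> D))|?H. \<theta> y) / r ^ k)
          \<longlongrightarrow> 0) (at_right 0)"
      proof (rule Lim_transform_eventually)
        show "\<forall>\<^sub>F r in at_right 0. r * ((LINT y:(ball x r \<inter> (R - tangency_set \<Omega> k \<eta> D))|?H. \<theta> y) / r ^ (k + 1)) =
          1 * (LINT y:(ball x r \<inter> (R - tangency_set \<Omega> k \<eta> D))|?H. \<theta> y) / r ^ k"
          using rpos by eventually_elim simp
      qed
      show "\<forall>\<^sub>F r in at_right 0. \<bar>LINT y:R|?H. pairing (\<eta> y) (bump x r y *\<^sub>R wedge (\<omega> j x) \<beta>) * \<theta> y\<bar> \<le> e * r ^ k"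
        using tangential_negligible[where w = "bump x" and W = "\<lambda>_. 1" and \<omega>' = "\<lambda>_. \<omega> j x",
            OF repr k1(1) df U(1,2) j bump_meas _ bump_outside _ close nt1 dens \<beta> e]
        by (auto simp: bump_bounds elim: eventually_mono)
    qed
    then have "\<forall>v\<in>mv_span k (\<eta> x). pairing (embed1 v) (\<omega> j x) = 0" if "j < ?q" for j
      using mv_span_annihilates_iff[OF \<eta>x(1) k1(1) defining_formsD(2)[OF df U(2) that]] that by blast
    then show ?thesis using defining_formsD(1)[OF df U(2)] by blast
  qed
  moreover have "subspace (D x)" "dim (D x) = k"
    using dist x\<Omega> by (auto simp: distribution_of_class_def distribution_def)
  \<comment> \<open>An inclusion of k-dimensional subspaces is an equality; the span has dimension k
    because it is the approximate tangent plane.\<close>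
  ultimately have DW: "D x = mv_span k (\<eta> x)"
    using subspace_dim_equal[of "mv_span k (\<eta> x)" "D x"] W by simp
  have vanish: "pairing (wedge (embed1 v) (embed1 w)) (ext_deriv (\<omega> j) x) = 0"
    if j: "j < ?q" and vw: "v \<in> D x" "w \<in> D x" for j v w
  proof -
    define L where "L = frechet_derivative (\<omega> j) (at x)"
    have der: "(\<omega> j has_derivative L) (at x)"
      unfolding L_def by (rule frechet_derivative_works[THEN iffD1, OF diff[OF j]])
    have L: "linear L" by (rule has_derivative_linear[OF der])
    have L1: "L v \<in> graded 1" for v
      by (rule derivative_graded[OF der U(1,2) defining_formsD(2)[OF df _ j]])
    have \<omega>1: "\<omega> j x \<in> graded 1" by (rule defining_formsD(2)[OF df U(2) j])
    \<comment> \<open>Each L e_i has degree one, so d\<omega>(x) becomes a sum of products of two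
      1-covectors, the form that \<open>two_covector_vanishes\<close> takes.\<close>
    define b where "b i = (\<chi> m. L (axis i 1) $ {m})" for i
    have Lb: "L (axis i 1) = embed1 (b i)" for i
      unfolding b_def by (rule graded1_eq_embed1[OF L1])
    let ?w = "\<lambda>y. \<omega> j x + L (y - x)"
    have cont_w: "continuous_on UNIV ?w"
      by (intro continuous_intros continuous_on_compose2[OF linear_continuous_on[OF has_derivative_bounded_linear[OF der]], of UNIV]) auto
    have taylor: "\<forall>\<^sub>F r in at_right 0. \<forall>y\<in>ball x r. norm (?w y - \<omega> j y) \<le> e * r" if "e > 0" for e
    proof -
      obtain d where d: "d > 0" "\<And>y. norm (y - x) < d \<Longrightarrow> norm (\<omega> j y - \<omega> j x - L (y - x)) \<le> e * norm (y - x)"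
        using der \<open>e > 0\<close> unfolding has_derivative_at_alt by metis
      show ?thesis
      proof (rule eventually_at_rightI[of 0 d], intro ballI)
        fix r y assume r: "r \<in> {0<..<d}" and y: "y \<in> ball x r"
        have "norm (y - x) < r" using y by (simp add: dist_norm norm_minus_commute)
        then have "norm (\<omega> j y - \<omega> j x - L (y - x)) \<le> e * r"
          using d(2)[of y] r \<open>e > 0\<close> by (auto intro: order_trans mult_left_mono)
        then show "norm (?w y - \<omega> j y) \<le> e * r"
          by (metis (no_types, lifting) add.commute diff_diff_eq norm_minus_commute)
      qed (use d in simp)
    qed
    have "pairing (\<eta> x) (\<Sum>i\<in>UNIV. wedge (axis {i} 1) (wedge (L (axis i 1)) \<alpha>)) = 0"
      if \<alpha>: "\<alpha> \<in> graded (k - 2)" for \<alpha>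
    proof (rule blowup)
      fix e :: real assume e: "e > 0"
      let ?\<sigma> = "\<Sum>i\<in>UNIV. wedge (axis {i} 1) (wedge (L (axis i 1)) \<alpha>)"
      \<comment> \<open>One share for the boundary term and one for each of the CARD('n) components
        of the gradient.\<close>
      define e' where "e' = e / (CARD('n) + 1)"
      have e': "e' > 0" using e by (simp add: e'_def)
      have ev1: "\<forall>\<^sub>F r in at_right 0.
        \<bar>LINT y:R'|?H'. pairing (\<eta>' y) (bump x r y *\<^sub>R wedge (?w y) \<alpha>) * \<theta>' y\<bar> \<le> e' * r ^ k"
      proof -
        \<comment> \<open>On the boundary the weight is the bump itself, so closeness o(1) of
          \<omega>' to the defining form is enough.\<close>
        have close: "\<forall>\<^sub>F r in at_right 0. \<forall>y\<in>ball x r. 1 * norm (?w y - \<omega> j y) \<le> e" if "e > 0" for e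
        proof -
          have "\<forall>\<^sub>F r in at_right (0::real). r < 1"
            by (rule eventually_at_rightI[of 0 1]) auto
          with taylor[OF that] rpos show ?thesis
          proof eventually_elim
            case (elim r)
            then have "e * r \<le> e" using that by simp
            with elim(1) show ?case by (auto intro: order_trans)
          qed
        qed
        have \<alpha>': "\<alpha> \<in> graded (k - 1 - 1)" using \<alpha> by (simp add: numeral_2_eq_2)
        have nt1: "((\<lambda>r. 1 * (LINT y:(ball x r \<inter> (R' - tangency_set \<Omega> (k - 1) \<eta>' D))|?H'. \<theta>' y) / r ^ k)
          \<longlongrightarrow> 0) (at_right 0)" using nt' by simp
        show ?thesis
          using tangential_negligible[where w = "bump x" and W = "\<lambda>_. 1",
            OF repr' k1(2) df U(1,2) j bump_meas _ bump_outside cont_w close nt1 dens' \<alpha>' e']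
          by (auto simp: bump_bounds elim: eventually_mono)
      qed
      \<comment> \<open>The weight is now a component of the gradient, of size at most
        \<open>4 / r\<close>: the Taylor error o(r) becomes o(1), and the nontangential mass
        o(r^(k+1)) becomes o(r^k).\<close>
      have ev2: "\<forall>\<^sub>F r in at_right 0.
        set_integrable ?H R (\<lambda>y. pairing (\<eta> y) ((bump_grad x r y $ i) *\<^sub>R wedge (?w y) (wedge (axis {i} 1) \<alpha>)) * \<theta> y) \<and>
        \<bar>LINT y:R|?H. pairing (\<eta> y) ((bump_grad x r y $ i) *\<^sub>R wedge (?w y) (wedge (axis {i} 1) \<alpha>)) * \<theta> y\<bar> \<le> e' * r ^ k" for i
      proof (rule tangential_negligible[OF repr k1(1) df U(1,2) j bump_grad_meas _ _ cont_w _ _ dens _ e'])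
        show "\<bar>bump_grad x r y $ i\<bar> \<le> 4 / r" if "r > 0" for r y
          using component_le_norm_cart[of "bump_grad x r y" i] norm_bump_grad_le[OF that, of x y] by linarith
        show "bump_grad x r y $ i = 0" if "r > 0" "y \<notin> ball x r" for r y
          using bump_grad_outside[OF that] by simp
        show "\<forall>\<^sub>F r in at_right 0. \<forall>y\<in>ball x r. 4 / r * norm (?w y - \<omega> j y) \<le> e" if "e > 0" for e
        proof -
          have "e / 4 > 0" using that by simp
          from taylor[OF this] rpos show ?thesis
            by eventually_elim (auto simp: field_simps)
        qed
        have "((\<lambda>r. 4 * ((LINT y:(ball x r \<inter> (R - tangency_set \<Omega> k \<eta> D))|?H. \<theta> y) / r ^ (k + 1)))
          \<longlongrightarrow> 4 * 0) (at_right 0)"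
          by (intro tendsto_mult nt tendsto_const)
        then show "((\<lambda>r. 4 / r * (LINT y:(ball x r \<inter> (R - tangency_set \<Omega> k \<eta> D))|?H. \<theta> y) / r ^ k)
          \<longlongrightarrow> 0) (at_right 0)" by (simp add: mult.assoc)
        have "axis {i} 1 \<in> graded 1" using axis_graded[of "{i}"] by simp
        from graded_wedge[OF this \<alpha>] have "wedge (axis {i} 1) \<alpha> \<in> graded (1 + (k - 2))" .
        moreover have "1 + (k - 2) = k - 1" using k by simp
        ultimately show "wedge (axis {i} 1) \<alpha> \<in> graded (k - 1)" by simp
      qed
      have "\<forall>\<^sub>F r in at_right 0. cball x r \<subseteq> \<Omega>"
      proof -
        obtain d where d: "d > 0" "cball x d \<subseteq> \<Omega>" using \<Omega> x\<Omega> by (meson open_contains_cball)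
        show ?thesis
          by (rule eventually_at_rightI[of 0 d]) (use d in \<open>auto simp: subset_iff\<close>)
      qed
      moreover have "\<forall>\<^sub>F r in at_right 0. \<forall>i\<in>UNIV.
        set_integrable ?H R (\<lambda>y. pairing (\<eta> y) ((bump_grad x r y $ i) *\<^sub>R wedge (?w y) (wedge (axis {i} 1) \<alpha>)) * \<theta> y) \<and>
        \<bar>LINT y:R|?H. pairing (\<eta> y) ((bump_grad x r y $ i) *\<^sub>R wedge (?w y) (wedge (axis {i} 1) \<alpha>)) * \<theta> y\<bar> \<le> e' * r ^ k"
        using ev2 by (intro eventually_ball_finite) auto
      ultimately show "\<forall>\<^sub>F r in at_right 0. \<bar>LINT y:R|?H. pairing (\<eta> y) (bump x r y *\<^sub>R ?\<sigma>) * \<theta> y\<bar> \<le> e * r ^ k"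
        using ev1 rpos
      proof eventually_elim
        case (elim r)
        let ?\<zeta> = "\<lambda>y. bump x r y *\<^sub>R wedge (?w y) \<alpha>"
        let ?G = "\<lambda>i y. pairing (\<eta> y) ((bump_grad x r y $ i) *\<^sub>R wedge (?w y) (wedge (axis {i} 1) \<alpha>)) * \<theta> y"
        let ?B = "\<lambda>y. pairing (\<eta> y) (bump x r y *\<^sub>R ?\<sigma>) * \<theta> y"
        \<comment> \<open>With truncated subtraction both identities depend on k \<ge> 2.\<close>
        have kk: "1 + (k - 2) = k - 1" "1 + (1 + (k - 2)) = k" using k by auto
        note form = L L1 \<omega>1 \<alpha> elim(4) elim(1)
        have \<zeta>: "?\<zeta> \<in> test_forms \<Omega> (k - 1)" "ext_deriv ?\<zeta> \<in> test_forms \<Omega> k"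
          using bump_form_test[OF form, unfolded kk(1)] ext_deriv_bump_form_test[OF form, unfolded kk(2)] .
        have Gint: "set_integrable ?H R (?G i)" for i using elim(2) by blast
        have Bint: "set_integrable ?H R ?B"
        proof (rule integral_repr_pairing_integrable(1)[OF repr])
          show "(\<lambda>y. bump x r y *\<^sub>R ?\<sigma>) \<in> borel_measurable borel" using bump_meas[of r] by simp
          show "integrable ?H (\<lambda>y. norm ?\<sigma> * (indicator R y * \<theta> y))"
            by (intro integrable_mult_right integral_repr_weight[OF repr])
          show "0 \<le> norm ?\<sigma> * (indicator R y * \<theta> y)" for y
            using integral_repr_ge_1[OF repr, of y] by (auto simp: indicator_def)
          show "\<bar>?B y\<bar> \<le> norm ?\<sigma> * (indicator R y * \<theta> y)" if y: "y \<in> R" for y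
          proof -
            have "\<bar>pairing (\<eta> y) (bump x r y *\<^sub>R ?\<sigma>)\<bar> \<le> norm (\<eta> y) * norm (bump x r y *\<^sub>R ?\<sigma>)"
              by (rule Cauchy_Schwarz_ineq2)
            also have "\<dots> \<le> norm ?\<sigma>"
              using integral_repr_orientation(2)[OF repr y] bump_bounds[of x r y]
              by (simp add: mult_left_le_one_le)
            finally have "\<bar>pairing (\<eta> y) (bump x r y *\<^sub>R ?\<sigma>)\<bar> * \<theta> y \<le> norm ?\<sigma> * \<theta> y"
              using integral_repr_ge_1[OF repr y] by (intro mult_right_mono) auto
            then show ?thesis using integral_repr_ge_1[OF repr y] y by (simp add: abs_mult)
          qed
        qed
        have "boundary T ?\<zeta> = (LINT y:R'|?H'. pairing (\<eta>' y) (?\<zeta> y) * \<theta>' y)"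
          using repr' \<zeta>(1) by (auto simp: integral_repr_def rectifiable_repr_def)
        with elim(3) have "\<bar>boundary T ?\<zeta>\<bar> \<le> e' * r ^ k" by simp
        \<comment> \<open>The main term \<open>?B\<close> is isolated by linearity. Splitting the
          integral requires each piece to be integrable, which is why
          \<open>tangential_negligible\<close> asserts integrability as well.\<close>
        moreover have "boundary T ?\<zeta> = (LINT y:R|?H. ?B y) - (\<Sum>i\<in>UNIV. LINT y:R|?H. ?G i y)"
        proof -
          have "boundary T ?\<zeta> = (LINT y:R|?H. pairing (\<eta> y) (ext_deriv ?\<zeta> y) * \<theta> y)"
            unfolding boundary_def using repr \<zeta>(2) by (auto simp: integral_repr_def rectifiable_repr_def)
          also have "\<dots> = (LINT y:R|?H. ?B y - (\<Sum>i\<in>UNIV. ?G i y))"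
            unfolding ext_deriv_bump_form[OF form]
            by (simp only: inner_diff_right inner_sum_right left_diff_distrib sum_distrib_right)
          also have "\<dots> = (LINT y:R|?H. ?B y) - (LINT y:R|?H. (\<Sum>i\<in>UNIV. ?G i y))"
          proof (rule set_integral_diff(2)[OF Bint])
            show "set_integrable ?H R (\<lambda>y. \<Sum>i\<in>UNIV. ?G i y)"
              using Gint unfolding set_integrable_def scaleR_sum_right
              by (intro Bochner_Integration.integrable_sum) auto
          qed
          also have "(LINT y:R|?H. (\<Sum>i\<in>UNIV. ?G i y)) = (\<Sum>i\<in>UNIV. LINT y:R|?H. ?G i y)"
            using Gint unfolding set_lebesgue_integral_def set_integrable_def scaleR_sum_right
            by (intro Bochner_Integration.integral_sum) auto
          finally show ?thesis .
        qed
        moreover have "\<bar>\<Sum>i\<in>UNIV. LINT y:R|?H. ?G i y\<bar> \<le> (\<Sum>i\<in>(UNIV::'n set). e' * r ^ k)"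
          using elim(2) by (intro order_trans[OF sum_abs] sum_mono) blast
        then have "\<bar>\<Sum>i\<in>UNIV. LINT y:R|?H. ?G i y\<bar> \<le> CARD('n) * (e' * r ^ k)" by simp
        ultimately have "\<bar>LINT y:R|?H. ?B y\<bar> \<le> e' * r ^ k + CARD('n) * (e' * r ^ k)" by linarith
        also have "\<dots> = (CARD('n) + 1) * e' * r ^ k" by (simp add: algebra_simps)
        also have "(CARD('n) + 1) * e' = e" by (simp add: e'_def)
        finally show ?case .
      qed
    qed
    then have "pairing (wedge (embed1 v) (embed1 w)) (\<Sum>i\<in>UNIV. wedge (embed1 (axis i 1)) (embed1 (b i))) = 0"
      using vw unfolding DW Lb embed1_axis[symmetric] by (intro two_covector_vanishes[OF k \<eta>x(2,3)]) auto
    then show ?thesis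
      by (simp add: ext_deriv_def partial_eq[OF der] Lb embed1_axis)
  qed
  show ?thesis
    unfolding involutive_at_def using U df vanish by blast
qed

text \<open>Two vectors on one line are parallel, so v \<and> w = 0 and the condition on the
  differentials holds at every point.\<close>

lemma involutive_at_lines:
  fixes \<Omega> :: "'n::{finite,linorder} euclid set"
  assumes dist: "distribution_of_class 1 \<Omega> 1 D" and x: "x \<in> \<Omega>"
  shows "involutive_at \<Omega> 1 D x"
proof -
  obtain U \<omega> where U: "open U" "x \<in> U" "U \<subseteq> \<Omega>" and df: "defining_forms 1 1 D U \<omega>"
    using dist x unfolding distribution_of_class_def by blast
  have "dim (D x) = 1" using dist x by (auto simp: distribution_of_class_def distribution_def)
  then obtain B where B: "D x \<subseteq> span B" "card B = 1" using basis_exists[of "D x"] by metis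
  then obtain b where b: "D x \<subseteq> span {b}" by (auto simp: card_1_singleton_iff)
  have "wedge (embed1 v) (embed1 w) = 0" if vw: "v \<in> D x" "w \<in> D x" for v w
  proof -
    have "v \<in> span {b}" "w \<in> span {b}" using b vw by blast+
    then obtain s t where "v = s *\<^sub>R b" "w = t *\<^sub>R b" by (auto simp: span_singleton)
    moreover have "wedge (embed1 b) (embed1 b) = 0"
      using wedge_embed1_self[of b "axis {} 1"] by (simp add: wedge_unit_right)
    ultimately show ?thesis
      by (simp add: linear_scale[OF linear_embed1] wedge.scaleR_left wedge.scaleR_right)
  qed
  then show ?thesis unfolding involutive_at_def using U df by (intro exI[of _ U] exI[of _ \<omega>]) auto
qed

theorem corollary4p2:
  fixes \<Omega> :: "'n::{finite,linorder} euclid set"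
    and k :: nat
    and D :: "'n euclid \<Rightarrow> 'n euclid set"
    and T :: "'n functional"
    and R R' J :: "'n euclid set"
    and \<eta> \<eta>' :: "'n euclid \<Rightarrow> 'n exterior"
    and \<theta> \<theta>' :: "'n euclid \<Rightarrow> real"
  assumes "CARD('n) \<ge> 2" and "1 \<le> k" and "k \<le> CARD('n)" and "open \<Omega>"
    and "distribution_of_class 1 \<Omega> k D"
    and "integral_current \<Omega> k T"
    and "integral_repr \<Omega> k T R \<eta> \<theta>"
    and "integral_repr \<Omega> (k - 1) (boundary T) R' \<eta>' \<theta>'"
    and "J = {x\<in>\<Omega>.
      ((\<lambda>r. (LINT y:(ball x r \<inter> (R - tangency_set \<Omega> k \<eta> D))|hausdorff_measure k. \<theta> y)
          / r ^ (k + 1)) \<longlongrightarrow> 0) (at_right 0) \<and>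
      ((\<lambda>r. (LINT y:(ball x r \<inter> (R' - tangency_set \<Omega> (k - 1) \<eta>' D))|hausdorff_measure (k - 1). \<theta>' y)
          / r ^ k) \<longlongrightarrow> 0) (at_right 0)}"
  shows "AE x in hausdorff_measure k. x \<in> R \<longrightarrow> x \<in> J \<longrightarrow> involutive_at \<Omega> k D x"
proof (cases "k = 1")
  case True
  then show ?thesis using involutive_at_lines[of \<Omega> D] assms(5,9) by auto
next
  case False
  then have k: "k \<ge> 2" using assms(2) by simp
  note repr = assms(7) and repr' = assms(8)
  have R: "R \<in> sets (hausdorff_measure k)" "hausdorff_outer k R < \<infinity>"
    by (rule integral_repr_sets[OF repr])+
  have gint: "set_integrable (hausdorff_measure k) R (\<lambda>y. \<theta> y *\<^sub>R \<eta> y)"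
    by (rule integral_repr_vector_integrable[OF repr])
  have w0: "indicator S y * t y \<ge> 0" if "integral_repr \<Omega> h T' S n t" for S h T' n t y
    using integral_repr_ge_1[OF that, of y] by (auto simp: indicator_def)
  have tp: "AE x in hausdorff_measure k. x \<in> R \<longrightarrow> approx_tangent_plane k R x (mv_span k (\<eta> x))"
    using repr by (auto simp: integral_repr_def rectifiable_repr_def)
  show ?thesis
    using AE_lebesgue_point[OF gint R] AE_upper_density_pos[OF R(2)]
      AE_upper_density_integral[OF integral_repr_weight[OF repr] w0[OF repr], of k]
      AE_upper_density_integral[OF integral_repr_weight[OF repr'] w0[OF repr'], of k] tp
  proof eventually_elim
    case (elim x)
    show ?case
    proof (intro impI)
      assume x: "x \<in> R" and "x \<in> J"
      obtain C where C: "\<forall>\<^sub>F r in at_right 0.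
          (LINT y:ball x r|hausdorff_measure k. indicator R y * \<theta> y) \<le> C * r ^ k"
        using elim(3) by blast
      obtain C' where C': "\<forall>\<^sub>F r in at_right 0.
          (LINT y:ball x r|hausdorff_measure (k - 1). indicator R' y * \<theta>' y) \<le> C' * r ^ k"
        using elim(4) by blast
      \<comment> \<open>The lower density constant provided by
        \<open>AE_upper_density_pos\<close>.\<close>
      have c: "unit_ball_vol (real k) / 2 ^ Suc k > 0" by simp
      have W: "subspace (mv_span k (\<eta> x))" "dim (mv_span k (\<eta> x)) = k"
        using elim(5) x unfolding approx_tangent_plane_def by blast+
      show "involutive_at \<Omega> k D x"
        using \<open>x \<in> J\<close> unfolding assms(9)
        by (intro involutive_at_good_point[OF k assms(4,5) repr repr' x elim(1)[rule_format, OF x]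
              c elim(2)[rule_format, OF x] C C' W]) auto
    qed
  qed
qed

end
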